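(* For $j\in\frac12\mathbb N_+$ and any values $\bar\varepsilon_\pm\in\mathbb C$ and $k_\pm\in\mathbb C^*$, we have $$\big[\mathbf T^{(j)}(u),\ \bar\varepsilon_+\mathsf W_0+\bar\varepsilon_-\mathsf W_1\big]=0$$ if and only if $\bar k_\pm=0$.
   Context: **Conventions.** $q\in\mathbb C^*$ is not a root of unity, $\mathbb N=\{0,1,\dots\}$, $\mathbb N_+=\{1,2,\dots\}$, $[n]_q=\frac{q^n-q^{-n}}{q-q^{-1}}$, $[X,Y]=XY-YX$, $[X,Y]_q=qXY-q^{-1}YX$, $c(u)=u-u^{-1}$. Rational functions $1/p(u)$ are expanded in $u^{-1}$. $X_1=X\otimes\mathbb I$, $X_2=\mathbb I\otimes X$. $\sigma_\pm,\sigma_z$ are the Pauli matrices ($\sigma_+=E_{12}$, $\sigma_-=E_{21}$, $\sigma_z=\mathrm{diag}(1,-1)$). **Algebra $\mathcal A_q$.** $\rho=k_+k_-(q+q^{-1})^2$. $\mathcal A_q$ is the unital associative $\mathbb C$-algebra generated by $\mathsf W_{-k},\mathsf W_{k+1},\mathsf G_{k+1},\tilde{\mathsf G}_{k+1}$ ($k\in\mathbb N$) with, for all $k,l\in\mathbb N$: $[\mathsf W_0,\mathsf W_{k+1}]=[\mathsf W_{-k},\mathsf W_1]=\frac{\tilde{\mathsf G}_{k+1}-\mathsf G_{k+1}}{q+q^{-1}}$; $[\mathsf W_0,\mathsf G_{k+1}]_q=[\tilde{\mathsf G}_{k+1},\mathsf W_0]_q=\rho(\mathsf W_{-k-1}-\mathsf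 W_{k+1})$; $[\mathsf G_{k+1},\mathsf W_1]_q=[\mathsf W_1,\tilde{\mathsf G}_{k+1}]_q=\rho(\mathsf W_{k+2}-\mathsf W_{-k})$; $[\mathsf W_{-k},\mathsf W_{-l}]=[\mathsf W_{k+1},\mathsf W_{l+1}]=[\mathsf G_{k+1},\mathsf G_{l+1}]=[\tilde{\mathsf G}_{k+1},\tilde{\mathsf G}_{l+1}]=0$; $[\mathsf W_{-k},\mathsf W_{l+1}]+[\mathsf W_{k+1},\mathsf W_{-l}]=0$; $[\mathsf W_{-k},\mathsf G_{l+1}]+[\mathsf G_{k+1},\mathsf W_{-l}]=0$; $[\mathsf W_{-k},\tilde{\mathsf G}_{l+1}]+[\tilde{\mathsf G}_{k+1},\mathsf W_{-l}]=0$; $[\mathsf W_{k+1},\mathsf G_{l+1}]+[\mathsf G_{k+1},\mathsf W_{l+1}]=0$; $[\mathsf W_{k+1},\tilde{\mathsf G}_{l+1}]+[\tilde{\mathsf G}_{k+1},\mathsf W_{l+1}]=0$; $[\tilde{\mathsf G}_{k+1},\mathsf G_{l+1}]+[\mathsf G_{k+1},\tilde{\mathsf G}_{l+1}]=0$. Put $U=\frac{qu^2+q^{-1}u^{-2}}{q+q^{-1}}$ and $\mathsf W_+(u)=\sum_{k\ge0}\mathsf W_{-k}U^{-k-1}$, $\mathsf W_-(u)=\sum_{k\ge0}\mathsf W_{k+1}U^{-k-1}$, $\mathsf G_+(u)=\sum_{k\ge0}\mathsf G_{k+1}U^{-k-1}$, $\mathsf G_-(u)=\sum_{k\ge0}\tilde{\mathsf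 G}_{k+1}U^{-k-1}$, and $$\mathcal K^{(\frac12)}(u)=\begin{pmatrix}uq\mathsf W_+(u)-u^{-1}q^{-1}\mathsf W_-(u)&\frac{\mathsf G_+(u)}{k_-(q+q^{-1})}+\frac{k_+(q+q^{-1})}{q-q^{-1}}\\ \frac{\mathsf G_-(u)}{k_+(q+q^{-1})}+\frac{k_-(q+q^{-1})}{q-q^{-1}}&uq\mathsf W_-(u)-u^{-1}q^{-1}\mathsf W_+(u)\end{pmatrix}.$$ **Spin matrices, fusion maps, R-matrices.** $B_{j,j'}=\sqrt{[j+j']_q[j-j'+1]_q}$; $(S_+)_{mn}=B_{j,j+1-m}\delta_{m,n-1}$, $(S_-)_{mn}=B_{j,j+1-n}\delta_{m-1,n}$, $(S_3)_{mn}=2(j+1-n)\delta_{m,n}$. $\mathcal E^{(j)}:\mathbb C^{2j+1}\to\mathbb C^2\otimes\mathbb C^{2j}$ has nonzero entries $\mathcal E_{1,1}=1$, $\mathcal E_{1+n,1+n}=\prod_{p=0}^{n-1}\frac{B_{j-1/2,j-p-1/2}}{B_{j,j-p}}$ ($1\le n\le2j-1$), $\mathcal E_{2j+m,1+m}=[m]_q\mathcal E_{m,m}/B_{j,j+1-m}$ ($1\le m\le 2j$). $\mathcal F^{(j)}:\mathbb C^2\otimes\mathbb C^{2j}\to\mathbb C^{2j+1}$ has nonzero entries $\mathcal F_{1,1}=1$, $\mathcal F_{n,n+2j-1}=\frac{\mathcal E_{n+2j-1,n}}{\mathcal E_{n,n}^2+\mathcal E_{n+2j-1,n}^2}$, $\mathcal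 F_{n,n}=\frac{1-\mathcal F_{n,n+2j-1}\mathcal E_{n+2j-1,n}}{\mathcal E_{n,n}}$ ($2\le n\le 2j$), $\mathcal F_{2j+1,4j}=\mathcal E_{4j,2j+1}^{-1}$. $R^{(\frac12,0)}=\mathbb I_2$ and, on $\mathbb C^2\otimes\mathbb C^{2j+1}$, $R^{(\frac12,j)}(u)=\prod_{k=0}^{2j-2}c(uq^{j-\frac12-k})\Big((q-q^{-1})(\sigma_+\otimes S_-+\sigma_-\otimes S_+)+uq^{\frac12(\mathbb I+\sigma_z\otimes S_3)}-u^{-1}q^{-\frac12(\mathbb I+\sigma_z\otimes S_3)}\Big)$. **Fused K-operators and dual K-matrices.** $\mathcal K^{(0)}=1$, $\mathcal K^{(j)}(u)=\mathcal F^{(j)}\mathcal K_1^{(\frac12)}(uq^{-j+\frac12})R^{(\frac12,j-\frac12)}(u^2q^{-j+1})\mathcal K_2^{(j-\frac12)}(uq^{\frac12})\mathcal E^{(j)}$. For $\varepsilon_\pm\in\mathbb C$, $K^{(\frac12)}(u)=\begin{pmatrix}u\varepsilon_++u^{-1}\varepsilon_-&k_+c(u^2)/(q-q^{-1})\\k_-c(u^2)/(q-q^{-1})&u\varepsilon_-+u^{-1}\varepsilon_+\end{pmatrix}$, $K^{(0)}=1$, and $K^{(j)}$ by the same recursion. For $\bar\varepsilon_\pm,\bar k_\pm\in\mathbb C$, $K^{+(j)}(u)=\frac1{f^{(j)}(u)}\big(K^{(j)}(u^{-1}q^{-1})\big)^t$ with $\varepsilon_\pm\to\bar\varepsilon_\mp$,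 $k_\pm\to-\bar k_\mp$, $f^{(j)}(u)=\prod_{k=1}^{2j-1}\prod_{\ell=1}^kc(u^2q^{k+\ell+2-2j})c(u^{-2}q^{-k-\ell+2j})$. **Generating functions.** $\mathbf T^{(j)}(u)=\mathrm{tr}_{\mathbb C^{2j+1}}\big(K^{+(j)}(u)\mathcal K^{(j)}(u)\big)\in\mathcal A_q((u^{-1}))$ (formal Laurent series in $u^{-1}$ with coefficients in $\mathcal A_q$), the universal spin-$j$ transfer matrix; it depends on $\bar\varepsilon_\pm$ and $\bar k_\pm$.
   Formalization: The values ε̄₊ and ε̄₋ are assumed not both zero: if both vanish, the commutator is zero for every k̄±, so the stated equivalence fails there. *)

theory Defs
  imports
    "HOL-Computational_Algebra.Formal_Laurent_Series"
    "HOL-Library.Poly_Mapping"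
    "HOL-Algebra.QuotRing"
    "Jordan_Normal_Form.Matrix"
begin

section \<open>The algebra \<open>A\<^sub>q\<close>\<close>

text \<open>
  The generators \<open>W\<^bsub>-k\<^esub>\<close>, \<open>W\<^bsub>k+1\<^esub>\<close>, \<open>G\<^bsub>k+1\<^esub>\<close>, \<open>G~\<^bsub>k+1\<^esub>\<close> (in this order) are indexed by the
  natural number \<open>k\<close>.
\<close>

datatype aq_gen = Wneg nat | Wpos nat | Gen_G nat | Gen_Gt nat

text \<open>
  The free unital associative complex algebra on the generators is the monoid algebra of the
  free monoid of words. The multiplication of \<open>poly_mapping\<close> is convolution with respect to the
  additively written monoid of indices, so concatenation of words is written \<open>+\<close>.
\<close>

datatype aq_word = Aq_Word "aq_gen list"

instantiation aq_word :: monoid_add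
begin

definition zero_aq_word :: aq_word where
  "0 = Aq_Word []"

fun plus_aq_word :: "aq_word \<Rightarrow> aq_word \<Rightarrow> aq_word" where
  "Aq_Word xs + Aq_Word ys = Aq_Word (xs @ ys)"

instance
proof
  fix a b c :: aq_word
  show "a + b + c = a + (b + c)" by (cases a; cases b; cases c) simp
  show "0 + a = a" by (cases a) (simp add: zero_aq_word_def)
  show "a + 0 = a" by (cases a) (simp add: zero_aq_word_def)
qed

end

type_synonym free_alg = "aq_word \<Rightarrow>\<^sub>0 complex"

definition gen :: "aq_gen \<Rightarrow> free_alg" where
  "gen g = Poly_Mapping.single (Aq_Word [g]) 1"

definition scal :: "complex \<Rightarrow> free_alg" where
  "scal a = Poly_Mapping.single 0 a"

definition comm :: "free_alg \<Rightarrow> free_alg \<Rightarrow> free_alg" where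
  "comm x y = x * y - y * x"

definition qcomm :: "complex \<Rightarrow> free_alg \<Rightarrow> free_alg \<Rightarrow> free_alg" where
  "qcomm q x y = scal q * (x * y) - scal (inverse q) * (y * x)"

inductive aq_rel :: "complex \<Rightarrow> complex \<Rightarrow> complex \<Rightarrow> free_alg \<Rightarrow> free_alg \<Rightarrow> bool"
  for q kp km :: complex where
  "aq_rel q kp km (comm (gen (Wneg 0)) (gen (Wpos k)))
     (scal (1 / (q + inverse q)) * (gen (Gen_Gt k) - gen (Gen_G k)))"
| "aq_rel q kp km (comm (gen (Wneg k)) (gen (Wpos 0)))
     (scal (1 / (q + inverse q)) * (gen (Gen_Gt k) - gen (Gen_G k)))"
| "aq_rel q kp km (qcomm q (gen (Wneg 0)) (gen (Gen_G k)))
     (scal (kp * km * (q + inverse q)^2) * (gen (Wneg (Suc k)) - gen (Wpos k)))"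
| "aq_rel q kp km (qcomm q (gen (Gen_Gt k)) (gen (Wneg 0)))
     (scal (kp * km * (q + inverse q)^2) * (gen (Wneg (Suc k)) - gen (Wpos k)))"
| "aq_rel q kp km (qcomm q (gen (Gen_G k)) (gen (Wpos 0)))
     (scal (kp * km * (q + inverse q)^2) * (gen (Wpos (Suc k)) - gen (Wneg k)))"
| "aq_rel q kp km (qcomm q (gen (Wpos 0)) (gen (Gen_Gt k)))
     (scal (kp * km * (q + inverse q)^2) * (gen (Wpos (Suc k)) - gen (Wneg k)))"
| "aq_rel q kp km (comm (gen (Wneg k)) (gen (Wneg l))) 0"
| "aq_rel q kp km (comm (gen (Wpos k)) (gen (Wpos l))) 0"
| "aq_rel q kp km (comm (gen (Gen_G k)) (gen (Gen_G l))) 0"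
| "aq_rel q kp km (comm (gen (Gen_Gt k)) (gen (Gen_Gt l))) 0"
| "aq_rel q kp km (comm (gen (Wneg k)) (gen (Wpos l)) + comm (gen (Wpos k)) (gen (Wneg l))) 0"
| "aq_rel q kp km (comm (gen (Wneg k)) (gen (Gen_G l)) + comm (gen (Gen_G k)) (gen (Wneg l))) 0"
| "aq_rel q kp km (comm (gen (Wneg k)) (gen (Gen_Gt l)) + comm (gen (Gen_Gt k)) (gen (Wneg l))) 0"
| "aq_rel q kp km (comm (gen (Wpos k)) (gen (Gen_G l)) + comm (gen (Gen_G k)) (gen (Wpos l))) 0"
| "aq_rel q kp km (comm (gen (Wpos k)) (gen (Gen_Gt l)) + comm (gen (Gen_Gt k)) (gen (Wpos l))) 0"
| "aq_rel q kp km (comm (gen (Gen_Gt k)) (gen (Gen_G l)) + comm (gen (Gen_G k)) (gen (Gen_Gt l))) 0"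

definition free_ring :: "free_alg ring" where
  "free_ring = \<lparr>carrier = UNIV, mult = (*), one = 1, zero = 0, add = (+)\<rparr>"

definition aq_ideal :: "complex \<Rightarrow> complex \<Rightarrow> complex \<Rightarrow> free_alg set" where
  "aq_ideal q kp km = genideal free_ring {l - r |l r. aq_rel q kp km l r}"

definition Aq :: "complex \<Rightarrow> complex \<Rightarrow> complex \<Rightarrow> free_alg set ring" where
  "Aq q kp km = free_ring Quot aq_ideal q kp km"

definition aq_proj :: "complex \<Rightarrow> complex \<Rightarrow> complex \<Rightarrow> free_alg \<Rightarrow> free_alg set" where
  "aq_proj q kp km x = aq_ideal q kp km +>\<^bsub>free_ring\<^esub> x"

text \<open>
  An element of \<open>A\<^sub>q((u\<^sup>-\<^sup>1))\<close> is given by its coefficients in \<open>A\<^sub>q\<close>, the one at index \<open>n\<close>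
  being the coefficient of \<open>u\<^bsup>-n\<^esup>\<close>; \<open>aq_ser\<close> is the coefficientwise extension of the projection to
  a ring homomorphism from Laurent series over the free algebra onto \<open>A\<^sub>q((u\<^sup>-\<^sup>1))\<close>.
\<close>

definition aq_ser :: "complex \<Rightarrow> complex \<Rightarrow> complex \<Rightarrow> free_alg fls \<Rightarrow> (int \<Rightarrow> free_alg set)" where
  "aq_ser q kp km f = (\<lambda>n. aq_proj q kp km (fls_nth f n))"

definition ser_comm :: "('a, 'b) ring_scheme \<Rightarrow> (int \<Rightarrow> 'a) \<Rightarrow> 'a \<Rightarrow> (int \<Rightarrow> 'a)" where
  "ser_comm R f a = (\<lambda>n. f n \<otimes>\<^bsub>R\<^esub> a \<ominus>\<^bsub>R\<^esub> a \<otimes>\<^bsub>R\<^esub> f n)"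

lemma ring_free_ring: "ring free_ring"
proof (rule ringI)
  show "abelian_group free_ring"
  proof (rule abelian_groupI)
    fix x
    assume "x \<in> carrier free_ring"
    show "\<exists>y\<in>carrier free_ring. y \<oplus>\<^bsub>free_ring\<^esub> x = \<zero>\<^bsub>free_ring\<^esub>"
      by (rule bexI[of _ "- x"]) (simp_all add: free_ring_def)
  qed (simp_all add: free_ring_def algebra_simps)
  show "Group.monoid free_ring"
    by (rule monoidI) (simp_all add: free_ring_def algebra_simps)
qed (simp_all add: free_ring_def algebra_simps)

lemma ideal_aq_ideal: "ideal (aq_ideal q kp km) free_ring"
  unfolding aq_ideal_def
  by (rule ring.genideal_ideal[OF ring_free_ring]) (simp add: free_ring_def)

lemma ring_Aq: "ring (Aq q kp km)"
  unfolding Aq_def by (rule ideal.quotient_is_ring[OF ideal_aq_ideal])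


section \<open>Spectral parameters and generating functions\<close>

text \<open>
  Series in \<open>u\<^sup>-\<^sup>1\<close> are Laurent series in \<open>fls_X\<close>, so \<open>fls_X\<close> is \<open>u\<^sup>-\<^sup>1\<close> and \<open>fls_X_inv\<close> is \<open>u\<close>. All
  functions of the spectral parameter take an arbitrary element \<open>x\<close> of the field of complex
  Laurent series as argument; substitutions such as \<open>u \<mapsto> u q\<close> or \<open>u \<mapsto> u\<^sup>-\<^sup>1 q\<^sup>-\<^sup>1\<close> are applications to the
  corresponding series, and division in this field is expansion in \<open>u\<^sup>-\<^sup>1\<close>.

  Half-integer powers of \<open>q\<close> are integer powers of a fixed square root \<open>r\<close> of \<open>q\<close>.
\<close>

definition fls_scal :: "complex fls \<Rightarrow> free_alg fls" where
  "fls_scal f = Abs_fls (\<lambda>n. scal (fls_nth f n))"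

lemma fls_scal_nth [simp]: "fls_nth (fls_scal f) n = scal (fls_nth f n)"
proof -
  have "\<forall>\<^sub>\<infinity>n::nat. scal (fls_nth f (- int n)) = 0"
    
    using fls_nth[of f] unfolding mem_Collect_eq by (rule MOST_mono) (simp add: scal_def)
  then show ?thesis unfolding fls_scal_def by (simp add: nth_Abs_fls)
qed

definition cfun :: "complex fls \<Rightarrow> complex fls" where
  "cfun x = x - inverse x"

definition Ufun :: "complex \<Rightarrow> complex fls \<Rightarrow> complex fls" where
  "Ufun q x = (fls_const q * x^2 + fls_const (inverse q) * inverse (x^2)) / fls_const (q + inverse q)"

text \<open>
  The series \<open>\<Sum>k. gen (g k) * U(x)\<^bsup>-k-1\<^esup>\<close>, as the composition of \<open>\<Sum>k. gen (g k) * Y\<^bsup>k+1\<^esup>\<close> with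
  \<open>U(x)\<^sup>-\<^sup>1\<close>. It is only used for \<open>x = a u\<close> with \<open>a \<noteq> 0\<close>; then \<open>U(x)\<^sup>-\<^sup>1\<close> is a power series in \<open>u\<^sup>-\<^sup>1\<close>
  without constant term.
\<close>

definition gen_ser :: "complex \<Rightarrow> (nat \<Rightarrow> aq_gen) \<Rightarrow> complex fls \<Rightarrow> free_alg fls" where
  "gen_ser q g x = fps_to_fls (fps_compose
     (Abs_fps (\<lambda>n. case n of 0 \<Rightarrow> 0 | Suc k \<Rightarrow> gen (g k)))
     (Abs_fps (\<lambda>n. scal (fls_nth (inverse (Ufun q x)) (int n)))))"

lemma inverse_Ufun_nth_eq_0:
  assumes "q \<noteq> 0" "q + inverse q \<noteq> 0" "a \<noteq> 0" "n < 2"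
  shows "fls_nth (inverse (Ufun q (fls_const a * fls_X_inv))) n = 0"
proof -
  define V where "V = Ufun q (fls_const a * fls_X_inv)"
  have x2: "(fls_const a * fls_X_inv)^2 = fls_const (a^2) * fls_X_inv^2"
    by (simp add: power_mult_distrib fls_const_power)
  have ix2: "inverse (fls_const (a^2) * fls_X_inv^2) = fls_const (inverse (a^2)) * fls_X^2"
    by (simp add: fls_inverse_const fls_inverse_X_inv flip: power_inverse)
  have V: "V = fls_const (q * a^2 / (q + inverse q)) * fls_X_inv^2
             + fls_const (inverse q * inverse (a^2) / (q + inverse q)) * fls_X^2"
    unfolding V_def Ufun_def x2 ix2
    by (simp add: divide_inverse fls_inverse_const distrib_right distrib_left mult_ac
        flip: fls_const_mult_const)
  have c0: "q * a^2 / (q + inverse q) \<noteq> 0" using assms by simp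
  have Vnth: "fls_nth V m = (if m = -2 then q * a^2 / (q + inverse q) else 0)
      + (if m = 2 then inverse q * inverse (a^2) / (q + inverse q) else 0)" for m
    unfolding V by (simp add: fls_X_power_nth fls_X_inv_power_nth)
  have sub: "fls_subdegree V = -2"
    by (rule fls_subdegree_eqI) (use c0 in \<open>auto simp: Vnth\<close>)
  have "V \<noteq> 0" using sub by auto
  then have "fls_subdegree (inverse V) = 2"
    using sub by (simp add: fls_inverse_subdegree)
  then show ?thesis
    using assms(4) unfolding V_def[symmetric] by (simp add: fls_eq0_below_subdegree)
qed

definition Kop_half :: "complex \<Rightarrow> complex \<Rightarrow> complex \<Rightarrow> complex fls \<Rightarrow> free_alg fls mat" where
  "Kop_half q kp km x =
    (let s = (\<lambda>a. fls_scal (fls_const a));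
         uq = fls_scal (x * fls_const q);
         uqi = fls_scal (inverse x * fls_const (inverse q));
         Wp = gen_ser q Wneg x; Wm = gen_ser q Wpos x;
         Gp = gen_ser q Gen_G x; Gm = gen_ser q Gen_Gt x
     in mat_of_rows_list 2
       [[uq * Wp - uqi * Wm,
         s (1 / (km * (q + inverse q))) * Gp + s (kp * (q + inverse q) / (q - inverse q))],
        [s (1 / (kp * (q + inverse q))) * Gm + s (km * (q + inverse q) / (q - inverse q)),
         uq * Wm - uqi * Wp]])"

definition Ksc_half ::
    "complex \<Rightarrow> complex \<Rightarrow> complex \<Rightarrow> complex \<Rightarrow> complex \<Rightarrow> complex fls \<Rightarrow> complex fls mat" where
  "Ksc_half q ep em kp km x = mat_of_rows_list 2
     [[x * fls_const ep + inverse x * fls_const em,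
       fls_const (kp / (q - inverse q)) * cfun (x^2)],
      [fls_const (km / (q - inverse q)) * cfun (x^2),
       x * fls_const em + inverse x * fls_const ep]]"


section \<open>Spin matrices, fusion maps and R-matrices\<close>

text \<open>
  A spin \<open>j\<close> is represented by \<open>J = 2j\<close>, and likewise the second argument of \<open>B\<close> is doubled; the
  two arguments of \<open>Bcoef\<close> always have the same parity. The entry functions \<open>Ecoef\<close> and \<open>Fcoef\<close> use
  indices starting from 1, the matrices (as usual for \<open>mat\<close>) indices starting from 0. Square roots in
  \<open>Bcoef\<close> are principal.
\<close>

definition qnum :: "complex \<Rightarrow> int \<Rightarrow> complex" where
  "qnum q n = (q powi n - q powi (- n)) / (q - inverse q)"

definition Bcoef :: "complex \<Rightarrow> int \<Rightarrow> int \<Rightarrow> complex" where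
  "Bcoef q J J' = csqrt (qnum q ((J + J') div 2) * qnum q ((J - J') div 2 + 1))"

definition spin_plus :: "complex \<Rightarrow> nat \<Rightarrow> complex mat" where
  "spin_plus q J = mat (J + 1) (J + 1)
     (\<lambda>(i, k). let m = i + 1; n = k + 1 in
        if m + 1 = n then Bcoef q (int J) (int J + 2 - 2 * int m) else 0)"

definition spin_minus :: "complex \<Rightarrow> nat \<Rightarrow> complex mat" where
  "spin_minus q J = mat (J + 1) (J + 1)
     (\<lambda>(i, k). let m = i + 1; n = k + 1 in
        if m = n + 1 then Bcoef q (int J) (int J + 2 - 2 * int n) else 0)"

definition spin_three :: "nat \<Rightarrow> int mat" where
  "spin_three J = mat (J + 1) (J + 1)
     (\<lambda>(i, k). let n = k + 1 in if i = k then int J + 2 - 2 * int n else 0)"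

definition Ediag :: "complex \<Rightarrow> nat \<Rightarrow> nat \<Rightarrow> complex" where
  "Ediag q J n = (\<Prod>p<n - 1. Bcoef q (int J - 1) (int J - 2 * int p - 1)
                             / Bcoef q (int J) (int J - 2 * int p))"

definition Ecoef :: "complex \<Rightarrow> nat \<Rightarrow> nat \<Rightarrow> nat \<Rightarrow> complex" where
  "Ecoef q J a b =
    (if 1 \<le> b \<and> b \<le> J \<and> a = b then Ediag q J b
     else if 2 \<le> b \<and> b \<le> J + 1 \<and> a = J + (b - 1) then
       (let m = b - 1 in qnum q (int m) * Ediag q J m / Bcoef q (int J) (int J + 2 - 2 * int m))
     else 0)"

definition Fcoef :: "complex \<Rightarrow> nat \<Rightarrow> nat \<Rightarrow> nat \<Rightarrow> complex" where
  "Fcoef q J a b =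
    (let E = Ecoef q J;
         F2 = (\<lambda>n. E (n + J - 1) n / ((E n n)^2 + (E (n + J - 1) n)^2))
     in if a = 1 \<and> b = 1 then 1
        else if 2 \<le> a \<and> a \<le> J \<and> b = a + J - 1 then F2 a
        else if 2 \<le> a \<and> a \<le> J \<and> b = a then (1 - F2 a * E (a + J - 1) a) / E a a
        else if a = J + 1 \<and> b = 2 * J then inverse (E (2 * J) (J + 1))
        else 0)"

definition Emat :: "complex \<Rightarrow> nat \<Rightarrow> complex mat" where
  "Emat q J = mat (2 * J) (J + 1) (\<lambda>(i, k). Ecoef q J (i + 1) (k + 1))"

definition Fmat :: "complex \<Rightarrow> nat \<Rightarrow> complex mat" where
  "Fmat q J = mat (J + 1) (2 * J) (\<lambda>(i, k). Fcoef q J (i + 1) (k + 1))"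

definition kron :: "'a::times mat \<Rightarrow> 'a mat \<Rightarrow> 'a mat" where
  "kron A B = mat (dim_row A * dim_row B) (dim_col A * dim_col B)
     (\<lambda>(i, k). A $$ (i div dim_row B, k div dim_col B) * B $$ (i mod dim_row B, k mod dim_col B))"

definition sigma_plus :: "complex mat" where
  "sigma_plus = mat_of_rows_list 2 [[0, 1], [0, 0]]"

definition sigma_minus :: "complex mat" where
  "sigma_minus = mat_of_rows_list 2 [[0, 0], [1, 0]]"

definition sigma_z :: "int mat" where
  "sigma_z = mat_of_rows_list 2 [[1, 0], [0, - 1]]"

text \<open>The matrix \<open>a\<^sup>D\<close> for a diagonal integer matrix \<open>D\<close>.\<close>

definition diag_powi :: "complex \<Rightarrow> int mat \<Rightarrow> complex mat" where
  "diag_powi a D = mat (dim_row D) (dim_col D) (\<lambda>(i, k). if i = k then a powi (D $$ (i, i)) else 0)"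

definition Rmat :: "complex \<Rightarrow> complex \<Rightarrow> nat \<Rightarrow> complex fls \<Rightarrow> complex fls mat" where
  "Rmat q r J x =
    (if J = 0 then 1\<^sub>m 2
     else let D = 1\<^sub>m (2 * (J + 1)) + kron sigma_z (spin_three J) in
       (\<Prod>k<J - 1. cfun (x * fls_const (r powi (int J - 1 - 2 * int k)))) \<cdot>\<^sub>m
       (map_mat fls_const ((q - inverse q) \<cdot>\<^sub>m
            (kron sigma_plus (spin_minus q J) + kron sigma_minus (spin_plus q J)))
        + x \<cdot>\<^sub>m map_mat fls_const (diag_powi r D)
        - inverse x \<cdot>\<^sub>m map_mat fls_const (diag_powi r (- D))))"


section \<open>Fused K-operators, dual K-matrices and transfer matrices\<close>

text \<open>
  The fusion recursion, common to K-operators (entries in Laurent series over the algebra, \<open>emb\<close> the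
  inclusion of the scalars) and K-matrices (scalar entries, \<open>emb\<close> the identity). For \<open>Suc J\<close> the spin
  is \<open>j = (J + 1)/2\<close>, so that \<open>q\<^bsup>-j+1/2\<^esup> = r\<^bsup>-J\<^esup>\<close> and \<open>q\<^bsup>-j+1\<^esup> = r\<^bsup>1-J\<^esup>\<close>.
  At spin 1/2 both fusion maps are the identity matrix and the recursion returns \<open>K x\<close>.
\<close>

fun fused :: "complex \<Rightarrow> complex \<Rightarrow> (complex fls \<Rightarrow> 'b::ring_1) \<Rightarrow> (complex fls \<Rightarrow> 'b mat) \<Rightarrow>
    nat \<Rightarrow> complex fls \<Rightarrow> 'b mat" where
  "fused q r emb K 0 x = 1\<^sub>m 1"
| "fused q r emb K (Suc J) x =
     map_mat (\<lambda>a. emb (fls_const a)) (Fmat q (Suc J))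
     * kron (K (x * fls_const (r powi (- int J)))) (1\<^sub>m (Suc J))
     * map_mat emb (Rmat q r J (x^2 * fls_const (r powi (1 - int J))))
     * kron (1\<^sub>m 2) (fused q r emb K J (x * fls_const r))
     * map_mat (\<lambda>a. emb (fls_const a)) (Emat q (Suc J))"

definition Kop :: "complex \<Rightarrow> complex \<Rightarrow> complex \<Rightarrow> complex \<Rightarrow> nat \<Rightarrow> complex fls \<Rightarrow> free_alg fls mat" where
  "Kop q r kp km = fused q r fls_scal (Kop_half q kp km)"

definition Ksc :: "complex \<Rightarrow> complex \<Rightarrow> complex \<Rightarrow> complex \<Rightarrow> complex \<Rightarrow> complex \<Rightarrow> nat \<Rightarrow>
    complex fls \<Rightarrow> complex fls mat" where
  "Ksc q r ep em kp km = fused q r (\<lambda>f. f) (Ksc_half q ep em kp km)"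

definition ffun :: "complex \<Rightarrow> nat \<Rightarrow> complex fls \<Rightarrow> complex fls" where
  "ffun q J x = (\<Prod>k=1..J - 1. \<Prod>l=1..k.
      cfun (x^2 * fls_const (q powi (int k + int l + 2 - int J)))
    * cfun (inverse (x^2) * fls_const (q powi (- int k - int l + int J))))"

definition Kdual :: "complex \<Rightarrow> complex \<Rightarrow> complex \<Rightarrow> complex \<Rightarrow> complex \<Rightarrow> complex \<Rightarrow> nat \<Rightarrow>
    complex fls \<Rightarrow> complex fls mat" where
  "Kdual q r ebp ebm kbp kbm J x =
     (1 / ffun q J x) \<cdot>\<^sub>m
     transpose_mat (Ksc q r ebm ebp (- kbm) (- kbp) J (inverse x * fls_const (inverse q)))"

definition mat_trace :: "'a::comm_monoid_add mat \<Rightarrow> 'a" where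
  "mat_trace A = (\<Sum>i<dim_row A. A $$ (i, i))"

definition transfer :: "complex \<Rightarrow> complex \<Rightarrow> complex \<Rightarrow> complex \<Rightarrow>
    complex \<Rightarrow> complex \<Rightarrow> complex \<Rightarrow> complex \<Rightarrow> nat \<Rightarrow> (int \<Rightarrow> free_alg set)" where
  "transfer q r kp km ebp ebm kbp kbm J = aq_ser q kp km (mat_trace
     (map_mat fls_scal (Kdual q r ebp ebm kbp kbm J fls_X_inv) * Kop q r kp km J fls_X_inv))"

end

theory Submission
  imports Defs
begin

text \<open>
  Both directions are proved with representatives in the free algebra: the commutator vanishes in
  \<open>A\<^sub>q\<close> iff every coefficient of its representative lies in the defining ideal. Write \<open>j = J/2\<close>.

  If the off-diagonal parameters \<open>kbp\<close>, \<open>kbm\<close> vanish, the dual K-matrix is diagonal, because fusing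
  diagonal matrices gives a diagonal matrix. Neighbouring diagonal entries satisfy an explicit
  first-order ratio (\<open>Ksc_diagonal\<close>). On the other side, \<open>W\<^sub>0\<close> and \<open>W\<^sub>1\<close> act on the spin-\<open>j\<close> space
  tensored with the algebra by tridiagonal operators \<open>opM\<close>, a coideal coaction depending on the
  spectral parameter, and the fused K-operator intertwines this coaction at \<open>u\<close> with the one at
  \<open>u\<^sup>-\<^sup>1\<close> (\<open>Kop_intertwines\<close>). The diagonal entries of this relation express the commutators of the
  diagonal entries of the K-operator with \<open>W\<^sub>0\<close> and \<open>W\<^sub>1\<close> by its entries next to the diagonal. In the
  combination \<open>ebp W\<^sub>0 + ebm W\<^sub>1\<close>, traced against the dual K-matrix, every such entry gets a
  coefficient that vanishes by the ratio (\<open>transfer_commutes\<close>).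

  The intertwining property is proved by induction on the spin. Each factor of the fusion formula
  (fusion map, K-operator, R-matrix, K-operator) moves the coaction past itself; only the left fusion
  map \<open>F\<close> does so under a condition: the vectors it is applied to must lie in the image of \<open>E\<close>. The
  usual argument for this is the reflection equation. Here it is replaced by a degree argument: the
  component outside that image, the defect, satisfies two linear relations, one for each generator, whose leading
  coefficients in \<open>u\<close> sit at different neighbours. Comparing leading coefficients forces every
  coefficient of the defect into the ideal, one degree after the other (\<open>bigraded_defect_vanishes\<close>).

  For the converse, suppose \<open>kbp\<close> or \<open>kbm\<close> is nonzero. The algebra is represented on functions on
  the lattice of integer pairs, through a quantum torus: \<open>W\<^sub>0\<close> and \<open>W\<^sub>1\<close> act by \<open>Y + Y\<^sup>-\<^sup>1\<close> and
  \<open>X + X\<^sup>-\<^sup>1\<close>, up to a factor \<open>mu\<close>, where \<open>X\<close> and \<open>Y\<close> commute up to a power of \<open>w\<close>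
  (\<open>aq_ideal_act\<close>). In the filtration by total degree the leading part of an entry of the spin-\<open>j\<close>
  K-operator is a multiple of the translation by \<open>(J, J)\<close>, and the multiples, the symbols, are again
  obtained by fusion (\<open>symbol_series_fused\<close>). For \<open>w = q\<close> the symbol of the fundamental K-operator
  has one nonzero entry, below the diagonal, for \<open>w = q\<^sup>-\<^sup>1\<close> one above the diagonal; so the fused
  symbol has one nonzero corner entry, which is paired in the trace with the corresponding corner of
  the dual K-matrix, and that is nonzero for \<open>kbp \<noteq> 0\<close> and for \<open>kbm \<noteq> 0\<close> respectively. Hence some
  coefficient of the transfer matrix has a nonzero symbol of degree \<open>J\<close>, and such an element does not
  commute with \<open>ebp W\<^sub>0 + ebm W\<^sub>1\<close>, as \<open>w\<close> is not a root of unity (\<open>symbol_commutator\<close>).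
\<close>

section \<open>Scalars and ideals for series over the free algebra\<close>

text \<open>
  Products of two pairs of series can be expanded over the same index range only if the bounds are
  allowed to lie below the subdegrees.
\<close>

lemma fls_times_nth_interval:
  fixes f g :: "'a::semiring_0 fls"
  assumes "\<And>i. i < a \<Longrightarrow> fls_nth f i = 0" and "\<And>i. i < b \<Longrightarrow> fls_nth g i = 0"
  shows "fls_nth (f * g) n = (\<Sum>i=a..n - b. fls_nth f i * fls_nth g (n - i))"
proof -
  have "fls_nth (f * g) n = (\<Sum>i=fls_subdegree f..n - fls_subdegree g. fls_nth f i * fls_nth g (n - i))"
    by (rule fls_times_nth(2))
  also have "\<dots> = (\<Sum>i=min a (fls_subdegree f)..max (n - b) (n - fls_subdegree g). fls_nth f i * fls_nth g (n - i))"
    by (rule sum.mono_neutral_left) (auto simp: not_le)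
  also have "\<dots> = (\<Sum>i=a..n - b. fls_nth f i * fls_nth g (n - i))"
    by (rule sum.mono_neutral_right) (auto simp: not_le assms)
  finally show ?thesis .
qed

lemma scal_0 [simp]: "scal 0 = 0" by (simp add: scal_def)
lemma scal_1 [simp]: "scal 1 = 1" by (simp add: scal_def)
lemma scal_add: "scal (a + b) = scal a + scal b" by (simp add: scal_def single_add)
lemma scal_mult: "scal (a * b) = scal a * scal b" by (simp add: scal_def mult_single)
lemma scal_diff: "scal (a - b) = scal a - scal b" by (simp add: scal_def single_diff)
lemma scal_sum: "scal (sum f A) = (\<Sum>i\<in>A. scal (f i))"
  by (induction A rule: infinite_finite_induct) (simp_all add: scal_add)

lemma scal_single_commute: "scal a * Poly_Mapping.single w b = Poly_Mapping.single w b * scal a"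
  by (simp add: scal_def mult_single mult.commute)

lemma poly_mapping_eq_sum_single: "x = (\<Sum>w\<in>Poly_Mapping.keys x. Poly_Mapping.single w (Poly_Mapping.lookup x w))"
proof (rule poly_mapping_eqI)
  fix k
  show "Poly_Mapping.lookup x k = Poly_Mapping.lookup (\<Sum>w\<in>Poly_Mapping.keys x. Poly_Mapping.single w (Poly_Mapping.lookup x w)) k"
    by (simp add: lookup_sum lookup_single when_def not_in_keys_iff_lookup_eq_zero)
qed

lemma scal_commute: "scal a * x = x * scal a"
  by (subst (1 2) poly_mapping_eq_sum_single[of x])
    (simp add: sum_distrib_left sum_distrib_right scal_single_commute)

lemma fls_scal_0 [simp]: "fls_scal 0 = 0" by (rule fls_eqI) simp
lemma fls_scal_1 [simp]: "fls_scal 1 = 1" by (rule fls_eqI) simp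
lemma fls_scal_add: "fls_scal (a + b) = fls_scal a + fls_scal b" by (rule fls_eqI) (simp add: scal_add)
lemma fls_scal_diff: "fls_scal (a - b) = fls_scal a - fls_scal b" by (rule fls_eqI) (simp add: scal_diff)
lemma fls_scal_const: "fls_scal (fls_const a) = fls_const (scal a)" by (rule fls_eqI) simp

lemma fls_scal_mult: "fls_scal (f * g) = fls_scal f * fls_scal g"
proof (rule fls_eqI)
  fix n
  have "fls_nth (f * g) n = (\<Sum>i=fls_subdegree f..n - fls_subdegree g. fls_nth f i * fls_nth g (n - i))"
    by (rule fls_times_nth_interval) simp_all
  moreover have "fls_nth (fls_scal f * fls_scal g) n
      = (\<Sum>i=fls_subdegree f..n - fls_subdegree g. fls_nth (fls_scal f) i * fls_nth (fls_scal g) (n - i))"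
    by (rule fls_times_nth_interval) simp_all
  ultimately show "fls_nth (fls_scal (f * g)) n = fls_nth (fls_scal f * fls_scal g) n"
    by (simp add: scal_sum scal_mult)
qed

lemma fls_scal_commute: "fls_scal f * g = g * fls_scal f"
proof (rule fls_eqI)
  fix n
  let ?a = "fls_subdegree f" and ?b = "fls_subdegree g"
  have "fls_nth (fls_scal f * g) n = (\<Sum>i=?a..n - ?b. fls_nth (fls_scal f) i * fls_nth g (n - i))"
    by (rule fls_times_nth_interval) simp_all
  also have "\<dots> = (\<Sum>i=?b..n - ?a. fls_nth g i * fls_nth (fls_scal f) (n - i))"
    by (rule sum.reindex_bij_witness[of _ "\<lambda>i. n - i" "\<lambda>i. n - i"]) (auto simp: scal_commute)
  also have "\<dots> = fls_nth (g * fls_scal f) n"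
    by (rule fls_times_nth_interval[symmetric]) simp_all
  finally show "fls_nth (fls_scal f * g) n = fls_nth (g * fls_scal f) n" .
qed

locale two_sided_ideal =
  fixes I :: "'a::ring_1 set"
  assumes zero_closed: "0 \<in> I"
    and diff_closed: "x \<in> I \<Longrightarrow> y \<in> I \<Longrightarrow> x - y \<in> I"
    and mult_left_closed: "x \<in> I \<Longrightarrow> a * x \<in> I"
    and mult_right_closed: "x \<in> I \<Longrightarrow> x * a \<in> I"
begin

definition cong_mod (infix "\<approx>" 50) where "x \<approx> y \<longleftrightarrow> x - y \<in> I"

lemma uminus_closed: "x \<in> I \<Longrightarrow> - x \<in> I"
  using diff_closed[OF zero_closed] by simp

lemma add_closed: "x \<in> I \<Longrightarrow> y \<in> I \<Longrightarrow> x + y \<in> I"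
  using diff_closed[of x "- y"] uminus_closed[of y] by simp

lemma sum_closed: "(\<And>i. i \<in> A \<Longrightarrow> f i \<in> I) \<Longrightarrow> sum f A \<in> I"
  by (induction A rule: infinite_finite_induct) (auto intro: zero_closed add_closed)

lemma cong_refl [simp]: "x \<approx> x"
  by (simp add: cong_mod_def zero_closed)

lemma cong_sym: "x \<approx> y \<Longrightarrow> y \<approx> x"
  unfolding cong_mod_def using uminus_closed[of "x - y"] by simp

lemma cong_trans [trans]: "x \<approx> y \<Longrightarrow> y \<approx> z \<Longrightarrow> x \<approx> z"
  unfolding cong_mod_def using add_closed[of "x - y" "y - z"] by simp

lemma cong_eq_trans [trans]: "x \<approx> y \<Longrightarrow> y = z \<Longrightarrow> x \<approx> z" by simp
lemma eq_cong_trans [trans]: "x = y \<Longrightarrow> y \<approx> z \<Longrightarrow> x \<approx> z" by simp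

lemma cong_add: "x \<approx> y \<Longrightarrow> x' \<approx> y' \<Longrightarrow> x + x' \<approx> y + y'"
  unfolding cong_mod_def using add_closed[of "x - y" "x' - y'"] by (simp add: algebra_simps)

lemma cong_diff: "x \<approx> y \<Longrightarrow> x' \<approx> y' \<Longrightarrow> x - x' \<approx> y - y'"
  unfolding cong_mod_def using diff_closed[of "x - y" "x' - y'"] by (simp add: algebra_simps)

lemma cong_mult_left: "x \<approx> y \<Longrightarrow> a * x \<approx> a * y"
  unfolding cong_mod_def using mult_left_closed[of "x - y" a] by (simp add: algebra_simps)

lemma cong_mult_right: "x \<approx> y \<Longrightarrow> x * a \<approx> y * a"
  unfolding cong_mod_def using mult_right_closed[of "x - y" a] by (simp add: algebra_simps)

end

text \<open>
  The kernel of the coefficientwise projection to Laurent series over \<open>A\<^sub>q\<close>.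
\<close>

definition aq_null :: "complex \<Rightarrow> complex \<Rightarrow> complex \<Rightarrow> free_alg fls set" where
  "aq_null q kp km = {F. \<forall>n. fls_nth F n \<in> aq_ideal q kp km}"

lemma two_sided_ideal_aq_ideal: "two_sided_ideal (aq_ideal q kp km)"
proof -
  interpret ideal "aq_ideal q kp km" free_ring by (rule ideal_aq_ideal)
  have neg: "\<ominus>\<^bsub>free_ring\<^esub> y = - y" for y
    by (rule minus_equality) (simp_all add: free_ring_def)
  show ?thesis
  proof
    show "0 \<in> aq_ideal q kp km"
      using additive_subgroup.zero_closed[OF additive_subgroup_axioms] by (simp add: free_ring_def)
    fix x y a
    assume x: "x \<in> aq_ideal q kp km"
    show "a * x \<in> aq_ideal q kp km" "x * a \<in> aq_ideal q kp km"
      using I_l_closed[OF x, of a] I_r_closed[OF x, of a] by (simp_all add: free_ring_def)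
    assume y: "y \<in> aq_ideal q kp km"
    show "x - y \<in> aq_ideal q kp km"
      using additive_subgroup.a_closed[OF additive_subgroup_axioms x
          additive_subgroup.a_inv_closed[OF additive_subgroup_axioms y]]
      unfolding neg by (simp add: free_ring_def)
  qed
qed

lemma two_sided_ideal_aq_null: "two_sided_ideal (aq_null q kp km)"
proof -
  interpret two_sided_ideal "aq_ideal q kp km" by (rule two_sided_ideal_aq_ideal)
  show ?thesis
    by standard (auto simp: aq_null_def zero_closed fls_times_nth(2)
        intro!: diff_closed sum_closed intro: mult_left_closed mult_right_closed)
qed

lemma aq_rel_imp_ideal: "aq_rel q kp km l r \<Longrightarrow> l - r \<in> aq_ideal q kp km"
  unfolding aq_ideal_def
  using ring.genideal_self[OF ring_free_ring, of "{l - r |l r. aq_rel q kp km l r}"]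
  by (auto simp: free_ring_def)

text \<open>
  The way to use a representation of \<open>A\<^sub>q\<close>: its kernel in the free algebra is an ideal containing the
  relations.
\<close>

lemma aq_ideal_minimal:
  assumes "two_sided_ideal I" and rel: "\<And>l r. aq_rel q kp km l r \<Longrightarrow> l - r \<in> I"
  shows "aq_ideal q kp km \<subseteq> I"
proof -
  interpret two_sided_ideal I by fact
  have neg: "\<ominus>\<^bsub>free_ring\<^esub> y = - y" for y
    by (rule abelian_group.minus_equality[OF ring.is_abelian_group[OF ring_free_ring]])
      (simp_all add: free_ring_def)
  have "ideal I free_ring"
  proof (rule idealI[OF ring_free_ring])
    show "subgroup I (add_monoid free_ring)"
      by (rule group.subgroupI[OF abelian_group.a_group[OF ring.is_abelian_group[OF ring_free_ring]]])
        (use zero_closed neg uminus_closed add_closed in \<open>auto simp: free_ring_def a_inv_def\<close>)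
  qed (auto simp: free_ring_def mult_left_closed mult_right_closed)
  then show ?thesis
    unfolding aq_ideal_def
    by (rule ring.genideal_minimal[OF ring_free_ring]) (auto dest: rel)
qed

lemma aq_proj_eq_zero_iff: "aq_proj q kp km x = \<zero>\<^bsub>Aq q kp km\<^esub> \<longleftrightarrow> x \<in> aq_ideal q kp km"
proof -
  interpret ideal "aq_ideal q kp km" free_ring by (rule ideal_aq_ideal)
  show ?thesis
    unfolding aq_proj_def Aq_def FactRing_def
    using a_rcos_const[of x] a_rcos_self[of x] by (auto simp: free_ring_def)
qed

lemma aq_proj_commutator:
  "aq_proj q kp km x \<otimes>\<^bsub>Aq q kp km\<^esub> aq_proj q kp km y \<ominus>\<^bsub>Aq q kp km\<^esub>
   aq_proj q kp km y \<otimes>\<^bsub>Aq q kp km\<^esub> aq_proj q kp km x = aq_proj q kp km (x * y - y * x)"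
proof -
  interpret ideal "aq_ideal q kp km" free_ring by (rule ideal_aq_ideal)
  interpret h: ring_hom_ring free_ring "Aq q kp km" "aq_proj q kp km"
    using rcos_ring_hom_ring by (simp add: Aq_def aq_proj_def[abs_def])
  have neg: "\<ominus>\<^bsub>free_ring\<^esub> y = - y" for y
    by (rule minus_equality) (simp_all add: free_ring_def)
  have "aq_proj q kp km (x * y \<ominus>\<^bsub>free_ring\<^esub> y * x) =
    aq_proj q kp km (x * y) \<ominus>\<^bsub>Aq q kp km\<^esub> aq_proj q kp km (y * x)"
    unfolding a_minus_def by (subst h.hom_add) (auto simp: free_ring_def[of] simp flip: h.hom_a_inv)
  moreover have "x * y \<ominus>\<^bsub>free_ring\<^esub> y * x = x * y - y * x"
    unfolding a_minus_def neg by (simp add: free_ring_def)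
  moreover have "aq_proj q kp km (a * b) = aq_proj q kp km a \<otimes>\<^bsub>Aq q kp km\<^esub> aq_proj q kp km b" for a b
    using h.hom_mult[of a b] by (simp add: free_ring_def)
  ultimately show ?thesis by simp
qed

section \<open>The fusion recursion in coordinates\<close>

text \<open>
  Matrices are used through their action on vectors with entries in a noncommutative ring. A vector of \<open>C\<^sup>2 \<otimes> C\<^sup>N\<close> is a function of two indices, and \<open>flat\<close> gives its single-index form that
  fits the Kronecker products.
\<close>

definition mat_apply :: "'a::semiring_0 mat \<Rightarrow> (nat \<Rightarrow> 'a) \<Rightarrow> nat \<Rightarrow> 'a" where
  "mat_apply A f i = (\<Sum>l<dim_col A. A $$ (i, l) * f l)"

lemma index_mult_mat_apply:
  assumes "i < dim_row A" "k < dim_col B" "dim_col A = dim_row B"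
  shows "(A * B) $$ (i, k) = mat_apply A (\<lambda>l. B $$ (l, k)) i"
  using assms by (simp add: mat_apply_def scalar_prod_def lessThan_atLeast0)

lemma mat_apply_cong:
  "(\<And>l. l < dim_col A \<Longrightarrow> f l = g l) \<Longrightarrow> mat_apply A f i = mat_apply A g i"
  by (simp add: mat_apply_def)

definition flat :: "nat \<Rightarrow> (nat \<Rightarrow> nat \<Rightarrow> 'a) \<Rightarrow> nat \<Rightarrow> 'a" where
  "flat N \<psi> l = \<psi> (l div N) (l mod N)"

lemma sum_double:
  "(\<Sum>l<2 * N. g (l :: nat)) = (\<Sum>n<N. g n) + (\<Sum>n<N. (g (N + n) :: 'a::comm_monoid_add))"
proof -
  have "{..<2 * N} = {..<N} \<union> {N..<2 * N}" by auto
  then have "(\<Sum>l<2 * N. g l) = (\<Sum>n<N. g n) + (\<Sum>n=N..<2 * N. g n)"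
    by (simp add: sum.union_disjoint ivl_disj_int)
  also have "(\<Sum>n=N..<2 * N. g n) = (\<Sum>n<N. g (N + n))"
    by (rule sum.reindex_bij_witness[of _ "\<lambda>n. N + n" "\<lambda>n. n - N"]) auto
  finally show ?thesis .
qed

lemma mat_apply_flat:
  assumes "dim_col A = 2 * N"
  shows "mat_apply A (flat N \<psi>) i = (\<Sum>n<N. A $$ (i, n) * \<psi> 0 n) + (\<Sum>n<N. A $$ (i, N + n) * \<psi> 1 n)"
proof (cases "N = 0")
  case False
  have "(\<Sum>n<N. A $$ (i, n) * flat N \<psi> n) = (\<Sum>n<N. A $$ (i, n) * \<psi> 0 n)"
    by (rule sum.cong) (auto simp: flat_def)
  moreover have "(\<Sum>n<N. A $$ (i, N + n) * flat N \<psi> (N + n)) = (\<Sum>n<N. A $$ (i, N + n) * \<psi> 1 n)"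
    using False by (intro sum.cong) (auto simp: flat_def)
  ultimately show ?thesis by (simp add: mat_apply_def assms sum_double)
qed (simp add: mat_apply_def assms)

lemma index_kron:
  assumes "dim_row B = N" "dim_col B = N" "a < dim_row A" "c < dim_col A" "n < N" "m < N"
  shows "kron A B $$ (a * N + n, c * N + m) = A $$ (a, c) * B $$ (n, m)"
proof -
  have "a * N + n < dim_row A * N"
    using assms mult_le_mono1[of "Suc a" "dim_row A" N] by (simp del: mult_le_cancel2)
  moreover have "c * N + m < dim_col A * N"
    using assms mult_le_mono1[of "Suc c" "dim_col A" N] by (simp del: mult_le_cancel2)
  ultimately show ?thesis using assms by (simp add: kron_def)
qed

lemma mat_apply_kron_left:
  fixes A :: "'a::ring_1 mat"
  assumes "A \<in> carrier_mat 2 2" "a < 2" "n < N"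
  shows "mat_apply (kron A (1\<^sub>m N)) (flat N \<psi>) (a * N + n) = A $$ (a, 0) * \<psi> 0 n + A $$ (a, 1) * \<psi> 1 n"
proof -
  have 0: "kron A (1\<^sub>m N) $$ (a * N + n, m) = (if m = n then A $$ (a, 0) else 0)" if "m < N" for m
    using index_kron[of "1\<^sub>m N" N a A 0 n m] assms that by auto
  have 1: "kron A (1\<^sub>m N) $$ (a * N + n, N + m) = (if m = n then A $$ (a, 1) else 0)" if "m < N" for m
    using index_kron[of "1\<^sub>m N" N a A 1 n m] assms that by auto
  have "dim_col (kron A (1\<^sub>m N)) = 2 * N" using assms by (auto simp: kron_def)
  then show ?thesis
    using assms by (simp add: mat_apply_flat 0 1 if_distrib[of "\<lambda>x. x * _"] cong: if_cong)
qed

lemma mat_apply_kron_right: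
  fixes Y :: "'a::ring_1 mat"
  assumes "Y \<in> carrier_mat N N" "a < 2" "n < N"
  shows "mat_apply (kron (1\<^sub>m 2) Y) (flat N \<psi>) (a * N + n) = (\<Sum>m<N. Y $$ (n, m) * \<psi> a m)"
proof -
  have 0: "kron (1\<^sub>m 2) Y $$ (a * N + n, m) = (if a = 0 then Y $$ (n, m) else 0)" if "m < N" for m
    using index_kron[of Y N a "1\<^sub>m 2" 0 n m] assms that by auto
  have 1: "kron (1\<^sub>m 2) Y $$ (a * N + n, N + m) = (if a = 1 then Y $$ (n, m) else 0)" if "m < N" for m
    using index_kron[of Y N a "1\<^sub>m 2" 1 n m] assms that by auto
  have "dim_col (kron (1\<^sub>m 2) Y) = 2 * N" using assms by (auto simp: kron_def)
  then have "mat_apply (kron (1\<^sub>m 2) Y) (flat N \<psi>) (a * N + n) =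
      (\<Sum>m<N. (if a = 0 then Y $$ (n, m) else 0) * \<psi> 0 m) +
      (\<Sum>m<N. (if a = 1 then Y $$ (n, m) else 0) * \<psi> 1 m)"
    by (simp only: mat_apply_flat) (simp add: 0 1)
  moreover have "a = 0 \<or> a = 1" using assms by linarith
  ultimately show ?thesis by auto
qed

definition bq :: "complex \<Rightarrow> nat \<Rightarrow> nat \<Rightarrow> complex" where
  "bq q J n = Bcoef q (int J) (int J + 2 - 2 * int n)"

text \<open>
  The entries of the R-matrix without the common factor \<open>Rfac\<close>: \<open>Rdiag\<close> on the diagonal, and \<open>Roff\<close>
  between \<open>(0, n)\<close> and \<open>(1, n - 1)\<close>.
\<close>

definition Rdiag :: "complex \<Rightarrow> nat \<Rightarrow> complex fls \<Rightarrow> nat \<Rightarrow> nat \<Rightarrow> complex fls" where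
  "Rdiag r J x a n = (let d = (if a = 0 then 1 + (int J - 2 * int n) else 1 - (int J - 2 * int n))
     in x * fls_const (r powi d) - inverse x * fls_const (r powi (- d)))"

definition Roff :: "complex \<Rightarrow> nat \<Rightarrow> nat \<Rightarrow> complex fls" where
  "Roff q J n = fls_const ((q - inverse q) * bq q J n)"

text \<open>
  At spin 0 the R-matrix is the identity; the value of \<open>Rfac\<close> there makes the general formula for the
  entries true in that case as well.
\<close>

definition Rfac :: "complex \<Rightarrow> nat \<Rightarrow> complex fls \<Rightarrow> complex fls" where
  "Rfac r J x = (if J = 0 then inverse (Rdiag r 0 x 0 0)
     else \<Prod>k<J - 1. cfun (x * fls_const (r powi (int J - 1 - 2 * int k))))"

lemma spin_carrier:
  "spin_plus q J \<in> carrier_mat (Suc J) (Suc J)" "spin_minus q J \<in> carrier_mat (Suc J) (Suc J)"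
  "spin_three J \<in> carrier_mat (Suc J) (Suc J)" "sigma_plus \<in> carrier_mat 2 2"
  "sigma_minus \<in> carrier_mat 2 2" "sigma_z \<in> carrier_mat 2 2"
  by (auto simp: spin_three_def sigma_z_def spin_plus_def spin_minus_def sigma_plus_def
      sigma_minus_def mat_of_rows_list_def)

lemma kron_carrier:
  "A \<in> carrier_mat a b \<Longrightarrow> B \<in> carrier_mat c d \<Longrightarrow> kron A B \<in> carrier_mat (a * c) (b * d)"
  by (auto simp: kron_def)

lemma Rmat_carrier: "Rmat q r J x \<in> carrier_mat (2 * Suc J) (2 * Suc J)"
proof -
  have "dim_row (kron sigma_z (spin_three J)) = 2 * Suc J" "dim_col (kron sigma_z (spin_three J)) = 2 * Suc J"
    using kron_carrier[OF spin_carrier(6,3)] by auto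
  then show ?thesis
    by (intro carrier_matI) (simp_all add: Rmat_def Let_def diag_powi_def)
qed

text \<open>
  The exponent of \<open>r\<close> in the R-matrix is \<open>1\<close> plus or minus a weight, and \<open>sigma_plus\<close>, \<open>sigma_minus\<close>
  are paired with the opposite spin matrices, so every row has at most two nonzero entries.
\<close>

lemma Rmat_index:
  fixes r :: complex and J :: nat and a c n m :: nat
  assumes "a < 2" "c < 2" "n \<le> J" "m \<le> J" and nz: "Rdiag r 0 x 0 0 \<noteq> 0"
  shows "Rmat q r J x $$ (a * Suc J + n, c * Suc J + m) = Rfac r J x *
     (if a = c then (if n = m then Rdiag r J x a n else 0)
      else if a = 0 then (if n = Suc m then Roff q J n else 0)
      else (if m = Suc n then Roff q J m else 0))"
proof -
  let ?N = "Suc J"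
  have lt: "a * ?N + n < 2 * ?N" "c * ?N + m < 2 * ?N"
    using assms by (auto simp: less_2_cases_iff)
  have eq: "a * ?N + n = c * ?N + m \<longleftrightarrow> a = c \<and> n = m"
    using assms(1-4) by (auto simp: less_2_cases_iff)
  show ?thesis
  proof (cases "J = 0")
    case True
    with assms lt show ?thesis
      by (auto simp: Rmat_def Rfac_def less_2_cases_iff Rdiag_def)
  next
    case False
    have P: "kron sigma_plus (spin_minus q J) $$ (a * ?N + n, c * ?N + m)
        = (if a = 0 \<and> c = 1 \<and> n = Suc m then bq q J n else 0)"
      using assms spin_carrier by (subst index_kron) (auto simp: sigma_plus_def spin_minus_def mat_of_rows_list_def less_2_cases_iff bq_def)
    have M: "kron sigma_minus (spin_plus q J) $$ (a * ?N + n, c * ?N + m)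
        = (if a = 1 \<and> c = 0 \<and> m = Suc n then bq q J m else 0)"
      using assms spin_carrier by (subst index_kron) (auto simp: sigma_minus_def spin_plus_def mat_of_rows_list_def less_2_cases_iff bq_def)
    have Z: "kron sigma_z (spin_three J) $$ (a * ?N + n, c * ?N + m)
        = (if a = c \<and> n = m then (if a = 0 then 1 else - 1) * (int J - 2 * int n) else 0)"
      using assms spin_carrier by (subst index_kron) (auto simp: sigma_z_def spin_three_def mat_of_rows_list_def less_2_cases_iff)
    have Z': "kron sigma_z (spin_three J) $$ (a * ?N + n, a * ?N + n)
        = (if a = 0 then 1 else - 1) * (int J - 2 * int n)"
      using assms spin_carrier by (subst index_kron) (auto simp: sigma_z_def spin_three_def mat_of_rows_list_def less_2_cases_iff)
    have k': "dim_row (kron sigma_z (spin_three J)) = 2 * ?N" "dim_col (kron sigma_z (spin_three J)) = 2 * ?N"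
      "dim_row (kron sigma_minus (spin_plus q J)) = 2 * ?N" "dim_col (kron sigma_minus (spin_plus q J)) = 2 * ?N"
      "dim_row (kron sigma_plus (spin_minus q J)) = 2 * ?N" "dim_col (kron sigma_plus (spin_minus q J)) = 2 * ?N"
      using kron_carrier[OF spin_carrier(6,3), of J] kron_carrier[OF spin_carrier(5,1), of q J]
        kron_carrier[OF spin_carrier(4,2), of q J] by auto
    define ii jj where "ii = a * ?N + n" and "jj = c * ?N + m"
    have eq': "ii = jj \<longleftrightarrow> a = c \<and> n = m" unfolding ii_def jj_def by (rule eq)
    have Zii: "kron sigma_z (spin_three J) $$ (ii, ii) = (if a = 0 then 1 else - 1) * (int J - 2 * int n)"
      unfolding ii_def by (rule Z')
    then have Zjj: "ii = jj \<Longrightarrow> kron sigma_z (spin_three J) $$ (jj, jj) = (if a = 0 then 1 else - 1) * (int J - 2 * int n)"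
      by simp
    have entry: "Rmat q r J x $$ (ii, jj) = Rfac r J x *
        (fls_const ((q - inverse q) * ((if a = 0 \<and> c = 1 \<and> n = Suc m then bq q J n else 0) +
             (if a = 1 \<and> c = 0 \<and> m = Suc n then bq q J m else 0)))
         + x * fls_const (if ii = jj then r powi (1 + (if a = 0 then 1 else - 1) * (int J - 2 * int n)) else 0)
         - inverse x * fls_const (if ii = jj then r powi (- (1 + (if a = 0 then 1 else - 1) * (int J - 2 * int n))) else 0))"
      using False lt k' P M
      unfolding Rmat_def Let_def Rfac_def ii_def[symmetric] jj_def[symmetric]
      by (simp add: Zii Zjj diag_powi_def del: mult_Suc mult_Suc_right)
    consider "a = 0" "c = 0" | "a = 0" "c = 1" | "a = 1" "c = 0" | "a = 1" "c = 1"
      using assms(1,2) by linarith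
    then show ?thesis
      unfolding ii_def[symmetric] jj_def[symmetric] entry eq'
      by cases (auto simp: Rdiag_def Roff_def Let_def diff_diff_eq2 add_diff_eq)
  qed
qed

text \<open>
  The nonzero entries of the fusion maps at spin \<open>(J + 1)/2\<close>: column \<open>n\<close> of \<open>E\<close> has the entries \<open>Ea\<close> at
  \<open>(0, n)\<close> and \<open>Eb\<close> at \<open>(1, n - 1)\<close>, row \<open>n\<close> of \<open>F\<close> has \<open>Fa\<close> and \<open>Fb\<close> in the same places. All four
  vanish where the position is out of range, which keeps the formulas below free of case distinctions.
\<close>

definition Ea :: "complex \<Rightarrow> nat \<Rightarrow> nat \<Rightarrow> complex" where
  "Ea q J n = (\<Prod>p<n. bq q J (Suc p) / bq q (Suc J) (Suc p))"

definition Eb :: "complex \<Rightarrow> nat \<Rightarrow> nat \<Rightarrow> complex" where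
  "Eb q J n = qnum q (int n) * Ea q J (n - 1) / bq q (Suc J) n"

definition Fa :: "complex \<Rightarrow> nat \<Rightarrow> nat \<Rightarrow> complex" where
  "Fa q J i = (if i \<le> J then Fcoef q (Suc J) (i + 1) (i + 1) else 0)"

definition Fb :: "complex \<Rightarrow> nat \<Rightarrow> nat \<Rightarrow> complex" where
  "Fb q J i = (if i = 0 then 0 else Fcoef q (Suc J) (i + 1) (i + 1 + J))"

lemma Ediag_Suc: "Ediag q (Suc J) (Suc n) = Ea q J n"
  by (simp add: Ediag_def Ea_def bq_def algebra_simps)

lemma Emat_index:
  assumes "n \<le> J" "k \<le> Suc J"
  shows "Emat q (Suc J) $$ (n, k) = (if n = k then Ea q J k else 0)"
    "Emat q (Suc J) $$ (Suc J + n, k) = (if Suc n = k then Eb q J k else 0)"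
  using assms by (auto simp: Emat_def Ecoef_def Let_def Ediag_Suc Eb_def bq_def algebra_simps
      simp flip: Ediag_Suc)

lemma Fmat_index:
  assumes "n \<le> J" "i \<le> Suc J"
  shows "Fmat q (Suc J) $$ (i, n) = (if n = i then Fa q J i else 0)"
    "Fmat q (Suc J) $$ (i, Suc J + n) = (if Suc n = i then Fb q J i else 0)"
  using assms by (auto simp: Fmat_def Fa_def Fb_def Fcoef_def Let_def)

definition Rop :: "(complex fls \<Rightarrow> 'a::ring_1) \<Rightarrow> complex \<Rightarrow> complex \<Rightarrow> nat \<Rightarrow> complex fls \<Rightarrow> (nat \<Rightarrow> nat \<Rightarrow> 'a) \<Rightarrow> nat \<Rightarrow> nat \<Rightarrow> 'a" where
  "Rop emb q r J x \<psi> a n = emb (Rfac r J x) *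
     (if a = 0 then emb (Rdiag r J x 0 n) * \<psi> 0 n + emb (Roff q J n) * \<psi> 1 (n - 1)
      else emb (Roff q J (Suc n)) * \<psi> 0 (Suc n) + emb (Rdiag r J x 1 n) * \<psi> 1 n)"

definition Eop :: "(complex fls \<Rightarrow> 'a::ring_1) \<Rightarrow> complex \<Rightarrow> nat \<Rightarrow> (nat \<Rightarrow> 'a) \<Rightarrow> nat \<Rightarrow> nat \<Rightarrow> 'a" where
  "Eop emb q J \<phi> a n = (if a = 0 then emb (fls_const (Ea q J n)) * \<phi> n
     else emb (fls_const (Eb q J (Suc n))) * \<phi> (Suc n))"

definition Fop :: "(complex fls \<Rightarrow> 'a::ring_1) \<Rightarrow> complex \<Rightarrow> nat \<Rightarrow> (nat \<Rightarrow> nat \<Rightarrow> 'a) \<Rightarrow> nat \<Rightarrow> 'a" where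
  "Fop emb q J \<psi> i = emb (fls_const (Fa q J i)) * \<psi> 0 i + emb (fls_const (Fb q J i)) * \<psi> 1 (i - 1)"

definition left_op :: "'a::ring_1 mat \<Rightarrow> (nat \<Rightarrow> nat \<Rightarrow> 'a) \<Rightarrow> nat \<Rightarrow> nat \<Rightarrow> 'a" where
  "left_op A \<psi> a n = A $$ (a, 0) * \<psi> 0 n + A $$ (a, 1) * \<psi> 1 n"

definition right_op :: "nat \<Rightarrow> 'a::ring_1 mat \<Rightarrow> (nat \<Rightarrow> nat \<Rightarrow> 'a) \<Rightarrow> nat \<Rightarrow> nat \<Rightarrow> 'a" where
  "right_op J Y \<psi> a n = (\<Sum>m\<le>J. Y $$ (n, m) * \<psi> a m)"

lemma Roff_0 [simp]: "Roff q J 0 = 0"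
  by (simp add: Roff_def bq_def Bcoef_def qnum_def)

lemma Roff_Suc [simp]: "Roff q J (Suc J) = 0"
  by (simp add: Roff_def bq_def Bcoef_def qnum_def)

lemma mat_apply_Rmat:
  fixes emb :: "complex fls \<Rightarrow> 'a::ring_1"
  assumes "emb 0 = 0" "\<And>x y. emb (x * y) = emb x * emb y" "a < 2" "n \<le> J" "Rdiag r 0 x 0 0 \<noteq> 0"
  shows "mat_apply (map_mat emb (Rmat q r J x)) (flat (Suc J) \<psi>) (a * Suc J + n) = Rop emb q r J x \<psi> a n"
proof -
  let ?R = "map_mat emb (Rmat q r J x)"
  have lt: "a * Suc J + n < 2 * Suc J"
    using assms by (auto simp: less_2_cases_iff)
  have 0: "?R $$ (a * Suc J + n, m) = emb (Rfac r J x) *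
     (if a = 0 then (if m = n then emb (Rdiag r J x 0 n) else 0) else (if m = Suc n then emb (Roff q J (Suc n)) else 0))"
    if "m < Suc J" for m
    using Rmat_index[of a 0 n J m r x q] Rmat_carrier[of q r J x] assms that lt by auto
  have 1: "?R $$ (a * Suc J + n, Suc J + m) = emb (Rfac r J x) *
     (if a = 1 then (if m = n then emb (Rdiag r J x 1 n) else 0) else (if n = Suc m then emb (Roff q J n) else 0))"
    if "m < Suc J" for m
    using Rmat_index[of a 1 n J m r x q] Rmat_carrier[of q r J x] assms that lt by auto
  have *: "(\<Sum>m<Suc J. (if m = Suc n then emb (Roff q J (Suc n)) else 0) * \<psi> 0 m)
      = emb (Roff q J (Suc n)) * \<psi> 0 (Suc n)"
    using assms by (cases "n = J") (simp_all add: if_distrib[of "\<lambda>x. x * _"] cong: if_cong)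
  have **: "(\<Sum>m<Suc J. (if n = Suc m then emb (Roff q J n) else 0) * \<psi> 1 m)
      = emb (Roff q J n) * \<psi> 1 (n - 1)"
    using assms by (cases n) (simp_all add: if_distrib[of "\<lambda>x. x * _"] cong: if_cong)
  have "dim_col ?R = 2 * Suc J" using Rmat_carrier[of q r J x] by auto
  then have "mat_apply ?R (flat (Suc J) \<psi>) (a * Suc J + n) =
     emb (Rfac r J x) * (\<Sum>m<Suc J. (if a = 0 then (if m = n then emb (Rdiag r J x 0 n) else 0) else (if m = Suc n then emb (Roff q J (Suc n)) else 0)) * \<psi> 0 m)
   + emb (Rfac r J x) * (\<Sum>m<Suc J. (if a = 1 then (if m = n then emb (Rdiag r J x 1 n) else 0) else (if n = Suc m then emb (Roff q J n) else 0)) * \<psi> 1 m)"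
    unfolding sum_distrib_left
    by (simp only: mat_apply_flat) (intro arg_cong2[where f = "(+)"] sum.cong, auto simp only: 0 1 mult.assoc lessThan_iff)
  also have "\<dots> = Rop emb q r J x \<psi> a n"
    using assms(3,4) * ** unfolding Rop_def
    by (auto simp: less_2_cases_iff distrib_left if_distrib[of "\<lambda>x. x * _"] simp del: sum.lessThan_Suc cong: if_cong)
  finally show ?thesis .
qed

lemma mat_apply_Fmat:
  fixes emb :: "complex fls \<Rightarrow> 'a::ring_1"
  assumes "emb 0 = 0" "i \<le> Suc J"
  shows "mat_apply (map_mat (\<lambda>a. emb (fls_const a)) (Fmat q (Suc J))) (flat (Suc J) \<psi>) i = Fop emb q J \<psi> i"
proof -
  let ?F = "map_mat (\<lambda>a. emb (fls_const a)) (Fmat q (Suc J))"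
  have F: "Fmat q (Suc J) \<in> carrier_mat (Suc (Suc J)) (2 * Suc J)"
    by (simp add: Fmat_def)
  have 0: "?F $$ (i, n) = (if n = i then emb (fls_const (Fa q J i)) else 0)" if "n < Suc J" for n
    using Fmat_index(1)[of n J i q] F that assms by auto
  have 1: "?F $$ (i, Suc J + n) = (if i = Suc n then emb (fls_const (Fb q J i)) else 0)" if "n < Suc J" for n
    using Fmat_index(2)[of n J i q] F that assms by auto
  have *: "(\<Sum>m<Suc J. (if i = Suc m then emb (fls_const (Fb q J i)) else 0) * \<psi> 1 m)
      = emb (fls_const (Fb q J i)) * \<psi> 1 (i - 1)"
    using assms by (cases i) (simp_all add: Fb_def if_distrib[of "\<lambda>x. x * _"] cong: if_cong)
  have **: "(\<Sum>m<Suc J. (if m = i then emb (fls_const (Fa q J i)) else 0) * \<psi> 0 m)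
      = emb (fls_const (Fa q J i)) * \<psi> 0 i"
    using assms by (cases "i = Suc J") (simp_all add: Fa_def if_distrib[of "\<lambda>x. x * _"] cong: if_cong)
  have "dim_col ?F = 2 * Suc J" using F by auto
  then have "mat_apply ?F (flat (Suc J) \<psi>) i =
     (\<Sum>m<Suc J. (if m = i then emb (fls_const (Fa q J i)) else 0) * \<psi> 0 m)
   + (\<Sum>m<Suc J. (if i = Suc m then emb (fls_const (Fb q J i)) else 0) * \<psi> 1 m)"
    by (simp only: mat_apply_flat) (intro arg_cong2[where f = "(+)"] sum.cong, auto simp only: 0 1 mult.assoc lessThan_iff)
  then show ?thesis unfolding * ** Fop_def .
qed

lemma fused_carrier: "fused q r emb K J x \<in> carrier_mat (Suc J) (Suc J)"
  by (cases J) (auto simp: Fmat_def Emat_def)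

lemma flat_index: "n < N \<Longrightarrow> flat N \<psi> (a * N + n) = \<psi> a n"
  by (simp add: flat_def)

definition fusion_step :: "(complex fls \<Rightarrow> 'a::ring_1) \<Rightarrow> complex \<Rightarrow> complex \<Rightarrow> nat \<Rightarrow> 'a mat \<Rightarrow> 'a mat \<Rightarrow> complex fls \<Rightarrow> (nat \<Rightarrow> 'a) \<Rightarrow> nat \<Rightarrow> nat \<Rightarrow> 'a" where
  "fusion_step emb q r J K1 Y z \<phi> = left_op K1 (Rop emb q r J z (right_op J Y (Eop emb q J \<phi>)))"

text \<open>
  The form of the recursion that all inductions use: a column of the fused matrix arises by letting the
  five factors act one after the other on a unit vector.
\<close>

lemma fused_Suc_index:
  fixes emb :: "complex fls \<Rightarrow> 'a::ring_1" and K :: "complex fls \<Rightarrow> 'a mat"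
  assumes emb: "emb 0 = 0" "emb 1 = 1" "\<And>x y. emb (x * y) = emb x * emb y"
    and K: "\<And>x. K x \<in> carrier_mat 2 2"
    and nz: "Rdiag r 0 (x^2 * fls_const (r powi (1 - int J))) 0 0 \<noteq> 0"
    and i: "i \<le> Suc J" "k \<le> Suc J"
  shows "fused q r emb K (Suc J) x $$ (i, k) = Fop emb q J
    (fusion_step emb q r J (K (x * fls_const (r powi (- int J))))
      (fused q r emb K J (x * fls_const r)) (x^2 * fls_const (r powi (1 - int J)))
      (\<lambda>n. if n = k then 1 else 0)) i"
proof -
  let ?N = "Suc J"
  let ?F = "map_mat (\<lambda>a. emb (fls_const a)) (Fmat q (Suc J))"
  let ?K = "K (x * fls_const (r powi (- int J)))"
  let ?Y = "fused q r emb K J (x * fls_const r)"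
  let ?R = "map_mat emb (Rmat q r J (x^2 * fls_const (r powi (1 - int J))))"
  let ?E = "map_mat (\<lambda>a. emb (fls_const a)) (Emat q (Suc J))"
  let ?d = "\<lambda>n. if n = k then 1 else 0 :: 'a"
  have F: "?F \<in> carrier_mat (Suc ?N) (2 * ?N)" by (simp add: Fmat_def)
  have E: "?E \<in> carrier_mat (2 * ?N) (Suc ?N)" by (simp add: Emat_def)
  have R: "?R \<in> carrier_mat (2 * ?N) (2 * ?N)" using Rmat_carrier by simp
  have K1: "kron ?K (1\<^sub>m ?N) \<in> carrier_mat (2 * ?N) (2 * ?N)" by (rule kron_carrier[OF K]) simp
  have Y: "kron (1\<^sub>m 2) ?Y \<in> carrier_mat (2 * ?N) (2 * ?N)"
    by (rule kron_carrier[OF _ fused_carrier]) simp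
  have step: "(A * B) $$ (l, k) = flat ?N (T \<psi>) l"
    if "A \<in> carrier_mat (2 * ?N) (2 * ?N)" "B \<in> carrier_mat (2 * ?N) (Suc ?N)" "l < 2 * ?N"
      and "\<And>l. l < 2 * ?N \<Longrightarrow> B $$ (l, k) = flat ?N \<psi> l"
      and "mat_apply A (flat ?N \<psi>) l = flat ?N (T \<psi>) l" for A B :: "'a mat" and \<psi> T l
  proof -
    have "(A * B) $$ (l, k) = mat_apply A (\<lambda>l. B $$ (l, k)) l"
      by (rule index_mult_mat_apply) (use that(1-3) i in auto)
    also have "\<dots> = mat_apply A (flat ?N \<psi>) l"
      by (rule mat_apply_cong) (use that(1,4) in auto)
    finally show ?thesis using that(5) by simp
  qed
  have ex: "\<exists>a n. l = a * ?N + n \<and> a < 2 \<and> n < ?N" if "l < 2 * ?N" for l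
  proof (intro exI conjI)
    show "l = (l div ?N) * ?N + l mod ?N" by (rule div_mult_mod_eq[symmetric])
    show "l div ?N < 2" using that by (simp add: less_mult_imp_div_less del: mult_Suc_right)
  qed simp
  have Ecol: "?E $$ (l, k) = flat ?N (Eop emb q J ?d) l" if l: "l < 2 * ?N" for l
  proof -
    obtain a n where *: "l = a * ?N + n" "a < 2" "n < ?N" using ex[OF l] by blast
    have "?E $$ (l, k) = emb (fls_const (Emat q (Suc J) $$ (l, k)))"
      using l E i by (simp add: Emat_def)
    also have "Emat q (Suc J) $$ (l, k) = (if a = 0 then (if n = k then Ea q J k else 0) else
        (if Suc n = k then Eb q J k else 0))"
      using * Emat_index[of n J k q] i by (auto simp: less_2_cases_iff)
    finally show ?thesis
      using emb unfolding *(1) flat_index[OF *(3)] by (auto simp: Eop_def)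
  qed
  have op: "mat_apply A (flat ?N \<psi>) l = flat ?N (T \<psi>) l"
    if l: "l < 2 * ?N" and "\<And>a n. a < 2 \<Longrightarrow> n < ?N \<Longrightarrow> mat_apply A (flat ?N \<psi>) (a * ?N + n) = T \<psi> a n"
    for A :: "'a mat" and T \<psi> l
    using ex[OF l] that(2) flat_index by metis
  have opY: "mat_apply (kron (1\<^sub>m 2) ?Y) (flat ?N \<psi>) l = flat ?N (right_op J ?Y \<psi>) l" if "l < 2 * ?N" for \<psi> l
    by (rule op[OF that], subst mat_apply_kron_right[OF fused_carrier])
      (simp_all add: right_op_def lessThan_Suc_atMost)
  have opR: "mat_apply ?R (flat ?N \<psi>) l = flat ?N (Rop emb q r J (x^2 * fls_const (r powi (1 - int J))) \<psi>) l"
    if "l < 2 * ?N" for \<psi> l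
    by (rule op[OF that], rule mat_apply_Rmat) (use emb nz in auto)
  have opK: "mat_apply (kron ?K (1\<^sub>m ?N)) (flat ?N \<psi>) l = flat ?N (left_op ?K \<psi>) l" if "l < 2 * ?N" for \<psi> l
    by (rule op[OF that], subst mat_apply_kron_left[OF K]) (simp_all add: left_op_def)
  have "fused q r emb K (Suc J) x $$ (i, k)
     = (?F * (kron ?K (1\<^sub>m ?N) * (?R * (kron (1\<^sub>m 2) ?Y * ?E)))) $$ (i, k)"
    using F E R K1 Y by (simp del: mult_Suc mult_Suc_right add: assoc_mult_mat[of _ _ "2 * ?N" _ "2 * ?N" _ _] )
  also have "\<dots> = mat_apply ?F (\<lambda>l. (kron ?K (1\<^sub>m ?N) * (?R * (kron (1\<^sub>m 2) ?Y * ?E))) $$ (l, k)) i"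
    using F E R K1 Y i by (intro index_mult_mat_apply) auto
  also have "\<dots> = mat_apply ?F (flat ?N (fusion_step emb q r J ?K ?Y (x^2 * fls_const (r powi (1 - int J))) ?d)) i"
  proof (rule mat_apply_cong)
    fix l assume "l < dim_col ?F"
    then have l: "l < 2 * ?N" using F by auto
    have e1: "(kron (1\<^sub>m 2) ?Y * ?E) $$ (l, k) = flat ?N (right_op J ?Y (Eop emb q J ?d)) l" if "l < 2 * ?N" for l
      by (rule step[where T = "right_op J ?Y" and \<psi> = "Eop emb q J ?d", OF Y E that Ecol opY[OF that]])
    have e2: "(?R * (kron (1\<^sub>m 2) ?Y * ?E)) $$ (l, k) =
       flat ?N (Rop emb q r J (x^2 * fls_const (r powi (1 - int J))) (right_op J ?Y (Eop emb q J ?d))) l" if "l < 2 * ?N" for l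

      by (rule step[where T = "Rop emb q r J (x^2 * fls_const (r powi (1 - int J)))"
            and \<psi> = "right_op J ?Y (Eop emb q J ?d)", OF R _ that e1 opR[OF that]])
        (use mult_carrier_mat[OF Y E] in simp_all)
    show "(kron ?K (1\<^sub>m ?N) * (?R * (kron (1\<^sub>m 2) ?Y * ?E))) $$ (l, k) =
      flat ?N (fusion_step emb q r J ?K ?Y (x^2 * fls_const (r powi (1 - int J))) ?d) l"
      unfolding fusion_step_def
      by (rule step[where T = "left_op ?K" and \<psi> = "Rop emb q r J (x^2 * fls_const (r powi (1 - int J))) (right_op J ?Y (Eop emb q J ?d))",
            OF K1 _ l e2 opK[OF l]])
        (use mult_carrier_mat[OF R mult_carrier_mat[OF Y E]] in simp_all)
  qed
  also have "\<dots> = Fop emb q J (fusion_step emb q r J ?K ?Y (x^2 * fls_const (r powi (1 - int J))) ?d) i"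
    by (rule mat_apply_Fmat) (use emb i in auto)
  finally show ?thesis .
qed

section \<open>Spin coefficients and the two coideal generators\<close>

locale generic_q =
  fixes q r :: complex
  assumes q_nz: "q \<noteq> 0" and q_power: "\<And>n::nat. n \<ge> 1 \<Longrightarrow> q ^ n \<noteq> 1" and r_sq: "r ^ 2 = q"
begin

lemma r_nz: "r \<noteq> 0"
  using q_nz r_sq by auto

lemma q_diff_nz: "q - inverse q \<noteq> 0"
proof
  assume "q - inverse q = 0"
  then have "q ^ 2 = 1" using q_nz by (simp add: power2_eq_square field_simps)
  then show False using q_power[of 2] by simp
qed

lemma q_sum_nz: "q + inverse q \<noteq> 0"
proof
  assume "q + inverse q = 0"
  then have "q ^ 2 = - 1" using q_nz by (simp add: power2_eq_square field_simps eq_neg_iff_add_eq_0)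
  moreover have "q ^ 4 = (q ^ 2) ^ 2" by (simp flip: power_mult)
  ultimately have "q ^ 4 = 1" by simp
  then show False using q_power[of 4] by simp
qed

lemma qnum_nz: "n \<ge> 1 \<Longrightarrow> qnum q (int n) \<noteq> 0"
proof
  assume n: "n \<ge> 1" and "qnum q (int n) = 0"
  then have "q powi int n = q powi (- int n)"
    using q_diff_nz by (simp add: qnum_def)
  then have "q ^ n * q ^ n = 1"
    using q_nz by (simp add: power_int_minus field_simps)
  then show False using q_power[of "n + n"] n by (simp add: power_add)
qed

lemma qnum_0 [simp]: "qnum q 0 = 0"
  by (simp add: qnum_def)

lemma qnum_1 [simp]: "qnum q 1 = 1"
  using q_diff_nz by (simp add: qnum_def power_int_minus)

lemma bq_sq: "bq q J n ^ 2 = qnum q (int n) * qnum q (int J + 1 - int n)"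
proof -
  have *: "(int J + (int J + 2 - 2 * int n)) div 2 = int J + 1 - int n"
    "(int J - (int J + 2 - 2 * int n)) div 2 + 1 = int n" by linarith+
  show ?thesis unfolding bq_def Bcoef_def * power2_csqrt by (rule mult.commute)
qed

lemma bq_0 [simp]: "bq q J 0 = 0"
  using bq_sq[of J 0] by simp

lemma bq_Suc [simp]: "bq q J (Suc J) = 0"
  using bq_sq[of J "Suc J"] by simp

lemma bq_nz: "1 \<le> n \<Longrightarrow> n \<le> J \<Longrightarrow> bq q J n \<noteq> 0"
  using bq_sq[of J n] qnum_nz[of n] qnum_nz[of "J + 1 - n"] by (auto simp: of_nat_diff algebra_simps)

lemma Ea_0 [simp]: "Ea q J 0 = 1"
  by (simp add: Ea_def)

lemma Ea_Suc: "n \<le> J \<Longrightarrow> Ea q J (Suc n) * bq q (Suc J) (Suc n) = Ea q J n * bq q J (Suc n)"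
  using bq_nz[of "Suc n" "Suc J"] by (simp add: Ea_def)

lemma Eb_0 [simp]: "Eb q J 0 = 0"
  by (simp add: Eb_def)

lemma Eb_Suc: "n \<le> J \<Longrightarrow> Eb q J (Suc n) * bq q (Suc J) (Suc n) = qnum q (1 + int n) * Ea q J n"
  using bq_nz[of "Suc n" "Suc J"] by (simp add: Eb_def)

lemma Ea_nz: "n \<le> J \<Longrightarrow> Ea q J n \<noteq> 0"
  using bq_nz by (auto simp: Ea_def)

lemma Ea_Suc_top [simp]: "Ea q J (Suc J) = 0"
  by (simp add: Ea_def)

lemma Eb_nz: "1 \<le> n \<Longrightarrow> n \<le> Suc J \<Longrightarrow> Eb q J n \<noteq> 0"
  using Ea_nz[of "n - 1" J] bq_nz[of n "Suc J"] qnum_nz[of n] by (simp add: Eb_def)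

lemma bq_Eb: "n \<le> Suc J \<Longrightarrow> bq q J n * Eb q J n = qnum q (int n) * Ea q J n"
proof (cases n)
  case (Suc m)
  assume "n \<le> Suc J"
  then have nz: "bq q (Suc J) (Suc m) \<noteq> 0" and m: "m \<le> J" using Suc bq_nz[of "Suc m" "Suc J"] by auto
  have "(bq q J n * Eb q J n) * bq q (Suc J) n = (qnum q (int n) * Ea q J n) * bq q (Suc J) n"
  proof -
    have "(bq q J n * Eb q J n) * bq q (Suc J) n = bq q J n * (qnum q (int n) * Ea q J m)"
      using Eb_Suc[OF m] by (simp add: Suc mult.assoc)
    also have "\<dots> = qnum q (int n) * (Ea q J n * bq q (Suc J) n)"
      using Ea_Suc[OF m] by (simp add: Suc ac_simps)
    finally show ?thesis by (simp add: mult.assoc)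
  qed
  then show ?thesis using nz Suc by simp
qed simp

lemma Eb_shift: "n \<le> J \<Longrightarrow> Eb q J (Suc n) * bq q J n = bq q (Suc J) (Suc n) * Eb q J n"
proof -
  assume n: "n \<le> J"
  have nz: "bq q (Suc J) (Suc n) \<noteq> 0" using n bq_nz[of "Suc n" "Suc J"] by simp
  have "Eb q J (Suc n) * bq q J n * bq q (Suc J) (Suc n) = qnum q (1 + int n) * (Ea q J n * bq q J n)"
    using Eb_Suc[OF n] by (simp add: algebra_simps)
  also have "\<dots> = qnum q (1 + int n) * qnum q (int J + 1 - int n) * Eb q J n"
  proof (cases n)
    case (Suc m)
    have m: "m \<le> J" "n \<le> J" using n Suc by auto
    have nz': "qnum q (int n) \<noteq> 0" using Suc qnum_nz[of n] by simp
    have "qnum q (int n) * (Ea q J n * bq q J n) = bq q J n ^ 2 * Eb q J n"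
      using bq_Eb[of n J] n by (simp add: power2_eq_square algebra_simps)
    also have "\<dots> = qnum q (int n) * (qnum q (int J + 1 - int n) * Eb q J n)"
      by (simp add: bq_sq)
    finally show ?thesis using nz' by (simp add: mult.assoc)
  qed simp
  also have "\<dots> = bq q (Suc J) (Suc n) ^ 2 * Eb q J n"
  proof -
    have "int (Suc n) = 1 + int n" "int (Suc J) + 1 - int (Suc n) = int J + 1 - int n" by simp_all
    then show ?thesis unfolding bq_sq by metis
  qed
  finally show ?thesis using nz by (simp add: power2_eq_square)
qed

text \<open>
  The left fusion map is a left inverse of the right one.
\<close>

lemma Fa_Fb: "n \<le> Suc J \<Longrightarrow> Fa q J n * Ea q J n + Fb q J n * Eb q J n = 1"
proof -
  assume n: "n \<le> Suc J"
  have Ecoef_a: "Ecoef q (Suc J) (Suc n) (Suc n) = Ea q J n" if "n \<le> J" for n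
    using that by (simp add: Ecoef_def Ediag_Suc)
  have Ecoef_b: "Ecoef q (Suc J) (Suc (n + J)) (Suc n) = Eb q J n" if "1 \<le> n" "n \<le> Suc J" for n
    using that Ediag_Suc[of q J "n - 1"]
    by (cases n) (auto simp: Ecoef_def Eb_def Let_def bq_def algebra_simps)
  consider "n = 0" | "1 \<le> n" "n \<le> J" | "n = Suc J" using n by linarith
  then show ?thesis
  proof cases
    case 1
    then show ?thesis by (simp add: Fa_def Fb_def Fcoef_def Let_def)
  next
    case 2
    then have "Fa q J n = (1 - Fb q J n * Eb q J n) / Ea q J n"
      using Ecoef_a[of n] Ecoef_b[of n] by (simp add: Fa_def Fb_def Fcoef_def Let_def)
    then show ?thesis using Ea_nz[of n J] 2 by (simp add: field_simps)
  next
    case 3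
    then have "Fb q J n = inverse (Eb q J n)"
      using Ecoef_b[of n] by (auto simp: Fb_def Fcoef_def Let_def mult_2)
    then show ?thesis using 3 Eb_nz[of n J] by simp
  qed
qed

end

text \<open>
  The substitution of \<open>q\<^sup>-\<^sup>1\<close> for \<open>q\<close> and \<open>u\<^sup>-\<^sup>1\<close> for \<open>u\<close> turns the relations of \<open>W\<^sub>0\<close> into those of \<open>W\<^sub>1\<close>.
  Everything is therefore done once, for a parameter \<open>p\<close> that is \<open>r\<close> for \<open>W\<^sub>0\<close> and \<open>r\<^sup>-\<^sup>1\<close> for \<open>W\<^sub>1\<close>.
\<close>

locale spin_param = generic_q +
  fixes p :: complex
  assumes p_cases: "p = r \<or> p = inverse r"
begin

lemma p_nz: "p \<noteq> 0"
  using p_cases r_nz by auto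

definition cp :: "int \<Rightarrow> complex fls" where "cp k = fls_const (p powi k)"

lemma cp_mult: "cp a * cp b = cp (a + b)"
  using p_nz by (simp add: cp_def power_int_add flip: fls_const_mult_const)

lemma cp_mult_left: "cp a * (cp b * x) = cp (a + b) * x"
  by (simp add: cp_mult flip: mult.assoc)

lemma cp_0 [simp]: "cp 0 = 1" by (simp add: cp_def)

lemma cp_nz [simp]: "cp a \<noteq> 0" using p_nz by (simp add: cp_def)

lemma cp_expand:
  "cp (a + b) = cp a * cp b" "cp (a - b) = cp a / cp b" "cp (- a) = inverse (cp a)"
  "cp (numeral k * a) = cp a ^ numeral k" "cp (- numeral k * a) = inverse (cp a ^ numeral k)"
  "cp (numeral k) = cp 1 ^ numeral k" "cp (- numeral k) = inverse (cp 1 ^ numeral k)"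
  "cp (- 1) = inverse (cp 1)"
proof -
  show minus: "cp (- a) = inverse (cp a)" for a
    using cp_mult[of a "- a"] by (intro inverse_unique[symmetric]) simp
  show "cp (a + b) = cp a * cp b" by (simp add: cp_mult)
  show "cp (a - b) = cp a / cp b"
    by (simp add: divide_inverse minus[symmetric] cp_mult)
  have pow: "cp (int m * a) = cp a ^ m" for m a
    by (induction m) (simp_all add: distrib_right flip: cp_mult)
  show num: "cp (numeral k * a) = cp a ^ numeral k" for k a
    using pow[of "numeral k" a] by simp
  show "cp (- numeral k * a) = inverse (cp a ^ numeral k)"
    using minus[of "numeral k * a"] num by simp
  show "cp (numeral k) = cp 1 ^ numeral k" using num[of k 1] by simp
  then show "cp (- numeral k) = inverse (cp 1 ^ numeral k)" using minus[of "numeral k"] by simp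
  show "cp (- 1) = inverse (cp 1)" by (rule minus)
qed

lemma inverse_cp: "inverse (cp a) = cp (- a)"
  using cp_mult[of a "- a"] by (intro inverse_unique) simp

text \<open>
  The sign by which \<open>q - q\<^sup>-\<^sup>1\<close> differs from \<open>p\<^sup>2 - p\<^sup>-\<^sup>2\<close>.
\<close>

definition sg :: "complex fls" where "sg = (if p = r then 1 else - 1)"

text \<open>
  The entry of the spin raising matrix together with the power of \<open>p\<close> that it carries in the coaction.
\<close>

definition be :: "nat \<Rightarrow> nat \<Rightarrow> complex fls" where
  "be J n = fls_const (bq q J n) * cp (int J + 1 - 2 * int n)"

definition qn :: "int \<Rightarrow> complex fls" where "qn n = fls_const (qnum q n)"

lemma q_p: "q powi n = (if p = r then p powi (2 * n) else p powi (- 2 * n))"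
proof -
  have "q powi n = r powi (2 * n)" using r_sq by (simp add: power_int_mult power2_eq_square)
  then show ?thesis using p_cases by (auto simp: power_int_minus power_int_inverse)
qed

lemma qn_eq: "(cp 2 - cp (- 2)) * qn n = cp (2 * n) - cp (- 2 * n)"
proof -
  have "(q - inverse q) * qnum q n = q powi n - q powi (- n)"
    using q_diff_nz by (simp add: qnum_def)
  then have "(q powi 1 - q powi (- 1)) * qnum q n = q powi n - q powi (- n)"
    by (simp add: power_int_minus)
  then have "(p powi 2 - p powi (- 2)) * qnum q n = p powi (2 * n) - p powi (- 2 * n)"
    unfolding q_p by (auto split: if_splits simp: algebra_simps)
  then show ?thesis unfolding cp_def qn_def by (simp add: fls_minus_const)
qed

lemma q_diff_p: "fls_const (q - inverse q) = sg * (cp 2 - cp (- 2))"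
proof -
  have "q - inverse q = q powi 1 - q powi (- 1)" by (simp add: power_int_minus)
  then show ?thesis unfolding q_p sg_def cp_def fls_minus_const by (simp add: fls_minus_const del: fls_const_uminus flip: fls_const_uminus)
qed

lemma cp_diff_nz: "cp 2 - cp (- 2) \<noteq> 0"
proof -
  have "fls_const (q - inverse q) \<noteq> 0" using q_diff_nz by simp
  then show ?thesis unfolding q_diff_p by auto
qed

lemma be_0 [simp]: "be J 0 = 0" by (simp add: be_def)
lemma be_Suc [simp]: "be J (Suc J) = 0" by (simp add: be_def)
lemma Roff_eq: "Roff q J n = sg * (cp 2 - cp (- 2)) * fls_const (bq q J n)"
  by (simp add: Roff_def flip: q_diff_p)

definition param_of :: "complex fls \<Rightarrow> complex fls" where
  "param_of x = (if p = r then x else inverse x)"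

lemma Rdiag_eq:
  assumes "x \<noteq> 0"
  shows "Rdiag r J x 0 n = sg * (param_of x * cp (1 + int J - 2 * int n) - inverse (param_of x) * cp (2 * int n - int J - 1))"
    "Rdiag r J x (Suc 0) n = sg * (param_of x * cp (1 - int J + 2 * int n) - inverse (param_of x) * cp (int J - 1 - 2 * int n))"
proof -
  have r: "fls_const (r powi k) = (if p = r then cp k else cp (- k))" for k
    unfolding cp_def using p_cases by (auto simp: power_int_minus power_int_inverse)
  show "Rdiag r J x 0 n = sg * (param_of x * cp (1 + int J - 2 * int n) - inverse (param_of x) * cp (2 * int n - int J - 1))"
    "Rdiag r J x (Suc 0) n = sg * (param_of x * cp (1 - int J + 2 * int n) - inverse (param_of x) * cp (int J - 1 - 2 * int n))"
    unfolding Rdiag_def r Let_def by (auto simp: param_of_def sg_def algebra_simps)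
qed

lemma bq_square: "fls_const (bq q J n) * fls_const (bq q J n) = qn (int n) * qn (int J + 1 - int n)"
  using bq_sq[of J n] by (simp add: qn_def power2_eq_square)

text \<open>
  With the denominators of the \<open>q\<close>-integers cleared, the squares of the coefficients become Laurent
  polynomials in powers of \<open>p\<close>, so that identities involving them can be checked by expansion.
\<close>

lemma bq_square_cleared: "(cp 2 - cp (- 2)) * ((cp 2 - cp (- 2)) * (fls_const (bq q J n) * fls_const (bq q J n)))
   = (cp (2 * int n) - cp (- 2 * int n)) * (cp (2 * (int J + 1 - int n)) - cp (- 2 * (int J + 1 - int n)))"
  unfolding bq_square qn_eq[symmetric] by (simp add: ac_simps)

end

text \<open>
  The spectral parameter is \<open>v\<close>, and \<open>iv\<close> is its inverse; a separate variable keeps both in monomial form.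
  The parameters \<open>kp\<close> and \<open>km\<close> scale the off-diagonal part of the coaction.
\<close>

locale spin_spectral = spin_param +
  fixes J :: nat and v iv kp km :: "complex fls"
  assumes v_iv: "v * iv = 1"
begin

lemma v_iv_left: "v * (iv * x) = x" "iv * (v * x) = x" "iv * v = 1"
  using v_iv by (simp_all add: mult.assoc[symmetric] mult.commute[of iv v])

text \<open>
  The diagonal R-matrix entries in a fusion step, where the spectral parameter is \<open>v\<^sup>2 p\<^bsup>1-J\<^esup>\<close>. In the
  abbreviations that follow, \<open>al\<close> and \<open>ga\<close> are the raising and lowering coefficients of the coaction on the
  first and on the second tensor factor.
\<close>

definition D0 :: "nat \<Rightarrow> complex fls" where
  "D0 n = sg * (v * (v * cp (2 - 2 * int n)) - iv * (iv * cp (2 * int n - 2)))"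
definition D1 :: "nat \<Rightarrow> complex fls" where
  "D1 n = sg * (v * (v * cp (2 - 2 * int J + 2 * int n)) - iv * (iv * cp (2 * int J - 2 - 2 * int n)))"

abbreviation "h n \<equiv> int J - 2 * int n"
abbreviation "Of n \<equiv> Roff q J n"
abbreviation "al1 \<equiv> kp * v * cp (- int J)"
abbreviation "ga1 \<equiv> km * iv * cp (int J)"
abbreviation "al2 \<equiv> kp * iv * cp (- 1)"
abbreviation "ga2 \<equiv> km * v * cp 1"

lemma v_nz [simp]: "v \<noteq> 0" using v_iv by auto

lemma iv_eq: "iv = inverse v" using v_iv by (rule inverse_unique[symmetric])

lemmas cp_simps = cp_mult cp_mult_left v_iv_left v_iv

lemmas monomials = cp_expand iv_eq of_nat_Suc power_mult_distrib divide_simps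

lemma cancel_cp_diff:
  assumes "(cp 2 - cp (- 2)) * x = (cp 2 - cp (- 2)) * y" shows "x = y"
  using assms cp_diff_nz by simp

text \<open>
  The next nine identities are the scalar content of the intertwining property of the R-matrix: each
  compares the coefficients of one basis vector, named by the two rows and the move in the second factor.
\<close>

lemma Rmat_relation_00_up: "D0 n * (cp 2 * (al2 * be J (Suc n))) = al2 * be J (Suc n) * D0 (Suc n) + cp (2 * h n) * al1 * Of (Suc n)"
  unfolding D0_def Roff_eq be_def
    by (simp add: monomials, (simp add: algebra_simps power_numeral_reduce)?)

lemma Rmat_relation_01_diag: "D0 n * al1 + Of n * (cp (- 2) * (al2 * be J n)) = al2 * be J (Suc n) * Of (Suc n) + cp (2 * h n) * al1 * D1 n"
proof (rule cancel_cp_diff)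
  have *: "(cp 2 - cp (- 2)) * (Of m * be J m) =
     sg * cp (int J + 1 - 2 * int m) * ((cp (2 * int m) - cp (- 2 * int m)) * (cp (2 * (int J + 1 - int m)) - cp (- 2 * (int J + 1 - int m))))" for m
    unfolding Roff_eq be_def bq_square_cleared[symmetric] by (simp add: ac_simps)
  have "(cp 2 - cp (- 2)) * (D0 n * al1 + Of n * (cp (- 2) * (al2 * be J n)))
    = (cp 2 - cp (- 2)) * (D0 n * al1) + cp (- 2) * al2 * ((cp 2 - cp (- 2)) * (Of n * be J n))"
    by (simp add: algebra_simps)
  also have "\<dots> = al2 * ((cp 2 - cp (- 2)) * (Of (Suc n) * be J (Suc n))) + (cp 2 - cp (- 2)) * (cp (2 * h n) * al1 * D1 n)"
    unfolding * D0_def D1_def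
    by (simp add: monomials, (simp add: algebra_simps power_numeral_reduce)?)
  also have "\<dots> = (cp 2 - cp (- 2)) * (al2 * be J (Suc n) * Of (Suc n) + cp (2 * h n) * al1 * D1 n)"
    by (simp add: algebra_simps)
  finally show "(cp 2 - cp (- 2)) * (D0 n * al1 + Of n * (cp (- 2) * (al2 * be J n))) =
     (cp 2 - cp (- 2)) * (al2 * be J (Suc n) * Of (Suc n) + cp (2 * h n) * al1 * D1 n)" .
qed

lemma Rmat_relation_00_down: "D0 (Suc n) * (cp 2 * (ga2 * be J (Suc n))) + Of (Suc n) * ga1 = ga2 * be J (Suc n) * D0 n"
  unfolding D0_def Roff_eq be_def
    by (simp add: monomials, (simp add: algebra_simps power_numeral_reduce)?)

lemma Rmat_relation_01_down: "Of (Suc n) * (cp (- 2) * (ga2 * be J n)) = ga2 * be J (Suc n) * Of n"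
  unfolding Roff_eq be_def
    by (simp add: monomials, (simp add: algebra_simps power_numeral_reduce)?)

lemma Rmat_relation_10_up: "Of (Suc n) * (cp 2 * (al2 * be J (Suc (Suc n)))) = al2 * be J (Suc n) * Of (Suc (Suc n))"
  unfolding Roff_eq be_def
    by (simp add: monomials, (simp add: algebra_simps power_numeral_reduce)?)

lemma Rmat_relation_11_up: "Of (Suc n) * al1 + D1 n * (cp (- 2) * (al2 * be J (Suc n))) = al2 * be J (Suc n) * D1 (Suc n)"
  unfolding D1_def Roff_eq be_def
    by (simp add: monomials, (simp add: algebra_simps power_numeral_reduce)?)

lemma Rmat_relation_10_diag: "Of (Suc n) * (cp 2 * (ga2 * be J (Suc n))) + D1 n * ga1 = ga2 * be J n * Of n + cp (2 * h n) * ga1 * D0 n"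
proof (rule cancel_cp_diff)
  have *: "(cp 2 - cp (- 2)) * (Of m * be J m) =
     sg * cp (int J + 1 - 2 * int m) * ((cp (2 * int m) - cp (- 2 * int m)) * (cp (2 * (int J + 1 - int m)) - cp (- 2 * (int J + 1 - int m))))" for m
    unfolding Roff_eq be_def bq_square_cleared[symmetric] by (simp add: ac_simps)
  have "(cp 2 - cp (- 2)) * (Of (Suc n) * (cp 2 * (ga2 * be J (Suc n))) + D1 n * ga1)
    = cp 2 * ga2 * ((cp 2 - cp (- 2)) * (Of (Suc n) * be J (Suc n))) + (cp 2 - cp (- 2)) * (D1 n * ga1)"
    by (simp add: algebra_simps)
  also have "\<dots> = ga2 * ((cp 2 - cp (- 2)) * (Of n * be J n)) + (cp 2 - cp (- 2)) * (cp (2 * h n) * ga1 * D0 n)"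
    unfolding * D0_def D1_def
    by (simp add: monomials, (simp add: algebra_simps power_numeral_reduce)?)
  also have "\<dots> = (cp 2 - cp (- 2)) * (ga2 * be J n * Of n + cp (2 * h n) * ga1 * D0 n)"
    by (simp add: algebra_simps)
  finally show "(cp 2 - cp (- 2)) * (Of (Suc n) * (cp 2 * (ga2 * be J (Suc n))) + D1 n * ga1) =
     (cp 2 - cp (- 2)) * (ga2 * be J n * Of n + cp (2 * h n) * ga1 * D0 n)" .
qed

lemma Rmat_relation_11_down: "D1 (Suc n) * (cp (- 2) * (ga2 * be J (Suc n))) = ga2 * be J (Suc n) * D1 n + cp (2 * h (Suc n)) * ga1 * Of (Suc n)"
  unfolding D1_def Roff_eq be_def
    by (simp add: monomials, (simp add: algebra_simps power_numeral_reduce)?)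

lemma Rmat_relation_weight: "Of (Suc n) * (cp 2 * cp (2 * h (Suc n))) = cp (- 2) * (cp (2 * h n) * Of (Suc n))"

    by (simp add: monomials, (simp add: algebra_simps power_numeral_reduce)?)

end

section \<open>One fusion step as an intertwiner\<close>

text \<open>
  Scalar series embedded into a ring in which they are central, such as the series over the free algebra.
\<close>

locale central_scalars =
  fixes emb :: "complex fls \<Rightarrow> 'a::ring_1"
  assumes emb_1 [simp]: "emb 1 = 1"
    and emb_add: "emb (a + b) = emb a + emb b"
    and emb_mult: "emb (a * b) = emb a * emb b"
    and emb_commute: "emb a * x = x * emb a"
begin

lemma emb_0 [simp]: "emb 0 = 0"
  using emb_add[of 0 0] by simp

lemma emb_minus: "emb (- a) = - emb a"
  using emb_add[of a "- a"] by (simp add: eq_neg_iff_add_eq_0 add.commute)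

lemma emb_diff: "emb (a - b) = emb a - emb b"
  using emb_add[of a "- b"] by (simp add: emb_minus)

lemma emb_assoc: "emb a * (emb b * x) = emb (a * b) * x"
  by (simp add: emb_mult mult.assoc)

lemma emb_left_commute: "x * (emb a * y) = emb a * (x * y)"
  by (metis emb_commute mult.assoc)

end

text \<open>
  Equations between operators hold modulo the ideal \<open>I\<close>; \<open>w\<close> is the generator \<open>W\<^sub>0\<close> or \<open>W\<^sub>1\<close>.
\<close>

locale fusion = spin_spectral q r p J v iv kp km + central_scalars emb + two_sided_ideal I
  for q r p :: complex and J :: nat and v iv kp km :: "complex fls"
    and emb :: "complex fls \<Rightarrow> 'a::ring_1" and I :: "'a set" +
  fixes w :: 'a
begin

text \<open>
  The coaction of the generator \<open>w\<close> on spin \<open>L/2\<close>: a diagonal part multiplying by \<open>w\<close>, and scalar raising and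
  lowering parts.
\<close>

definition opM :: "nat \<Rightarrow> complex fls \<Rightarrow> complex fls \<Rightarrow> (nat \<Rightarrow> 'a) \<Rightarrow> nat \<Rightarrow> 'a" where
  "opM L al ga \<phi> n = emb (cp (2 * (int L - 2 * int n))) * (w * \<phi> n)
     + emb (al * be L (Suc n)) * \<phi> (Suc n) + emb (ga * be L n) * \<phi> (n - 1)"

text \<open>
  The coaction on \<open>C\<^sup>2 \<otimes> C\<^bsup>J+1\<^esup>\<close>, in the two possible orders of the tensor factors. In \<open>opR\<close> the scalar part at the
  second factor carries the weight of the first one, in \<open>opL\<close> it is the other way round; the R-matrix relates the two.
\<close>

definition opR :: "complex fls \<Rightarrow> complex fls \<Rightarrow> complex fls \<Rightarrow> complex fls \<Rightarrow>
    (nat \<Rightarrow> nat \<Rightarrow> 'a) \<Rightarrow> nat \<Rightarrow> nat \<Rightarrow> 'a" where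
  "opR a1 g1 a2 g2 \<psi> a n = (if a = 0 then emb (cp 2) * opM J a2 g2 (\<psi> 0) n + emb a1 * \<psi> 1 n
     else emb (cp (- 2)) * opM J a2 g2 (\<psi> 1) n + emb g1 * \<psi> 0 n)"

definition opL :: "complex fls \<Rightarrow> complex fls \<Rightarrow> complex fls \<Rightarrow> complex fls \<Rightarrow>
    (nat \<Rightarrow> nat \<Rightarrow> 'a) \<Rightarrow> nat \<Rightarrow> nat \<Rightarrow> 'a" where
  "opL a1 g1 a2 g2 \<psi> a n = (if a = 0
     then emb (cp 2 * cp (2 * h n)) * (w * \<psi> 0 n) + emb (a2 * be J (Suc n)) * \<psi> 0 (Suc n)
       + emb (g2 * be J n) * \<psi> 0 (n - 1) + emb (cp (2 * h n) * a1) * \<psi> 1 n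
     else emb (cp (- 2) * cp (2 * h n)) * (w * \<psi> 1 n) + emb (a2 * be J (Suc n)) * \<psi> 1 (Suc n)
       + emb (g2 * be J n) * \<psi> 1 (n - 1) + emb (cp (2 * h n) * g1) * \<psi> 0 n)"

lemmas emb_simps = distrib_left right_diff_distrib emb_assoc emb_left_commute[of w] mult.assoc emb_add distrib_right

lemma right_op_opR:
  assumes Y: "\<And>\<phi>. (\<Sum>m\<le>J. Y $$ (n, m) * opM J a2 g2 \<phi> m) \<approx> opM J a2' g2' (\<lambda>n. \<Sum>m\<le>J. Y $$ (n, m) * \<phi> m) n"
  shows "right_op J Y (opR a1 g1 a2 g2 \<psi>) a n \<approx> opR a1 g1 a2' g2' (right_op J Y \<psi>) a n"
proof -
  have "(\<Sum>m\<le>J. Y $$ (n, m) * (emb c * opM J a2 g2 (\<psi> b) m + emb d * \<psi> e m)) \<approx>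
      emb c * opM J a2' g2' (\<lambda>n. \<Sum>m\<le>J. Y $$ (n, m) * \<psi> b m) n + emb d * (\<Sum>m\<le>J. Y $$ (n, m) * \<psi> e m)"
    for b c d e
  proof -
    have "(\<Sum>m\<le>J. Y $$ (n, m) * (emb c * opM J a2 g2 (\<psi> b) m + emb d * \<psi> e m)) =
       emb c * (\<Sum>m\<le>J. Y $$ (n, m) * opM J a2 g2 (\<psi> b) m) + emb d * (\<Sum>m\<le>J. Y $$ (n, m) * \<psi> e m)"
      by (simp add: distrib_left sum.distrib emb_left_commute sum_distrib_left)
    also have "\<dots> \<approx> emb c * opM J a2' g2' (\<lambda>n. \<Sum>m\<le>J. Y $$ (n, m) * \<psi> b m) n + emb d * (\<Sum>m\<le>J. Y $$ (n, m) * \<psi> e m)"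
      by (intro cong_add cong_mult_left Y cong_refl)
    finally show ?thesis .
  qed
  then show ?thesis
    unfolding right_op_def opR_def by auto
qed

text \<open>
  An identity of scalar matrices: the common factor \<open>Rfac\<close> drops out, and the remaining coefficients are
  compared one by one.
\<close>

lemma Rop_opR:
  assumes x: "x \<noteq> 0" "param_of x = v * (v * cp (1 - int J))" and a: "a < 2"
  shows "Rop emb q r J x (opR al1 ga1 al2 ga2 \<psi>) a n = opL al1 ga1 al2 ga2 (Rop emb q r J x \<psi>) a n"
proof -
  have "inverse (param_of x) = iv * (iv * cp (int J - 1))"
    unfolding x(2) by (rule inverse_unique) (simp add: ac_simps cp_simps)
  then have D: "Rdiag r J x 0 n = D0 n" "Rdiag r J x (Suc 0) n = D1 n" for n
    unfolding Rdiag_eq[OF x(1)] x(2) D0_def D1_def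
    by (simp_all add: algebra_simps cp_simps)
  define f where "f = Rfac r J x"
  define R where "R = (\<lambda>(\<psi> :: nat \<Rightarrow> nat \<Rightarrow> 'a) (a :: nat) n. if a = 0 then emb (D0 n) * \<psi> 0 n + emb (Of n) * \<psi> 1 (n - 1)
      else emb (Of (Suc n)) * \<psi> 0 (Suc n) + emb (D1 n) * \<psi> 1 n :: 'a)"
  have Rop: "Rop emb q r J x \<psi> a n = emb f * R \<psi> a n" for \<psi> a n
    by (simp add: Rop_def R_def D f_def)
  have lin: "opL al1 ga1 al2 ga2 (\<lambda>a n. emb f * R \<psi> a n) a n = emb f * opL al1 ga1 al2 ga2 (R \<psi>) a n"
    by (simp add: opL_def distrib_left emb_assoc emb_left_commute[of w] mult.commute)
  have "R (opR al1 ga1 al2 ga2 \<psi>) a n = opL al1 ga1 al2 ga2 (R \<psi>) a n"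
  proof (cases "a = 0")
    case True
    show ?thesis
    proof (cases n)
      case 0
      have "R (opR al1 ga1 al2 ga2 \<psi>) 0 0 =
        emb (D0 0 * (cp 2 * cp (2 * h 0))) * (w * \<psi> 0 0)
        + emb (D0 0 * (cp 2 * (al2 * be J (Suc 0)))) * \<psi> 0 (Suc 0)
        + emb (D0 0 * al1 + Of 0 * (cp (- 2) * (al2 * be J 0))) * \<psi> 1 0"
        by (simp add: R_def opR_def opM_def emb_simps add_ac)
      also have "\<dots> = opL al1 ga1 al2 ga2 (R \<psi>) 0 0"
        unfolding Rmat_relation_00_up Rmat_relation_01_diag by (simp add: R_def opL_def emb_simps ac_simps)
      finally show ?thesis using True 0 by simp
    next
      case (Suc m)
      have "R (opR al1 ga1 al2 ga2 \<psi>) 0 (Suc m) =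
        emb (D0 (Suc m) * (cp 2 * cp (2 * h (Suc m)))) * (w * \<psi> 0 (Suc m))
        + emb (Of (Suc m) * (cp (- 2) * cp (2 * h m))) * (w * \<psi> 1 m)
        + emb (D0 (Suc m) * (cp 2 * (al2 * be J (Suc (Suc m))))) * \<psi> 0 (Suc (Suc m))
        + emb (D0 (Suc m) * al1 + Of (Suc m) * (cp (- 2) * (al2 * be J (Suc m)))) * \<psi> 1 (Suc m)
        + emb (D0 (Suc m) * (cp 2 * (ga2 * be J (Suc m))) + Of (Suc m) * ga1) * \<psi> 0 m
        + emb (Of (Suc m) * (cp (- 2) * (ga2 * be J m))) * \<psi> 1 (m - 1)"
        by (simp add: R_def opR_def opM_def emb_simps add_ac)
      also have "Of (Suc m) * (cp (- 2) * cp (2 * h m)) = Of (Suc m) * (cp 2 * cp (2 * h (Suc m)))"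
        by (simp add: cp_mult algebra_simps)
      also note Rmat_relation_00_up also note Rmat_relation_01_diag also note Rmat_relation_00_down also note Rmat_relation_01_down
      finally show ?thesis using True Suc by (simp add: R_def opL_def emb_simps ac_simps)
    qed
  next
    case False
    then have a: "a = 1" using a by simp
    show ?thesis
    proof (cases n)
      case 0
      have "R (opR al1 ga1 al2 ga2 \<psi>) 1 0 =
        emb (Of (Suc 0) * (cp 2 * cp (2 * h (Suc 0)))) * (w * \<psi> 0 (Suc 0))
        + emb (D1 0 * (cp (- 2) * cp (2 * h 0))) * (w * \<psi> 1 0)
        + emb (Of (Suc 0) * (cp 2 * (al2 * be J (Suc (Suc 0))))) * \<psi> 0 (Suc (Suc 0))
        + emb (Of (Suc 0) * al1 + D1 0 * (cp (- 2) * (al2 * be J (Suc 0)))) * \<psi> 1 (Suc 0)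
        + emb (Of (Suc 0) * (cp 2 * (ga2 * be J (Suc 0))) + D1 0 * ga1) * \<psi> 0 0"
        by (simp add: R_def opR_def opM_def emb_simps add_ac)
      also note Rmat_relation_10_up also note Rmat_relation_11_up also note Rmat_relation_10_diag also note Rmat_relation_weight
      finally show ?thesis using a 0 by (simp add: R_def opL_def emb_simps ac_simps)
    next
      case (Suc m)
      have "R (opR al1 ga1 al2 ga2 \<psi>) 1 (Suc m) =
        emb (Of (Suc (Suc m)) * (cp 2 * cp (2 * h (Suc (Suc m))))) * (w * \<psi> 0 (Suc (Suc m)))
        + emb (D1 (Suc m) * (cp (- 2) * cp (2 * h (Suc m)))) * (w * \<psi> 1 (Suc m))
        + emb (Of (Suc (Suc m)) * (cp 2 * (al2 * be J (Suc (Suc (Suc m)))))) * \<psi> 0 (Suc (Suc (Suc m)))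
        + emb (Of (Suc (Suc m)) * al1 + D1 (Suc m) * (cp (- 2) * (al2 * be J (Suc (Suc m))))) * \<psi> 1 (Suc (Suc m))
        + emb (Of (Suc (Suc m)) * (cp 2 * (ga2 * be J (Suc (Suc m)))) + D1 (Suc m) * ga1) * \<psi> 0 (Suc m)
        + emb (D1 (Suc m) * (cp (- 2) * (ga2 * be J (Suc m)))) * \<psi> 1 m"
        by (simp add: R_def opR_def opM_def emb_simps add_ac)
      also note Rmat_relation_10_up also note Rmat_relation_11_up also note Rmat_relation_10_diag also note Rmat_relation_11_down also note Rmat_relation_weight
      finally show ?thesis using a Suc by (simp add: R_def opL_def emb_simps ac_simps)
    qed
  qed
  then show ?thesis unfolding Rop lin by simp
qed

abbreviation "al1' \<equiv> kp * iv * cp (int J)"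
abbreviation "ga1' \<equiv> km * v * cp (- int J)"

text \<open>
  The first K-operator has spin 1/2, and its four intertwining relations turn the parameters at \<open>v\<close> into those
  at \<open>v\<^sup>-\<^sup>1\<close>.
\<close>

lemma left_op_opL:
  assumes "emb (cp 2) * (K $$ (0,0) * w) + emb ga1 * K $$ (0,1) \<approx> emb (cp 2) * (w * K $$ (0,0)) + emb al1' * K $$ (1,0)"
    and "emb (cp (- 2)) * (K $$ (0,1) * w) + emb al1 * K $$ (0,0) \<approx> emb (cp 2) * (w * K $$ (0,1)) + emb al1' * K $$ (1,1)"
    and "emb (cp 2) * (K $$ (1,0) * w) + emb ga1 * K $$ (1,1) \<approx> emb (cp (- 2)) * (w * K $$ (1,0)) + emb ga1' * K $$ (0,0)"
    and "emb (cp (- 2)) * (K $$ (1,1) * w) + emb al1 * K $$ (1,0) \<approx> emb (cp (- 2)) * (w * K $$ (1,1)) + emb ga1' * K $$ (0,1)"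
    and a: "a < 2"
  shows "left_op K (opL al1 ga1 a2 g2 \<psi>) a n \<approx> opL al1' ga1' a2 g2 (left_op K \<psi>) a n"
proof -
  note comm = emb_left_commute[of "K $$ (i, j)" for i j]
  have *: "c * (A * \<psi> 0 n + B * \<psi> 1 n) + R \<approx> c * (A' * \<psi> 0 n + B' * \<psi> 1 n) + R"
    if "A \<approx> A'" "B \<approx> B'" for A B A' B' c R
    by (intro cong_add cong_mult_left cong_mult_right that cong_refl)
  define rest where "rest = (\<lambda>a. emb (a2 * be J (Suc n)) * (K $$ (a,0) * \<psi> 0 (Suc n) + K $$ (a,1) * \<psi> 1 (Suc n))
      + emb (g2 * be J n) * (K $$ (a,0) * \<psi> 0 (n - 1) + K $$ (a,1) * \<psi> 1 (n - 1)))"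
  have l: "left_op K (opL al1 ga1 a2 g2 \<psi>) a n = emb (cp (2 * h n)) *
      ((emb (cp 2) * (K $$ (a,0) * w) + emb ga1 * K $$ (a,1)) * \<psi> 0 n
      + (emb (cp (- 2)) * (K $$ (a,1) * w) + emb al1 * K $$ (a,0)) * \<psi> 1 n) + rest a" for a
    unfolding left_op_def opL_def rest_def
    by (simp add: emb_simps comm ac_simps)
  consider "a = 0" | "a = 1" using a by linarith
  then show ?thesis
  proof cases
    case 1
    have "opL al1' ga1' a2 g2 (left_op K \<psi>) 0 n = emb (cp (2 * h n)) *
      ((emb (cp 2) * (w * K $$ (0,0)) + emb al1' * K $$ (1,0)) * \<psi> 0 n
      + (emb (cp 2) * (w * K $$ (0,1)) + emb al1' * K $$ (1,1)) * \<psi> 1 n) + rest 0"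
      unfolding left_op_def opL_def rest_def
      by (simp add: emb_simps comm ac_simps)
    then show ?thesis unfolding 1 l using *[OF assms(1,2)] by simp
  next
    case 2
    have "opL al1' ga1' a2 g2 (left_op K \<psi>) 1 n = emb (cp (2 * h n)) *
      ((emb (cp (- 2)) * (w * K $$ (1,0)) + emb ga1' * K $$ (0,0)) * \<psi> 0 n
      + (emb (cp (- 2)) * (w * K $$ (1,1)) + emb ga1' * K $$ (0,1)) * \<psi> 1 n) + rest 1"
      unfolding left_op_def opL_def rest_def
      by (simp add: emb_simps comm ac_simps)
    then show ?thesis unfolding 2 l using *[OF assms(3,4)] by simp
  qed
qed

end

context spin_spectral
begin

lemma cp_expand_right: "cp (a * numeral k) = cp a ^ numeral k" "cp (a * - numeral k) = inverse (cp a ^ numeral k)"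
  using cp_expand(4,5)[of k a] by (simp_all add: mult.commute)

abbreviation "EA n \<equiv> fls_const (Ea q J n)"
abbreviation "EB n \<equiv> fls_const (Eb q J n)"
abbreviation "bb L n \<equiv> fls_const (bq q L n)"

text \<open>
  The two ways of splitting a \<open>q\<close>-integer; they produce the two forms of the coefficient identities below.
\<close>

lemma qn_Suc: "qn (k + 1) = cp 2 * qn k + cp (- 2 * k)"
proof (rule cancel_cp_diff)
  have "(cp 2 - cp (- 2)) * (cp 2 * qn k + cp (- 2 * k)) = cp 2 * (cp (2 * k) - cp (- 2 * k)) + (cp 2 - cp (- 2)) * cp (- 2 * k)"
    unfolding qn_eq[symmetric] by (simp add: algebra_simps)
  also have "\<dots> = cp (2 * (k + 1)) - cp (- 2 * (k + 1))" by (simp add: algebra_simps cp_mult)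
  finally show "(cp 2 - cp (- 2)) * qn (k + 1) = (cp 2 - cp (- 2)) * (cp 2 * qn k + cp (- 2 * k))"
    unfolding qn_eq by simp
qed

lemma qn_Suc': "qn (k + 1) = cp (- 2) * qn k + cp (2 * k)"
proof (rule cancel_cp_diff)
  have "(cp 2 - cp (- 2)) * (cp (- 2) * qn k + cp (2 * k)) = cp (- 2) * (cp (2 * k) - cp (- 2 * k)) + (cp 2 - cp (- 2)) * cp (2 * k)"
    unfolding qn_eq[symmetric] by (simp add: algebra_simps)
  also have "\<dots> = cp (2 * (k + 1)) - cp (- 2 * (k + 1))" by (simp add: algebra_simps cp_mult)
  finally show "(cp 2 - cp (- 2)) * qn (k + 1) = (cp 2 - cp (- 2)) * (cp (- 2) * qn k + cp (2 * k))"
    unfolding qn_eq by simp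
qed

lemma EA_Suc: "n \<le> J \<Longrightarrow> EA (Suc n) * bb (Suc J) (Suc n) = EA n * bb J (Suc n)"
  using Ea_Suc[of n J] by simp

lemma EB_Suc: "n \<le> J \<Longrightarrow> EB (Suc n) * bb (Suc J) (Suc n) = qn (1 + int n) * EA n"
  using Eb_Suc[of n J] by (simp add: qn_def)

lemma bb_EB: "n \<le> Suc J \<Longrightarrow> bb J n * EB n = qn (int n) * EA n"
  using bq_Eb[of n J] by (simp add: qn_def)

lemma EB_shift: "n \<le> J \<Longrightarrow> EB (Suc n) * bb J n = bb (Suc J) (Suc n) * EB n"
  using Eb_shift[of n J] by simp

lemma bb_nz: "1 \<le> n \<Longrightarrow> n \<le> L \<Longrightarrow> bb L n \<noteq> 0"
  using bq_nz by simp

text \<open>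
  The right fusion map embeds spin \<open>(J + 1)/2\<close> into the tensor product compatibly with raising. Both orders of
  the tensor product need this, with \<open>s\<close> and \<open>t\<close> taken from the respective splitting of the \<open>q\<close>-integer.
\<close>

lemma Emat_raise_coefficient:
  assumes n: "n \<le> J"
    and rec: "cp s * qn (int J - int n) + cp t = qn (int J - int n + 1)"
  shows "cp (1 + s) * be J (Suc n) * EA (Suc n) + cp (int J - 2 * int n + t) * EB (Suc n) = EA n * be (Suc J) (Suc n)"
proof -
  have nz: "bb (Suc J) (Suc n) \<noteq> 0" using n by (intro bb_nz) auto
  have "(cp (1 + s) * be J (Suc n) * EA (Suc n) + cp (int J - 2 * int n + t) * EB (Suc n)) * bb (Suc J) (Suc n)
    = cp (1 + s) * be J (Suc n) * (EA (Suc n) * bb (Suc J) (Suc n)) + cp (int J - 2 * int n + t) * (EB (Suc n) * bb (Suc J) (Suc n))"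
    by (simp add: algebra_simps del: fls_const_mult_const)
  also have "\<dots> = EA n * (cp (1 + s) * cp (int J - 1 - 2 * int n) * (bb J (Suc n) * bb J (Suc n)) + cp (int J - 2 * int n + t) * qn (1 + int n))"
    unfolding EA_Suc[OF n] EB_Suc[OF n] be_def by (simp add: algebra_simps)
  also have "bb J (Suc n) * bb J (Suc n) = qn (1 + int n) * qn (int J - int n)"
    unfolding bq_square by simp
  also have "EA n * (cp (1 + s) * cp (int J - 1 - 2 * int n) * (qn (1 + int n) * qn (int J - int n)) + cp (int J - 2 * int n + t) * qn (1 + int n))
    = EA n * cp (int J - 2 * int n) * (qn (1 + int n) * (cp s * qn (int J - int n) + cp t))"
    by (simp add: cp_expand cp_expand_right field_simps power_numeral_reduce del: fls_const_mult_const)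
  also have "qn (1 + int n) * (cp s * qn (int J - int n) + cp t) = bb (Suc J) (Suc n) * bb (Suc J) (Suc n)"
    unfolding bq_square rec by (simp add: add.commute diff_add_eq)
  finally have "(cp (1 + s) * be J (Suc n) * EA (Suc n) + cp (int J - 2 * int n + t) * EB (Suc n)) * bb (Suc J) (Suc n) =
    EA n * be (Suc J) (Suc n) * bb (Suc J) (Suc n)"
    unfolding be_def by (simp add: algebra_simps)
  then show ?thesis using nz by simp
qed

lemma Emat_raise_right_upper: "n \<le> J \<Longrightarrow> cp 2 * cp 1 * be J (Suc n) * EA (Suc n) + cp (- int J) * EB (Suc n) = EA n * be (Suc J) (Suc n)"
  using Emat_raise_coefficient[OF _ qn_Suc[symmetric], of n] by (simp add: algebra_simps cp_mult cp_mult_left)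

lemma Emat_raise_left_upper: "n \<le> J \<Longrightarrow> cp (- 1) * be J (Suc n) * EA (Suc n) + cp (2 * h n) * cp (int J) * EB (Suc n) = EA n * be (Suc J) (Suc n)"
  using Emat_raise_coefficient[OF _ qn_Suc'[symmetric], of n] by (simp add: algebra_simps cp_mult cp_mult_left)

lemma Emat_lower_left_upper: "n \<le> J \<Longrightarrow> cp 1 * be J n * EA (n - 1) = EA n * be (Suc J) n"
proof (cases n)
  case (Suc m)
  assume n: "n \<le> J"
  have "cp 1 * be J n * EA (n - 1) = cp (int J - 2 * int m) * (EA m * bb J (Suc m))"
    unfolding be_def Suc by (simp add: cp_expand cp_expand_right field_simps power_numeral_reduce del: fls_const_mult_const)
  also have "\<dots> = EA n * be (Suc J) n"
    using n EA_Suc[of m] unfolding be_def Suc by (simp add: ac_simps del: fls_const_mult_const)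
  finally show ?thesis .
qed simp

lemma Emat_lower_right_upper: "n \<le> J \<Longrightarrow> cp 2 * cp (- 1) * be J n * EA (n - 1) = EA n * be (Suc J) n"
  using Emat_lower_left_upper by (simp add: cp_mult)

lemma Emat_raise_left_lower: "n \<le> J \<Longrightarrow> cp (- 1) * be J (Suc n) * EB (Suc (Suc n)) = EB (Suc n) * be (Suc J) (Suc (Suc n))"
proof (cases "n = J")
  case False
  assume "n \<le> J"
  then have "EB (Suc (Suc n)) * bb J (Suc n) = bb (Suc J) (Suc (Suc n)) * EB (Suc n)"
    using False by (intro EB_shift) auto
  moreover have "cp (- 1) * be J (Suc n) * EB (Suc (Suc n)) = cp (int J - 2 - 2 * int n) * (EB (Suc (Suc n)) * bb J (Suc n))"
    unfolding be_def by (simp add: cp_expand cp_expand_right field_simps power_numeral_reduce del: fls_const_mult_const)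
  ultimately show ?thesis
    unfolding be_def by (simp add: cp_expand cp_expand_right field_simps power_numeral_reduce del: fls_const_mult_const)
qed simp

lemma Emat_raise_right_lower: "n \<le> J \<Longrightarrow> cp (- 2) * cp 1 * be J (Suc n) * EB (Suc (Suc n)) = EB (Suc n) * be (Suc J) (Suc (Suc n))"
  using Emat_raise_left_lower by (simp add: cp_mult)

lemma Emat_lower_coefficient:
  assumes n: "n \<le> J" and rec: "cp s * qn (int n) + cp t = qn (int n + 1)"
  shows "cp (s - 1) * be J n * EB n + cp (int J - 2 * int n + t) * EA n = EB (Suc n) * be (Suc J) (Suc n)"
proof -
  have "cp (s - 1) * be J n * EB n + cp (int J - 2 * int n + t) * EA n
    = cp (s - 1) * cp (int J + 1 - 2 * int n) * (bb J n * EB n) + cp (int J - 2 * int n + t) * EA n"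
    unfolding be_def by (simp add: ac_simps)
  also have "\<dots> = cp (int J - 2 * int n) * ((cp s * qn (int n) + cp t) * EA n)"
    using n bb_EB[of n] by (simp add: cp_expand cp_expand_right field_simps power_numeral_reduce del: fls_const_mult_const)
  also have "\<dots> = EB (Suc n) * be (Suc J) (Suc n)"
    unfolding rec using EB_Suc[OF n] unfolding be_def by (simp add: ac_simps)
  finally show ?thesis .
qed

lemma Emat_lower_right_lower: "n \<le> J \<Longrightarrow> cp (- 2) * cp (- 1) * be J n * EB n + cp (int J) * EA n = EB (Suc n) * be (Suc J) (Suc n)"
  using Emat_lower_coefficient[OF _ qn_Suc'[symmetric], of n] by (simp add: algebra_simps cp_mult cp_mult_left)

lemma Emat_lower_left_lower: "n \<le> J \<Longrightarrow> cp 1 * be J n * EB n + cp (2 * h n) * cp (- int J) * EA n = EB (Suc n) * be (Suc J) (Suc n)"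
  using Emat_lower_coefficient[OF _ qn_Suc[symmetric], of n] by (simp add: algebra_simps cp_mult cp_mult_left)

end

context fusion
begin

abbreviation "al \<equiv> kp * v"
abbreviation "ga \<equiv> km * iv"
abbreviation "al' \<equiv> kp * iv"
abbreviation "ga' \<equiv> km * v"

text \<open>
  The image of \<open>E\<close> is a subcomodule: the coaction on the tensor product restricts to the one on spin
  \<open>(J + 1)/2\<close>. This holds for both orders of the factors.
\<close>

lemma opR_Eop:
  assumes n: "n \<le> J" and a: "a < 2"
  shows "opR al1 ga1 (al * cp 1) (ga * cp (- 1)) (Eop emb q J \<phi>) a n = Eop emb q J (opM (Suc J) al ga \<phi>) a n"
proof -
  consider "a = 0" | "a = 1" using a by linarith
  then show ?thesis
  proof cases
    case 1
    have "opR al1 ga1 (al * cp 1) (ga * cp (- 1)) (Eop emb q J \<phi>) 0 n =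
      emb (cp 2 * cp (2 * h n) * EA n) * (w * \<phi> n)
      + emb (al * (cp 2 * cp 1 * be J (Suc n) * EA (Suc n) + cp (- int J) * EB (Suc n))) * \<phi> (Suc n)
      + emb (ga * (cp 2 * cp (- 1) * be J n * EA (n - 1))) * \<phi> (n - 1)"
      by (simp add: opR_def opM_def Eop_def emb_simps ac_simps del: fls_const_mult_const)
    also note Emat_raise_right_upper[OF n]
    also note Emat_lower_right_upper[OF n]
    also have "cp 2 * cp (2 * h n) = cp (2 * (int (Suc J) - 2 * int n))"
      by (simp add: cp_mult algebra_simps)
    finally have "opR al1 ga1 (al * cp 1) (ga * cp (- 1)) (Eop emb q J \<phi>) 0 n =
      emb (cp (2 * (int (Suc J) - 2 * int n)) * EA n) * (w * \<phi> n) + emb (al * (EA n * be (Suc J) (Suc n))) * \<phi> (Suc n) + emb (ga * (EA n * be (Suc J) n)) * \<phi> (n - 1)" .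
    moreover have "Eop emb q J (opM (Suc J) al ga \<phi>) 0 n =
      emb (cp (2 * (int (Suc J) - 2 * int n)) * EA n) * (w * \<phi> n)
      + emb (al * (EA n * be (Suc J) (Suc n))) * \<phi> (Suc n) + emb (ga * (EA n * be (Suc J) n)) * \<phi> (n - 1)"
      by (simp add: opM_def Eop_def emb_simps ac_simps del: fls_const_mult_const)
    ultimately show ?thesis unfolding 1 by simp
  next
    case 2
    have "opR al1 ga1 (al * cp 1) (ga * cp (- 1)) (Eop emb q J \<phi>) 1 n =
      emb (cp (- 2) * cp (2 * h n) * EB (Suc n)) * (w * \<phi> (Suc n))
      + emb (al * (cp (- 2) * cp 1 * be J (Suc n) * EB (Suc (Suc n)))) * \<phi> (Suc (Suc n))
      + emb (ga * (cp (- 2) * cp (- 1) * be J n * EB n + cp (int J) * EA n)) * \<phi> n"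
      by (cases n) (simp_all add: opR_def opM_def Eop_def emb_simps ac_simps del: fls_const_mult_const)
    also note Emat_raise_right_lower[OF n]
    also note Emat_lower_right_lower[OF n]
    also have "cp (- 2) * cp (2 * h n) = cp (2 * (int (Suc J) - 2 * int (Suc n)))"
      by (simp add: cp_mult algebra_simps)
    finally have "opR al1 ga1 (al * cp 1) (ga * cp (- 1)) (Eop emb q J \<phi>) 1 n =
      emb (cp (2 * (int (Suc J) - 2 * int (Suc n))) * EB (Suc n)) * (w * \<phi> (Suc n)) + emb (al * (EB (Suc n) * be (Suc J) (Suc (Suc n)))) * \<phi> (Suc (Suc n)) + emb (ga * (EB (Suc n) * be (Suc J) (Suc n))) * \<phi> n" .
    moreover have "Eop emb q J (opM (Suc J) al ga \<phi>) 1 n =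
      emb (cp (2 * (int (Suc J) - 2 * int (Suc n))) * EB (Suc n)) * (w * \<phi> (Suc n))
      + emb (al * (EB (Suc n) * be (Suc J) (Suc (Suc n)))) * \<phi> (Suc (Suc n)) + emb (ga * (EB (Suc n) * be (Suc J) (Suc n))) * \<phi> n"
      by (simp add: opM_def Eop_def emb_simps ac_simps del: fls_const_mult_const)
    ultimately show ?thesis unfolding 2 by simp
  qed
qed

lemma opL_Eop:
  assumes n: "n \<le> J" and a: "a < 2"
  shows "opL al1' ga1' al2 ga2 (Eop emb q J \<phi>) a n = Eop emb q J (opM (Suc J) al' ga' \<phi>) a n"
proof -
  consider "a = 0" | "a = 1" using a by linarith
  then show ?thesis
  proof cases
    case 1
    have "opL al1' ga1' al2 ga2 (Eop emb q J \<phi>) 0 n =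
      emb (cp 2 * cp (2 * h n) * EA n) * (w * \<phi> n)
      + emb (al' * (cp (- 1) * be J (Suc n) * EA (Suc n) + cp (2 * h n) * cp (int J) * EB (Suc n))) * \<phi> (Suc n)
      + emb (ga' * (cp 1 * be J n * EA (n - 1))) * \<phi> (n - 1)"
      by (simp add: opL_def Eop_def emb_simps ac_simps del: fls_const_mult_const)
    also note Emat_raise_left_upper[OF n]
    also note Emat_lower_left_upper[OF n]
    also have "cp 2 * cp (2 * h n) = cp (2 * (int (Suc J) - 2 * int n))"
      by (simp add: cp_mult algebra_simps)
    finally have "opL al1' ga1' al2 ga2 (Eop emb q J \<phi>) 0 n =
      emb (cp (2 * (int (Suc J) - 2 * int n)) * EA n) * (w * \<phi> n) + emb (al' * (EA n * be (Suc J) (Suc n))) * \<phi> (Suc n) + emb (ga' * (EA n * be (Suc J) n)) * \<phi> (n - 1)" .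
    moreover have "Eop emb q J (opM (Suc J) al' ga' \<phi>) 0 n =
      emb (cp (2 * (int (Suc J) - 2 * int n)) * EA n) * (w * \<phi> n)
      + emb (al' * (EA n * be (Suc J) (Suc n))) * \<phi> (Suc n) + emb (ga' * (EA n * be (Suc J) n)) * \<phi> (n - 1)"
      by (simp add: opM_def Eop_def emb_simps ac_simps del: fls_const_mult_const)
    ultimately show ?thesis unfolding 1 by simp
  next
    case 2
    have "opL al1' ga1' al2 ga2 (Eop emb q J \<phi>) 1 n =
      emb (cp (- 2) * cp (2 * h n) * EB (Suc n)) * (w * \<phi> (Suc n))
      + emb (al' * (cp (- 1) * be J (Suc n) * EB (Suc (Suc n)))) * \<phi> (Suc (Suc n))
      + emb (ga' * (cp 1 * be J n * EB n + cp (2 * h n) * cp (- int J) * EA n)) * \<phi> n"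
      by (cases n) (simp_all add: opL_def Eop_def emb_simps ac_simps del: fls_const_mult_const)
    also note Emat_raise_left_lower[OF n]
    also note Emat_lower_left_lower[OF n]
    also have "cp (- 2) * cp (2 * h n) = cp (2 * (int (Suc J) - 2 * int (Suc n)))"
      by (simp add: cp_mult algebra_simps)
    finally have "opL al1' ga1' al2 ga2 (Eop emb q J \<phi>) 1 n =
      emb (cp (2 * (int (Suc J) - 2 * int (Suc n))) * EB (Suc n)) * (w * \<phi> (Suc n)) + emb (al' * (EB (Suc n) * be (Suc J) (Suc (Suc n)))) * \<phi> (Suc (Suc n)) + emb (ga' * (EB (Suc n) * be (Suc J) (Suc n))) * \<phi> n" .
    moreover have "Eop emb q J (opM (Suc J) al' ga' \<phi>) 1 n =
      emb (cp (2 * (int (Suc J) - 2 * int (Suc n))) * EB (Suc n)) * (w * \<phi> (Suc n))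
      + emb (al' * (EB (Suc n) * be (Suc J) (Suc (Suc n)))) * \<phi> (Suc (Suc n)) + emb (ga' * (EB (Suc n) * be (Suc J) (Suc n))) * \<phi> n"
      by (simp add: opM_def Eop_def emb_simps ac_simps del: fls_const_mult_const)
    ultimately show ?thesis unfolding 2 by simp
  qed
qed

text \<open>
  Linear forms that cut out the image of \<open>E\<close>: on that image \<open>qn k\<close> times the component \<open>(0, k)\<close> equals \<open>bb J k\<close>
  times the component \<open>(1, k - 1)\<close>. The defect of a vector is its value under these forms.
\<close>

definition defect_form :: "(nat \<Rightarrow> nat \<Rightarrow> 'a) \<Rightarrow> nat \<Rightarrow> 'a" where
  "defect_form \<psi> k = emb (qn (int k)) * \<psi> 0 k - emb (bb J k) * \<psi> 1 (k - 1)"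

lemma qn_nz: "qn (int (Suc k)) \<noteq> 0"
  using qnum_nz[of "Suc k"] by (simp add: qn_def)

lemma qn_0 [simp]: "qn 0 = 0"
  by (simp add: qn_def)

text \<open>
  The coaction preserves the image of \<open>E\<close>, so it carries the forms \<open>defect_form\<close> to combinations of themselves. It acts on
  them as on a module of spin \<open>(J - 1)/2\<close>, with these raising and lowering coefficients.
\<close>

definition xi where "xi k = al2 * be J (Suc k) * qn (int k) / qn (int (Suc k))"
definition xi' where "xi' k = ga2 * (bb J k * cp (int J + 3 - 2 * int k))"

lemma defect_raise_upper: "qn (int k) * (al2 * be J (Suc k)) = xi k * qn (int (Suc k))"
  using qn_nz[of k] by (simp add: xi_def)

lemma defect_raise_lower:
  shows "bb J k * (al2 * be J k) - qn (int k) * (cp (2 * h k) * al1') = xi k * bb J (Suc k)"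
proof -
  have rec: "qn (int J + 1 - int k) = cp (- 2) * qn (int J - int k) + cp (2 * (int J - int k))"
    using qn_Suc'[of "int J - int k"] by (simp add: algebra_simps)
  have "bb J k * (al2 * be J k) - qn (int k) * (cp (2 * h k) * al1')
    = kp * iv * (cp (int J - 2 * int k) * (bb J k * bb J k) - qn (int k) * cp (3 * int J - 4 * int k))"
    unfolding be_def by (simp add: cp_expand cp_expand_right field_simps power_numeral_reduce del: fls_const_mult_const)
  also have "\<dots> = kp * iv * (qn (int k) * (cp (int J - 2 * int k - 2) * qn (int J - int k)))"
    unfolding bq_square rec by (simp add: cp_expand cp_expand_right field_simps power_numeral_reduce del: fls_const_mult_const)
  also have "\<dots> * qn (int (Suc k)) = al2 * qn (int k) * cp (int J - 1 - 2 * int k) * (bb J (Suc k) * bb J (Suc k))"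
    unfolding bq_square by (simp add: cp_expand cp_expand_right field_simps power_numeral_reduce del: fls_const_mult_const)
  also have "\<dots> = (al2 * be J (Suc k) * qn (int k)) * bb J (Suc k)"
    unfolding be_def by (simp add: algebra_simps)
  also have "\<dots> = xi k * bb J (Suc k) * qn (int (Suc k))"
    unfolding mult.assoc[of _ _ "qn (int (Suc k))"] using defect_raise_upper[of k] by (simp add: algebra_simps)
  finally show ?thesis using qn_nz[of k] by simp
qed

lemma defect_lower_upper: "qn (int (Suc m)) * (ga2 * be J (Suc m)) - bb J (Suc m) * (cp (2 * h m) * ga1') = xi' (Suc m) * qn (int m)"
proof -
  have rec: "qn (int (Suc m)) = cp 2 * qn (int m) + cp (- 2 * int m)"
    using qn_Suc[of "int m"] by (simp add: add.commute)
  show ?thesis unfolding rec xi'_def be_def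
    by (simp add: cp_expand cp_expand_right iv_eq field_simps power_numeral_reduce del: fls_const_mult_const)
qed

lemma defect_lower_lower: "bb J (Suc m) * (ga2 * be J m) = xi' (Suc m) * bb J m"
  unfolding xi'_def be_def by (simp add: cp_expand cp_expand_right field_simps power_numeral_reduce del: fls_const_mult_const)

lemma defect_form_opL:
  assumes "1 \<le> k"
  shows "defect_form (opL al1' ga1' al2 ga2 \<psi>) k = emb (cp 2 * cp (2 * h k)) * (w * defect_form \<psi> k)
    + emb (xi k) * defect_form \<psi> (Suc k) + emb (xi' k) * defect_form \<psi> (k - 1)"
proof -
  obtain m where k: "k = Suc m" using assms by (cases k) auto
  have cc: "cp (- 2) * cp (2 * h m) = cp 2 * cp (2 * h (Suc m))"
    by (simp add: cp_mult algebra_simps)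
  have "defect_form (opL al1' ga1' al2 ga2 \<psi>) (Suc m) =
      emb (cp 2 * cp (2 * h (Suc m)) * qn (int (Suc m))) * (w * \<psi> 0 (Suc m))
    - emb (cp (- 2) * cp (2 * h m) * bb J (Suc m)) * (w * \<psi> 1 m)
    + emb (qn (int (Suc m)) * (al2 * be J (Suc (Suc m)))) * \<psi> 0 (Suc (Suc m))
    - emb (bb J (Suc m) * (al2 * be J (Suc m)) - qn (int (Suc m)) * (cp (2 * h (Suc m)) * al1')) * \<psi> 1 (Suc m)
    + emb (qn (int (Suc m)) * (ga2 * be J (Suc m)) - bb J (Suc m) * (cp (2 * h m) * ga1')) * \<psi> 0 m
    - emb (bb J (Suc m) * (ga2 * be J m)) * \<psi> 1 (m - 1)"
    by (simp add: defect_form_def opL_def emb_simps emb_diff left_diff_distrib ac_simps del: of_nat_Suc)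
  also note defect_raise_upper also note defect_raise_lower also note defect_lower_upper also note defect_lower_lower also note cc
  finally show ?thesis unfolding k
    by (simp add: defect_form_def emb_simps emb_diff left_diff_distrib ac_simps right_diff_distrib del: of_nat_Suc)
qed

end

context fusion
begin

lemma right_op_cong:
  "(\<And>m. m \<le> J \<Longrightarrow> \<psi> a m = \<psi>' a m) \<Longrightarrow> right_op J Y \<psi> a n = right_op J Y \<psi>' a n"
  by (simp add: right_op_def)

lemma Rop_cong:
  assumes "\<And>b m. b < 2 \<Longrightarrow> m \<le> J \<Longrightarrow> \<psi> b m \<approx> \<psi>' b m" "a < 2" "n \<le> J"
  shows "Rop emb q r J x \<psi> a n \<approx> Rop emb q r J x \<psi>' a n"
proof -
  have "emb (Roff q J (Suc n)) * \<psi> 0 (Suc n) \<approx> emb (Roff q J (Suc n)) * \<psi>' 0 (Suc n)"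
    using assms by (cases "n = J") (auto intro!: cong_mult_left)
  then show ?thesis using assms(2,3) unfolding Rop_def
    by (auto intro!: cong_mult_left cong_add assms(1))
qed

lemma left_op_cong:
  assumes "\<And>b. b < 2 \<Longrightarrow> \<psi> b n \<approx> \<psi>' b n"
  shows "left_op K \<psi> a n \<approx> left_op K \<psi>' a n"
  unfolding left_op_def by (intro cong_add cong_mult_left assms) auto

lemma opL_cong:
  assumes "\<And>b m. b < 2 \<Longrightarrow> m \<le> J \<Longrightarrow> \<psi> b m \<approx> \<psi>' b m" "a < 2" "n \<le> J"
  shows "opL a1 g1 a2 g2 \<psi> a n \<approx> opL a1 g1 a2 g2 \<psi>' a n"
proof -
  have *: "emb (a2 * be J (Suc n)) * \<psi> b (Suc n) \<approx> emb (a2 * be J (Suc n)) * \<psi>' b (Suc n)" if "b < 2" for b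
    using assms that by (cases "n = J") (auto intro!: cong_mult_left)
  have 0: "\<psi> b m \<approx> \<psi>' b m" if "b = 0 \<or> b = 1" "m = n \<or> m = n - 1" for b m
    using that assms(3) by (intro assms(1)) auto
  have t: "emb c * (w * \<psi> b n) \<approx> emb c * (w * \<psi>' b n)" "emb c * \<psi> b (n - 1) \<approx> emb c * \<psi>' b (n - 1)"
    "emb c * \<psi> b n \<approx> emb c * \<psi>' b n" if "b = 0 \<or> b = 1" for b c
    by (intro cong_mult_left 0 that; simp)+
  show ?thesis unfolding opL_def by (auto simp del: One_nat_def intro!: cong_add t *)
qed

lemma defect_form_cong:
  assumes "\<And>b m. b < 2 \<Longrightarrow> m \<le> J \<Longrightarrow> \<psi> b m \<approx> \<psi>' b m" "k \<le> J"
  shows "defect_form \<psi> k \<approx> defect_form \<psi>' k"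
  unfolding defect_form_def using assms(2) by (intro cong_diff cong_mult_left assms(1)) auto

lemma Fop_cong:
  assumes "\<And>b m. b < 2 \<Longrightarrow> m \<le> J \<Longrightarrow> \<psi> b m \<approx> \<psi>' b m" "i \<le> Suc J"
  shows "Fop emb q J \<psi> i \<approx> Fop emb q J \<psi>' i"
proof -
  have "emb (fls_const (Fa q J i)) * \<psi> 0 i \<approx> emb (fls_const (Fa q J i)) * \<psi>' 0 i"
    using assms by (cases "i = Suc J") (auto intro!: cong_mult_left simp: Fa_def)
  moreover have "emb (fls_const (Fb q J i)) * \<psi> 1 (i - 1) \<approx> emb (fls_const (Fb q J i)) * \<psi>' 1 (i - 1)"
    using assms by (intro cong_mult_left) auto
  ultimately show ?thesis unfolding Fop_def by (rule cong_add)
qed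

lemma Fb_0: "Fb q J 0 = 0"
  by (simp add: Fb_def)

lemma Fop_Eop: "i \<le> Suc J \<Longrightarrow> Fop emb q J (Eop emb q J \<phi>) i = \<phi> i"
proof -
  assume i: "i \<le> Suc J"
  have "Fop emb q J (Eop emb q J \<phi>) i = emb (fls_const (Fa q J i * Ea q J i + Fb q J i * Eb q J i)) * \<phi> i"
    by (cases i) (simp_all add: Fop_def Eop_def emb_assoc distrib_right Fb_0 emb_add flip: fls_plus_const)
  then show ?thesis using Fa_Fb[OF i] by simp
qed

text \<open>
  The coaction passes the right fusion map, the second K-operator (the induction hypothesis), the R-matrix and the
  first K-operator in turn.
\<close>

lemma fusion_step_intertwines:
  assumes x: "x \<noteq> 0" "param_of x = v * (v * cp (1 - int J))"
    and Y: "\<And>\<phi> n. n \<le> J \<Longrightarrow> (\<Sum>m\<le>J. Y $$ (n, m) * opM J (al * cp 1) (ga * cp (- 1)) \<phi> m)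
        \<approx> opM J al2 ga2 (\<lambda>n. \<Sum>m\<le>J. Y $$ (n, m) * \<phi> m) n"
    and K: "emb (cp 2) * (K $$ (0,0) * w) + emb ga1 * K $$ (0,1) \<approx> emb (cp 2) * (w * K $$ (0,0)) + emb al1' * K $$ (1,0)"
      "emb (cp (- 2)) * (K $$ (0,1) * w) + emb al1 * K $$ (0,0) \<approx> emb (cp 2) * (w * K $$ (0,1)) + emb al1' * K $$ (1,1)"
      "emb (cp 2) * (K $$ (1,0) * w) + emb ga1 * K $$ (1,1) \<approx> emb (cp (- 2)) * (w * K $$ (1,0)) + emb ga1' * K $$ (0,0)"
      "emb (cp (- 2)) * (K $$ (1,1) * w) + emb al1 * K $$ (1,0) \<approx> emb (cp (- 2)) * (w * K $$ (1,1)) + emb ga1' * K $$ (0,1)"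
    and a: "a < 2" "n \<le> J"
  shows "fusion_step emb q r J K Y x (opM (Suc J) al ga \<phi>) a n
     \<approx> opL al1' ga1' al2 ga2 (fusion_step emb q r J K Y x \<phi>) a n"
proof -
  let ?E = "Eop emb q J \<phi>"
  have 1: "right_op J Y (Eop emb q J (opM (Suc J) al ga \<phi>)) b m \<approx> opR al1 ga1 al2 ga2 (right_op J Y ?E) b m"
    if "b < 2" "m \<le> J" for b m
  proof -
    have "right_op J Y (Eop emb q J (opM (Suc J) al ga \<phi>)) b m =
      right_op J Y (opR al1 ga1 (al * cp 1) (ga * cp (- 1)) ?E) b m"
      using that by (intro right_op_cong opR_Eop[symmetric]) auto
    also have "\<dots> \<approx> opR al1 ga1 al2 ga2 (right_op J Y ?E) b m"
      by (rule right_op_opR[OF Y[OF that(2)]])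
    finally show ?thesis .
  qed
  have 2: "Rop emb q r J x (right_op J Y (Eop emb q J (opM (Suc J) al ga \<phi>))) b m \<approx>
     opL al1 ga1 al2 ga2 (Rop emb q r J x (right_op J Y ?E)) b m" if "b < 2" "m \<le> J" for b m
    unfolding Rop_opR[OF x that(1), symmetric] by (rule Rop_cong) (use 1 that in auto)
  have "left_op K (Rop emb q r J x (right_op J Y (Eop emb q J (opM (Suc J) al ga \<phi>)))) a n \<approx>
     left_op K (opL al1 ga1 al2 ga2 (Rop emb q r J x (right_op J Y ?E))) a n"
    using a by (intro left_op_cong 2)
  also have "\<dots> \<approx> opL al1' ga1' al2 ga2 (left_op K (Rop emb q r J x (right_op J Y ?E))) a n"
    by (rule left_op_opL[OF K a(1)])
  finally show ?thesis unfolding fusion_step_def .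
qed

definition unitv :: "nat \<Rightarrow> nat \<Rightarrow> 'a" where "unitv l n = (if n = l then 1 else 0)"

lemma fusion_step_linear:
  assumes "a < 2" "n \<le> J"
  shows "fusion_step emb q r J K Y x \<phi> a n = (\<Sum>l\<le>Suc J. fusion_step emb q r J K Y x (unitv l) a n * \<phi> l)"
proof -
  have E: "Eop emb q J \<phi> b m = (\<Sum>l\<le>Suc J. Eop emb q J (unitv l) b m * \<phi> l)" if "m \<le> J" for b m
    using that by (simp add: Eop_def unitv_def if_distrib[of "\<lambda>x. x * _"] if_distrib[of "\<lambda>x. _ * x"] cong: if_cong)
  have R: "right_op J Y (Eop emb q J \<phi>) b m = (\<Sum>l\<le>Suc J. right_op J Y (Eop emb q J (unitv l)) b m * \<phi> l)" for b m
  proof -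
    have "right_op J Y (Eop emb q J \<phi>) b m = (\<Sum>j\<le>J. \<Sum>l\<le>Suc J. Y $$ (m, j) * Eop emb q J (unitv l) b j * \<phi> l)"
      unfolding right_op_def by (rule sum.cong) (simp_all only: atMost_iff E sum_distrib_left mult.assoc)
    also have "\<dots> = (\<Sum>l\<le>Suc J. right_op J Y (Eop emb q J (unitv l)) b m * \<phi> l)"
      unfolding right_op_def sum_distrib_right by (rule sum.swap)
    finally show ?thesis .
  qed
  have *: "Rop emb q r J x (right_op J Y (Eop emb q J \<phi>)) b m = (\<Sum>l\<le>Suc J. Rop emb q r J x (right_op J Y (Eop emb q J (unitv l))) b m * \<phi> l)" for b m
    unfolding Rop_def R by (cases "b = 0")
      (simp_all add: sum_distrib_left sum.distrib distrib_right distrib_left mult.assoc del: sum.atMost_Suc)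
  show ?thesis unfolding fusion_step_def left_op_def *
    by (simp add: sum_distrib_left sum.distrib distrib_right mult.assoc del: sum.atMost_Suc)
qed

lemma defect_form_linear:
  assumes "\<And>b m. b < 2 \<Longrightarrow> m \<le> J \<Longrightarrow> \<psi> b m = (\<Sum>l\<in>A. \<Psi> l b m * c l)" "k \<le> J"
  shows "defect_form \<psi> k = (\<Sum>l\<in>A. defect_form (\<Psi> l) k * c l)"
  unfolding defect_form_def using assms
  by (simp add: sum_distrib_left sum_subtractf left_diff_distrib mult.assoc)

lemma defect_form_0 [simp]: "defect_form \<psi> 0 = 0"
  by (simp add: defect_form_def)

lemma sum_opM_unitv:
  assumes "l \<le> L"
  shows "(\<Sum>m\<le>L. f m * opM L b c (unitv l) m) = emb (cp (2 * (int L - 2 * int l))) * (f l * w)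
     + (if l = 0 then 0 else emb (b * be L l) * f (l - 1)) + emb (c * be L (Suc l)) * f (Suc l)"
proof -
  have A: "(\<Sum>m\<le>L. f m * (emb (cp (2 * (int L - 2 * int m))) * (w * unitv l m))) = emb (cp (2 * (int L - 2 * int l))) * (f l * w)"
    using assms by (simp add: unitv_def emb_left_commute if_distrib[of "\<lambda>x. _ * x"] cong: if_cong)
  have B: "(\<Sum>m\<le>L. f m * (emb (b * be L (Suc m)) * unitv l (Suc m))) = (if l = 0 then 0 else emb (b * be L l) * f (l - 1))"
  proof (cases l)
    case 0
    then show ?thesis by (simp add: unitv_def)
  next
    case (Suc l')
    then have "(\<Sum>m\<le>L. f m * (emb (b * be L (Suc m)) * unitv l (Suc m))) = (\<Sum>m\<le>L. if m = l' then f m * emb (b * be L (Suc m)) else 0)"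
      by (intro sum.cong) (auto simp: unitv_def)
    then show ?thesis using assms Suc by (simp add: emb_commute)
  qed
  have C: "(\<Sum>m\<le>L. f m * (emb (c * be L m) * unitv l (m - 1))) = emb (c * be L (Suc l)) * f (Suc l)"
  proof -
    have "(\<Sum>m\<le>L. f m * (emb (c * be L m) * unitv l (m - 1))) = (\<Sum>m\<le>L. if m = Suc l then f m * emb (c * be L m) else 0)"
    proof (rule sum.cong)
      fix m show "f m * (emb (c * be L m) * unitv l (m - 1)) = (if m = Suc l then f m * emb (c * be L m) else 0)"
        by (cases m) (auto simp: unitv_def)
    qed simp
    also have "\<dots> = f (Suc l) * emb (c * be L (Suc l))" using assms by (cases "l = L") simp_all
    finally show ?thesis by (simp add: emb_commute)
  qed
  show ?thesis
    unfolding opM_def distrib_left sum.distrib A B C ..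
qed

text \<open>
  As the product in a fusion step intertwines and the forms \<open>defect_form\<close> are carried to one another, so does the matrix \<open>z\<close> of
  defects: it relates the coaction on spin \<open>(J + 1)/2\<close> to one on spin \<open>(J - 1)/2\<close>.
\<close>

lemma defect_relation:
  assumes X: "\<And>\<phi> a n. a < 2 \<Longrightarrow> n \<le> J \<Longrightarrow> fusion_step emb q r J K Y x (opM (Suc J) al ga \<phi>) a n
     \<approx> opL al1' ga1' al2 ga2 (fusion_step emb q r J K Y x \<phi>) a n"
    and k: "1 \<le> k" "k \<le> J" and l: "l \<le> Suc J"
    and z_def: "z = (\<lambda>k l. defect_form (fusion_step emb q r J K Y x (unitv l)) k)"
  shows "emb (cp (2 * (int (Suc J) - 2 * int l))) * (z k l * w)
     + (if l = 0 then 0 else emb (al * be (Suc J) l) * z k (l - 1)) + emb (ga * be (Suc J) (Suc l)) * z k (Suc l)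
     \<approx> emb (cp 2 * cp (2 * h k)) * (w * z k l) + emb (xi k) * z (Suc k) l + emb (xi' k) * z (k - 1) l"
proof -
  have "emb (cp (2 * (int (Suc J) - 2 * int l))) * (z k l * w)
     + (if l = 0 then 0 else emb (al * be (Suc J) l) * z k (l - 1)) + emb (ga * be (Suc J) (Suc l)) * z k (Suc l)
     = (\<Sum>m\<le>Suc J. z k m * opM (Suc J) al ga (unitv l) m)"
    by (rule sum_opM_unitv[OF l, symmetric])
  also have "\<dots> = defect_form (fusion_step emb q r J K Y x (opM (Suc J) al ga (unitv l))) k"
    unfolding z_def
    by (rule defect_form_linear[where \<Psi> = "\<lambda>l. fusion_step emb q r J K Y x (unitv l)", OF fusion_step_linear k(2), symmetric])
  also have "\<dots> \<approx> defect_form (opL al1' ga1' al2 ga2 (fusion_step emb q r J K Y x (unitv l))) k"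
    by (rule defect_form_cong[OF X k(2)])
  also have "\<dots> = emb (cp 2 * cp (2 * h k)) * (w * z k l) + emb (xi k) * z (Suc k) l + emb (xi' k) * z (k - 1) l"
    unfolding z_def by (rule defect_form_opL[OF k(1)])
  finally show ?thesis .
qed

text \<open>
  Where the defect vanishes, the vector is reproduced by \<open>E F\<close>, and then \<open>opL_Eop\<close> lets the coaction pass the left
  fusion map.
\<close>

lemma fused_intertwines:
  assumes X: "\<And>\<phi> a n. a < 2 \<Longrightarrow> n \<le> J \<Longrightarrow> fusion_step emb q r J K Y x (opM (Suc J) al ga \<phi>) a n
     \<approx> opL al1' ga1' al2 ga2 (fusion_step emb q r J K Y x \<phi>) a n"
    and z: "\<And>k l. 1 \<le> k \<Longrightarrow> k \<le> J \<Longrightarrow> l \<le> Suc J \<Longrightarrow> defect_form (fusion_step emb q r J K Y x (unitv l)) k \<in> I"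
    and i: "i \<le> Suc J"
  shows "Fop emb q J (fusion_step emb q r J K Y x (opM (Suc J) al ga \<phi>)) i
     \<approx> opM (Suc J) al' ga' (Fop emb q J (fusion_step emb q r J K Y x \<phi>)) i"
proof -
  let ?X = "fusion_step emb q r J K Y x \<phi>"
  let ?F = "Fop emb q J ?X"
  have N: "emb (qn (int k)) * ?X 0 k \<approx> emb (bb J k) * ?X 1 (k - 1)" if k: "1 \<le> k" "k \<le> J" for k
  proof -
    have "defect_form ?X k = (\<Sum>l\<le>Suc J. defect_form (fusion_step emb q r J K Y x (unitv l)) k * \<phi> l)"
      by (rule defect_form_linear[where \<Psi> = "\<lambda>l. fusion_step emb q r J K Y x (unitv l)", OF fusion_step_linear k(2)])
    also have "\<dots> \<in> I" using z k by (intro sum_closed mult_right_closed) auto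
    finally show ?thesis by (simp add: defect_form_def cong_mod_def)
  qed
  have N': "emb (EA k) * ?X 1 (k - 1) \<approx> emb (EB k) * ?X 0 k" if k: "1 \<le> k" "k \<le> J" for k
  proof -
    have nz: "bb J k \<noteq> 0" using k by (intro bb_nz)
    have "emb (EA k) * ?X 1 (k - 1) = emb (EA k / bb J k) * (emb (bb J k) * ?X 1 (k - 1))"
      using nz by (simp add: emb_assoc del: fls_const_mult_const)
    also have "\<dots> \<approx> emb (EA k / bb J k) * (emb (qn (int k)) * ?X 0 k)"
      by (intro cong_mult_left cong_sym[OF N] k)
    also have "\<dots> = emb (EB k) * ?X 0 k"
    proof -
      have "EA k / bb J k * qn (int k) = EB k"
        using bb_EB[of k] nz k by (simp add: field_simps del: fls_const_mult_const)
      then show ?thesis unfolding emb_assoc by (rule arg_cong)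
    qed
    finally show ?thesis .
  qed
  have FE: "fls_const (Fa q J k) * EA k + fls_const (Fb q J k) * EB k = 1" if "k \<le> Suc J" for k
    using Fa_Fb[OF that] by (simp add: fls_plus_const)
  have image: "?X b m \<approx> Eop emb q J ?F b m" if b: "b < 2" and m: "m \<le> J" for b m
  proof (cases "b = 0")
    case True
    have "emb (EA m) * (emb (fls_const (Fb q J m)) * ?X 1 (m - 1)) \<approx> emb (fls_const (Fb q J m)) * (emb (EB m) * ?X 0 m)"
    proof (cases "m = 0")
      case False
      have "emb (EA m) * (emb (fls_const (Fb q J m)) * ?X 1 (m - 1)) = emb (fls_const (Fb q J m)) * (emb (EA m) * ?X 1 (m - 1))"
        by (rule emb_left_commute)
      then show ?thesis using N'[of m] False m by (simp add: cong_mult_left)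
    qed (simp add: Fb_def)
    then have "Eop emb q J ?F 0 m \<approx> emb (EA m) * (emb (fls_const (Fa q J m)) * ?X 0 m) + emb (fls_const (Fb q J m)) * (emb (EB m) * ?X 0 m)"
      unfolding Eop_def Fop_def by (simp add: distrib_left cong_add)
    also have "\<dots> = emb (fls_const (Fa q J m) * EA m + fls_const (Fb q J m) * EB m) * ?X 0 m"
      by (simp add: emb_assoc emb_add distrib_right mult.commute del: fls_const_mult_const)
    also have "\<dots> = ?X 0 m" using FE[of m] m by simp
    finally show ?thesis using True by (simp add: cong_sym)
  next
    case False
    then have b: "b = 1" using b by simp
    have "emb (EB (Suc m)) * (emb (fls_const (Fa q J (Suc m))) * ?X 0 (Suc m)) \<approx> emb (fls_const (Fa q J (Suc m))) * (emb (EA (Suc m)) * ?X 1 m)"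
    proof (cases "m = J")
      case False
      have "emb (EB (Suc m)) * (emb (fls_const (Fa q J (Suc m))) * ?X 0 (Suc m)) = emb (fls_const (Fa q J (Suc m))) * (emb (EB (Suc m)) * ?X 0 (Suc m))"
        by (rule emb_left_commute)
      then show ?thesis using N'[of "Suc m"] False m by (simp add: cong_mult_left cong_sym)
    qed (simp add: Fa_def)
    then have "Eop emb q J ?F 1 m \<approx> emb (fls_const (Fa q J (Suc m))) * (emb (EA (Suc m)) * ?X 1 m) + emb (EB (Suc m)) * (emb (fls_const (Fb q J (Suc m))) * ?X 1 m)"
      unfolding Eop_def Fop_def by (simp add: distrib_left cong_add)
    also have "\<dots> = emb (fls_const (Fa q J (Suc m)) * EA (Suc m) + fls_const (Fb q J (Suc m)) * EB (Suc m)) * ?X 1 m"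
      by (simp add: emb_assoc emb_add distrib_right mult.commute del: fls_const_mult_const)
    also have "\<dots> = ?X 1 m" using FE[of "Suc m"] m by simp
    finally show ?thesis using b by (simp add: cong_sym)
  qed
  have "Fop emb q J (fusion_step emb q r J K Y x (opM (Suc J) al ga \<phi>)) i \<approx> Fop emb q J (opL al1' ga1' al2 ga2 ?X) i"
    by (rule Fop_cong[OF X i])
  also have "\<dots> \<approx> Fop emb q J (opL al1' ga1' al2 ga2 (Eop emb q J ?F)) i"
    by (rule Fop_cong[OF opL_cong[OF image] i])
  also have "\<dots> \<approx> Fop emb q J (Eop emb q J (opM (Suc J) al' ga' ?F)) i"
    by (rule Fop_cong[OF _ i]) (simp add: opL_Eop)
  also have "\<dots> = opM (Suc J) al' ga' ?F i" by (rule Fop_Eop[OF i])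
  finally show ?thesis .
qed

end

section \<open>Relations between the generating series\<close>

text \<open>
  The spectral parameter \<open>a u\<close>.
\<close>

definition lin :: "complex \<Rightarrow> complex fls" where "lin a = fls_const a * fls_X_inv"

definition inv_U_fps :: "complex \<Rightarrow> complex fls \<Rightarrow> complex fps" where
  "inv_U_fps q x = Abs_fps (\<lambda>n. fls_nth (inverse (Ufun q x)) (int n))"

lemma scal_fps_power:
  "Abs_fps (\<lambda>n. scal (fps_nth V n)) ^ i = Abs_fps (\<lambda>n. scal (fps_nth (V ^ i) n))"
proof (induction i)
  case 0
  show ?case by (rule fps_ext) (simp add: fps_one_nth)
next
  case (Suc i)
  show ?case unfolding power_Suc Suc
    by (rule fps_ext) (simp add: fps_mult_nth scal_sum scal_mult)
qed

lemma gen_ser_fps_nth: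
  "fps_nth (fps_compose (Abs_fps (\<lambda>n. case n of 0 \<Rightarrow> 0 | Suc k \<Rightarrow> gen (g k))) (Abs_fps (\<lambda>n. scal (fps_nth V n)))) n
   = (\<Sum>k<n. gen (g k) * scal (fps_nth (V ^ Suc k) n))"
proof -
  have "{0..n} = insert 0 (Suc ` {..<n})"
    by (simp only: atLeast0AtMost lessThan_Suc_atMost[symmetric] lessThan_Suc_eq_insert_0)
  then show ?thesis
    by (simp add: fps_compose_nth scal_fps_power sum.reindex del: power_Suc)
qed

text \<open>
  Although the composition of the defining power series takes place in a noncommutative ring, the inner series has scalar
  coefficients, so it expands like a commutative one.
\<close>

lemma gen_ser_nth:
  "fls_nth (gen_ser q g x) n = (if n < 0 then 0
     else \<Sum>k<nat n. gen (g k) * scal (fps_nth (inv_U_fps q x ^ Suc k) (nat n)))"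
  unfolding gen_ser_def
  using gen_ser_fps_nth[of g "inv_U_fps q x" "nat n"] by (simp add: inv_U_fps_def del: power_Suc)

lemma Ufun_nz:
  assumes "q \<noteq> 0" "q + inverse q \<noteq> 0" "a \<noteq> 0"
  shows "Ufun q (lin a) \<noteq> 0"
proof -
  have x2: "(lin a)^2 = fls_const (a^2) * fls_X_inv^2"
    by (simp add: lin_def power_mult_distrib fls_const_power)
  have ix2: "inverse (fls_const (a^2) * fls_X_inv^2) = fls_const (inverse (a^2)) * fls_X^2"
    by (simp add: fls_inverse_const fls_inverse_X_inv flip: power_inverse)
  have "fls_nth (fls_const q * (lin a)^2 + fls_const (inverse q) * inverse ((lin a)^2)) (- 2) = q * a^2"
    unfolding x2 ix2 by (simp add: mult.assoc[symmetric])
  then have "fls_const q * (lin a)^2 + fls_const (inverse q) * inverse ((lin a)^2) \<noteq> 0"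
    using assms by (metis fls_zero_nth mult_eq_0_iff power_not_zero)
  then show ?thesis using assms by (simp add: Ufun_def)
qed

text \<open>
  Multiplication by \<open>U\<close> removes one power of \<open>U\<^sup>-\<^sup>1\<close>. This turns the relations that raise the index of a generator into
  relations for the same generating series.
\<close>

lemma gen_ser_shift:
  assumes "q \<noteq> 0" "q + inverse q \<noteq> 0" "a \<noteq> 0"
  shows "fls_scal (Ufun q (lin a)) * gen_ser q g (lin a) = fls_const (gen (g 0)) + gen_ser q (\<lambda>k. g (Suc k)) (lin a)"
proof -
  define V where "V = inv_U_fps q (lin a)"
  define Vs where "Vs = Abs_fps (\<lambda>n. scal (fps_nth V n))"
  define f where "f = Abs_fps (\<lambda>n. case n of 0 \<Rightarrow> 0 | Suc k \<Rightarrow> gen (g k))"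
  define f' where "f' = Abs_fps (\<lambda>n. case n of 0 \<Rightarrow> 0 | Suc k \<Rightarrow> gen (g (Suc k)))"
  have V0: "fps_nth V 0 = 0"
    using inverse_Ufun_nth_eq_0[OF assms, of 0] by (simp add: V_def inv_U_fps_def lin_def)
  have Vpow: "fps_nth (V ^ k) m = 0" if "m < k" for k m
    using startsby_zero_power_prefix[OF V0] that by auto
  have "fls_nth (inverse (Ufun q (lin a))) n = 0" if "n < 0" for n
    using inverse_Ufun_nth_eq_0[OF assms, of n] that by (simp add: lin_def)
  then have Vs: "fls_scal (inverse (Ufun q (lin a))) = fps_to_fls Vs"
    by (intro fls_eqI) (auto simp: Vs_def V_def inv_U_fps_def)
  have "f oo Vs = Vs * (fps_const (gen (g 0)) + (f' oo Vs))"
  proof (rule fps_ext)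
    fix n
    have inner: "fps_nth (fps_const (gen (g 0)) + (f' oo Vs)) m = (\<Sum>i\<le>n. gen (g i) * scal (fps_nth (V ^ i) m))" if "m \<le> n" for m
    proof -
      have "fps_nth (fps_const (gen (g 0)) + (f' oo Vs)) m = (\<Sum>i\<le>m. gen (g i) * scal (fps_nth (V ^ i) m))"
        unfolding fps_add_nth f'_def Vs_def gen_ser_fps_nth sum.atMost_shift
        by (simp add: fps_one_nth del: power_Suc)
      also have "\<dots> = (\<Sum>i\<le>n. gen (g i) * scal (fps_nth (V ^ i) m))"
        by (rule sum.mono_neutral_left) (use that in \<open>auto simp: Vpow not_le\<close>)
      finally show ?thesis .
    qed
    have "fps_nth (Vs * (fps_const (gen (g 0)) + (f' oo Vs))) n
       = (\<Sum>m=0..n. scal (fps_nth V m) * (\<Sum>i\<le>n. gen (g i) * scal (fps_nth (V ^ i) (n - m))))"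
      unfolding fps_mult_nth by (rule sum.cong, simp, subst inner) (simp_all add: Vs_def)
    also have "\<dots> = (\<Sum>m=0..n. \<Sum>i\<le>n. gen (g i) * scal (fps_nth V m * fps_nth (V ^ i) (n - m)))"
      by (simp add: sum_distrib_left scal_mult mult.assoc[symmetric] scal_commute[of _ "gen _"])
    also have "\<dots> = (\<Sum>i\<le>n. gen (g i) * scal (fps_nth (V ^ Suc i) n))"
      by (subst sum.swap) (simp add: fps_mult_nth scal_sum sum_distrib_left)
    also have "\<dots> = (\<Sum>k<n. gen (g k) * scal (fps_nth (V ^ Suc k) n))"
      by (simp add: lessThan_Suc_atMost[symmetric] Vpow del: power_Suc)
    also have "\<dots> = fps_nth (f oo Vs) n"
      unfolding f_def Vs_def by (rule gen_ser_fps_nth[symmetric])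
    finally show "fps_nth (f oo Vs) n = fps_nth (Vs * (fps_const (gen (g 0)) + (f' oo Vs))) n" by simp
  qed
  moreover have "gen_ser q g (lin a) = fps_to_fls (f oo Vs)"
    "gen_ser q (\<lambda>k. g (Suc k)) (lin a) = fps_to_fls (f' oo Vs)"
    by (simp_all add: gen_ser_def f_def f'_def Vs_def V_def inv_U_fps_def)
  ultimately have "gen_ser q g (lin a) = fls_scal (inverse (Ufun q (lin a))) * (fls_const (gen (g 0)) + gen_ser q (\<lambda>k. g (Suc k)) (lin a))"
    by (simp add: Vs fls_times_fps_to_fls)
  then show ?thesis
    using Ufun_nz[OF assms] by (simp add: mult.assoc[symmetric] flip: fls_scal_mult)
qed

text \<open>
  The series \<open>\<Sum>k. R k * U\<^bsup>-k-1\<^esup>\<close>. Linear combinations of such series are again of this form, so a family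
  of relations for the \<open>R k\<close> becomes a relation of series.
\<close>

definition coeff_family :: "complex \<Rightarrow> complex fls \<Rightarrow> free_alg fls \<Rightarrow> (nat \<Rightarrow> free_alg) \<Rightarrow> bool" where
  "coeff_family q x F R \<longleftrightarrow> (\<forall>n. fls_nth F n = (if n < 0 then 0
     else \<Sum>k<nat n. R k * scal (fps_nth (inv_U_fps q x ^ Suc k) (nat n))))"

lemma coeff_family_intros:
  "coeff_family q x (gen_ser q g x) (\<lambda>k. gen (g k))"
  "coeff_family q x F R \<Longrightarrow> coeff_family q x (fls_const c * F) (\<lambda>k. c * R k)"
  "coeff_family q x F R \<Longrightarrow> coeff_family q x (F * fls_const c) (\<lambda>k. R k * c)"
  "coeff_family q x F R \<Longrightarrow> coeff_family q x G S \<Longrightarrow> coeff_family q x (F - G) (\<lambda>k. R k - S k)"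
proof -
  show "coeff_family q x (gen_ser q g x) (\<lambda>k. gen (g k))"
    unfolding coeff_family_def gen_ser_nth by simp
  assume F: "coeff_family q x F R"
  then show "coeff_family q x (fls_const c * F) (\<lambda>k. c * R k)"
    by (simp add: coeff_family_def sum_distrib_left mult.assoc del: power_Suc)
  have swap: "a * scal b * c = a * c * scal b" for a b c
    by (simp add: mult.assoc scal_commute)
  show "coeff_family q x (F * fls_const c) (\<lambda>k. R k * c)"
    using F by (simp add: coeff_family_def sum_distrib_right swap del: power_Suc)
  assume "coeff_family q x G S"
  with F show "coeff_family q x (F - G) (\<lambda>k. R k - S k)"
    by (simp add: coeff_family_def sum_subtractf left_diff_distrib del: power_Suc)
qed

lemma coeff_family_null:
  assumes "coeff_family q x F R" and "\<And>k. R k \<in> aq_ideal q kp km"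
  shows "F \<in> aq_null q kp km"
proof -
  interpret I: two_sided_ideal "aq_ideal q kp km" by (rule two_sided_ideal_aq_ideal)
  show ?thesis
    using assms unfolding aq_null_def coeff_family_def
    by (auto simp: I.zero_closed simp del: power_Suc intro!: I.sum_closed I.mult_right_closed)
qed

abbreviation "W0 \<equiv> fls_const (gen (Wneg 0))"
abbreviation "W1 \<equiv> fls_const (gen (Wpos 0))"
abbreviation "sc c \<equiv> fls_scal (fls_const c)"

lemma W_series_commute:
  "W0 * gen_ser q Wneg x - gen_ser q Wneg x * W0 \<in> aq_null q kp km"
  "W1 * gen_ser q Wpos x - gen_ser q Wpos x * W1 \<in> aq_null q kp km"
proof -
  have 0: "gen (Wneg 0) * gen (Wneg k) - gen (Wneg k) * gen (Wneg 0) \<in> aq_ideal q kp km"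
    "gen (Wpos 0) * gen (Wpos k) - gen (Wpos k) * gen (Wpos 0) \<in> aq_ideal q kp km" for k
    using aq_rel_imp_ideal[OF aq_rel.intros(7)[of q kp km 0 k]]
      aq_rel_imp_ideal[OF aq_rel.intros(8)[of q kp km 0 k]] by (simp_all add: comm_def)
  show "W0 * gen_ser q Wneg x - gen_ser q Wneg x * W0 \<in> aq_null q kp km"
    by (rule coeff_family_null[where x = x, OF _ 0(1)], (rule coeff_family_intros)+)
  show "W1 * gen_ser q Wpos x - gen_ser q Wpos x * W1 \<in> aq_null q kp km"
    by (rule coeff_family_null[where x = x, OF _ 0(2)], (rule coeff_family_intros)+)
qed

lemma W_series_commutator:
  shows "W0 * gen_ser q Wpos x - gen_ser q Wpos x * W0
    - sc (1 / (q + inverse q)) * (gen_ser q Gen_Gt x - gen_ser q Gen_G x) \<in> aq_null q kp km"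
    and "gen_ser q Wneg x * W1 - W1 * gen_ser q Wneg x
    - sc (1 / (q + inverse q)) * (gen_ser q Gen_Gt x - gen_ser q Gen_G x) \<in> aq_null q kp km"
proof -
  have 1: "gen (Wneg 0) * gen (Wpos k) - gen (Wpos k) * gen (Wneg 0) - scal (1 / (q + inverse q)) * (gen (Gen_Gt k) - gen (Gen_G k)) \<in> aq_ideal q kp km" for k
    using aq_rel_imp_ideal[OF aq_rel.intros(1)[of q kp km k]] by (simp add: comm_def)
  have 2: "gen (Wneg k) * gen (Wpos 0) - gen (Wpos 0) * gen (Wneg k) - scal (1 / (q + inverse q)) * (gen (Gen_Gt k) - gen (Gen_G k)) \<in> aq_ideal q kp km" for k
    using aq_rel_imp_ideal[OF aq_rel.intros(2)[of q kp km k]] by (simp add: comm_def)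
  show "W0 * gen_ser q Wpos x - gen_ser q Wpos x * W0
    - sc (1 / (q + inverse q)) * (gen_ser q Gen_Gt x - gen_ser q Gen_G x) \<in> aq_null q kp km"
    unfolding fls_scal_const by (rule coeff_family_null[where x = x, OF _ 1], (rule coeff_family_intros)+)
  show "gen_ser q Wneg x * W1 - W1 * gen_ser q Wneg x
    - sc (1 / (q + inverse q)) * (gen_ser q Gen_Gt x - gen_ser q Gen_G x) \<in> aq_null q kp km"
    unfolding fls_scal_const by (rule coeff_family_null[where x = x, OF _ 2], (rule coeff_family_intros)+)
qed

lemma WG_series_q_commutator:
  shows "sc q * (W0 * gen_ser q Gen_G x) - sc (inverse q) * (gen_ser q Gen_G x * W0)
    - sc (kp * km * (q + inverse q)^2) * (gen_ser q (\<lambda>k. Wneg (Suc k)) x - gen_ser q Wpos x) \<in> aq_null q kp km"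
    and "sc q * (gen_ser q Gen_Gt x * W0) - sc (inverse q) * (W0 * gen_ser q Gen_Gt x)
    - sc (kp * km * (q + inverse q)^2) * (gen_ser q (\<lambda>k. Wneg (Suc k)) x - gen_ser q Wpos x) \<in> aq_null q kp km"
    and "sc q * (gen_ser q Gen_G x * W1) - sc (inverse q) * (W1 * gen_ser q Gen_G x)
    - sc (kp * km * (q + inverse q)^2) * (gen_ser q (\<lambda>k. Wpos (Suc k)) x - gen_ser q Wneg x) \<in> aq_null q kp km"
    and "sc q * (W1 * gen_ser q Gen_Gt x) - sc (inverse q) * (gen_ser q Gen_Gt x * W1)
    - sc (kp * km * (q + inverse q)^2) * (gen_ser q (\<lambda>k. Wpos (Suc k)) x - gen_ser q Wneg x) \<in> aq_null q kp km"
proof -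
  have 1: "scal q * (gen (Wneg 0) * gen (Gen_G k)) - scal (inverse q) * (gen (Gen_G k) * gen (Wneg 0)) - scal (kp * km * (q + inverse q)^2) * (gen (Wneg (Suc k)) - gen (Wpos k)) \<in> aq_ideal q kp km" for k
    using aq_rel_imp_ideal[OF aq_rel.intros(3)[of q kp km k]] by (simp add: qcomm_def)
  have 2: "scal q * (gen (Gen_Gt k) * gen (Wneg 0)) - scal (inverse q) * (gen (Wneg 0) * gen (Gen_Gt k)) - scal (kp * km * (q + inverse q)^2) * (gen (Wneg (Suc k)) - gen (Wpos k)) \<in> aq_ideal q kp km" for k
    using aq_rel_imp_ideal[OF aq_rel.intros(4)[of q kp km k]] by (simp add: qcomm_def)
  have 3: "scal q * (gen (Gen_G k) * gen (Wpos 0)) - scal (inverse q) * (gen (Wpos 0) * gen (Gen_G k)) - scal (kp * km * (q + inverse q)^2) * (gen (Wpos (Suc k)) - gen (Wneg k)) \<in> aq_ideal q kp km" for k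
    using aq_rel_imp_ideal[OF aq_rel.intros(5)[of q kp km k]] by (simp add: qcomm_def)
  have 4: "scal q * (gen (Wpos 0) * gen (Gen_Gt k)) - scal (inverse q) * (gen (Gen_Gt k) * gen (Wpos 0)) - scal (kp * km * (q + inverse q)^2) * (gen (Wpos (Suc k)) - gen (Wneg k)) \<in> aq_ideal q kp km" for k
    using aq_rel_imp_ideal[OF aq_rel.intros(6)[of q kp km k]] by (simp add: qcomm_def)
  show "sc q * (W0 * gen_ser q Gen_G x) - sc (inverse q) * (gen_ser q Gen_G x * W0)
    - sc (kp * km * (q + inverse q)^2) * (gen_ser q (\<lambda>k. Wneg (Suc k)) x - gen_ser q Wpos x) \<in> aq_null q kp km"
    unfolding fls_scal_const by (rule coeff_family_null[where x = x, OF _ 1], (rule coeff_family_intros)+)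
  show "sc q * (gen_ser q Gen_Gt x * W0) - sc (inverse q) * (W0 * gen_ser q Gen_Gt x)
    - sc (kp * km * (q + inverse q)^2) * (gen_ser q (\<lambda>k. Wneg (Suc k)) x - gen_ser q Wpos x) \<in> aq_null q kp km"
    unfolding fls_scal_const by (rule coeff_family_null[where x = x, OF _ 2], (rule coeff_family_intros)+)
  show "sc q * (gen_ser q Gen_G x * W1) - sc (inverse q) * (W1 * gen_ser q Gen_G x)
    - sc (kp * km * (q + inverse q)^2) * (gen_ser q (\<lambda>k. Wpos (Suc k)) x - gen_ser q Wneg x) \<in> aq_null q kp km"
    unfolding fls_scal_const by (rule coeff_family_null[where x = x, OF _ 3], (rule coeff_family_intros)+)
  show "sc q * (W1 * gen_ser q Gen_Gt x) - sc (inverse q) * (gen_ser q Gen_Gt x * W1)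
    - sc (kp * km * (q + inverse q)^2) * (gen_ser q (\<lambda>k. Wpos (Suc k)) x - gen_ser q Wneg x) \<in> aq_null q kp km"
    unfolding fls_scal_const by (rule coeff_family_null[where x = x, OF _ 4], (rule coeff_family_intros)+)
qed

interpretation fls_scal: central_scalars fls_scal
  by standard (rule fls_scal_1 fls_scal_add fls_scal_mult fls_scal_commute)+

context central_scalars
begin

text \<open>
  The off-diagonal entries of the fundamental K-operator are \<open>s G + t\<close> with scalars \<open>s\<close> and \<open>t\<close>. The constant \<open>t\<close> is the
  one for which the scalar term of the \<open>q\<close>-commutator cancels the part of the relation that is linear in the
  generator \<open>w\<close>.
\<close>

lemma affine_q_commutator:
  assumes "s * rho = k * QQ" "q1 * t = q2 * t + k * QQ"
  shows "emb q1 * (w * (emb s * G + emb t)) - emb q2 * ((emb s * G + emb t) * w) - emb k * (emb QQ * (V - X))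
       = emb s * (emb q1 * (w * G) - emb q2 * (G * w) - emb rho * (V - w - X))"
    and "emb q1 * ((emb s * G + emb t) * w) - emb q2 * (w * (emb s * G + emb t)) - emb k * (emb QQ * (V - X))
       = emb s * (emb q1 * (G * w) - emb q2 * (w * G) - emb rho * (V - w - X))"
proof -
  note rules = distrib_left distrib_right right_diff_distrib mult.assoc emb_assoc emb_left_commute[of w]
    emb_commute[of t w, symmetric]
  have rho: "emb (rho * s) = emb (k * QQ)" and t: "emb (q1 * t) * w = emb (q2 * t) * w + emb (k * QQ) * w"
    using assms by (simp_all only: emb_add distrib_right mult.commute[of rho])
  show "emb q1 * (w * (emb s * G + emb t)) - emb q2 * ((emb s * G + emb t) * w) - emb k * (emb QQ * (V - X))
       = emb s * (emb q1 * (w * G) - emb q2 * (G * w) - emb rho * (V - w - X))"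
    by (simp only: rules rho t mult.commute[of s]) simp
  show "emb q1 * ((emb s * G + emb t) * w) - emb q2 * (w * (emb s * G + emb t)) - emb k * (emb QQ * (V - X))
       = emb s * (emb q1 * (G * w) - emb q2 * (w * G) - emb rho * (V - w - X))"
    by (simp only: rules rho t mult.commute[of s]) simp
qed

end

lemma sc_mult: "sc a * sc b = sc (a * b)"
  by (simp flip: fls_scal_mult)

context generic_q
begin

lemma Kop_half_index:
  "Kop_half q kp km x $$ (0, 0) = fls_scal (x * fls_const q) * gen_ser q Wneg x
     - fls_scal (inverse x * fls_const (inverse q)) * gen_ser q Wpos x"
  "Kop_half q kp km x $$ (0, Suc 0) = sc (1 / (km * (q + inverse q))) * gen_ser q Gen_G x
     + sc (kp * (q + inverse q) / (q - inverse q))"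
  "Kop_half q kp km x $$ (Suc 0, 0) = sc (1 / (kp * (q + inverse q))) * gen_ser q Gen_Gt x
     + sc (km * (q + inverse q) / (q - inverse q))"
  "Kop_half q kp km x $$ (Suc 0, Suc 0) = fls_scal (x * fls_const q) * gen_ser q Wpos x
     - fls_scal (inverse x * fls_const (inverse q)) * gen_ser q Wneg x"
  by (simp_all add: Kop_half_def Let_def mat_of_rows_list_def)

lemma Kop_half_carrier: "Kop_half q kp km x \<in> carrier_mat 2 2"
  by (rule carrier_matI) (simp_all add: Kop_half_def Let_def mat_of_rows_list_def)

text \<open>
  The defining relations that involve \<open>W\<^sub>0\<close> or \<open>W\<^sub>1\<close>, written with matrix entries. The right-hand sides are
  linear in the entries because \<open>Q U = q y\<^sup>2 + q\<^sup>-\<^sup>1 y\<^sup>-\<^sup>2\<close> for \<open>Q = q + q\<^sup>-\<^sup>1\<close>, so that \<open>y K\<^sub>1\<^sub>1 - y\<^sup>-\<^sup>1 K\<^sub>2\<^sub>2\<close> is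
  \<open>Q (U W\<^sub>+ - W\<^sub>-)\<close>.
\<close>

lemma Kop_half_relations:
  fixes kp km a :: complex
  defines "K \<equiv> Kop_half q kp km (lin a)" and "y \<equiv> lin a"
  assumes nz: "kp \<noteq> 0" "km \<noteq> 0" "a \<noteq> 0"
  defines "D \<equiv> sc kp * K $$ (1,0) - sc km * K $$ (0,1)"
  shows "W0 * K $$ (0,0) - K $$ (0,0) * W0 + fls_scal (inverse y * fls_const (inverse q)) * D \<in> aq_null q kp km" (is ?A0)
    and "W0 * K $$ (1,1) - K $$ (1,1) * W0 - fls_scal (y * fls_const q) * D \<in> aq_null q kp km" (is ?B0)
    and "sc q * (W0 * K $$ (0,1)) - sc (inverse q) * (K $$ (0,1) * W0)
      - sc kp * (fls_scal y * K $$ (0,0) - fls_scal (inverse y) * K $$ (1,1)) \<in> aq_null q kp km" (is ?C0)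
    and "sc q * (K $$ (1,0) * W0) - sc (inverse q) * (W0 * K $$ (1,0))
      - sc km * (fls_scal y * K $$ (0,0) - fls_scal (inverse y) * K $$ (1,1)) \<in> aq_null q kp km" (is ?D0)
    and "W1 * K $$ (0,0) - K $$ (0,0) * W1 + fls_scal (y * fls_const q) * D \<in> aq_null q kp km" (is ?A1)
    and "W1 * K $$ (1,1) - K $$ (1,1) * W1 - fls_scal (inverse y * fls_const (inverse q)) * D \<in> aq_null q kp km" (is ?B1)
    and "sc q * (K $$ (0,1) * W1) - sc (inverse q) * (W1 * K $$ (0,1))
      - sc kp * (fls_scal y * K $$ (1,1) - fls_scal (inverse y) * K $$ (0,0)) \<in> aq_null q kp km" (is ?C1)
    and "sc q * (W1 * K $$ (1,0)) - sc (inverse q) * (K $$ (1,0) * W1)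
      - sc km * (fls_scal y * K $$ (1,1) - fls_scal (inverse y) * K $$ (0,0)) \<in> aq_null q kp km" (is ?D1)
proof -
  interpret N: two_sided_ideal "aq_null q kp km" by (rule two_sided_ideal_aq_null)
  define Q where "Q = q + inverse q"
  have Q: "Q \<noteq> 0" using q_sum_nz by (simp add: Q_def)
  define U where "U = Ufun q (lin a)"
  define Wp Wm Gp Gm where "Wp = gen_ser q Wneg (lin a)" and "Wm = gen_ser q Wpos (lin a)"
    and "Gp = gen_ser q Gen_G (lin a)" and "Gm = gen_ser q Gen_Gt (lin a)"
  have y_nz: "y \<noteq> 0" using nz by (simp add: y_def lin_def)
  note K = Kop_half_index[of kp km "lin a", folded K_def Wp_def Wm_def Gp_def Gm_def y_def Q_def]
  have D: "D = sc (1 / Q) * (Gm - Gp)"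
  proof -
    have "kp * (1 / (kp * Q)) = 1 / Q" "km * (1 / (km * Q)) = 1 / Q"
      "kp * (km * Q / (q - inverse q)) = km * (kp * Q / (q - inverse q))"
      using nz Q by simp_all
    then show ?thesis unfolding D_def K One_nat_def
      by (simp only: distrib_left right_diff_distrib mult.assoc[symmetric] sc_mult) simp
  qed
  have UQ: "fls_const Q * U = fls_const q * y ^ 2 + fls_const (inverse q) * inverse (y ^ 2)"
    using Q by (simp add: U_def Ufun_def Q_def[symmetric] y_def)
  have diag: "fls_scal y * K $$ (0,0) - fls_scal (inverse y) * K $$ (1,1) = sc Q * (fls_scal U * Wp - Wm)"
    "fls_scal y * K $$ (1,1) - fls_scal (inverse y) * K $$ (0,0) = sc Q * (fls_scal U * Wm - Wp)"
  proof -
    have UQ': "fls_const Q * U = y * (y * fls_const q) + inverse y * (inverse y * fls_const (inverse q))"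
      unfolding UQ by (simp add: power2_eq_square mult_ac)
    have scQ: "sc Q = sc q + sc (inverse q)"
      unfolding Q_def fls_plus_const[symmetric] fls_scal_add ..
    have E: "sc Q * (fls_scal U * A) - sc Q * B = fls_scal (y * (y * fls_const q)) * A
      + fls_scal (inverse y * (inverse y * fls_const (inverse q))) * A - (sc q * B + sc (inverse q) * B)" for A B
      unfolding fls_scal.emb_assoc UQ' fls_scal_add distrib_right
      by (simp only: scQ distrib_right)
    have C: "y * (inverse y * z) = z" "inverse y * (y * z) = z" for z using y_nz by (simp_all add: mult.assoc[symmetric])
    have ab: "(a - b) - (c - d) = a + d - (c + b)" for a b c d :: "free_alg fls" by simp
    have "fls_scal y * (fls_scal (y * fls_const q) * A - fls_scal (inverse y * fls_const (inverse q)) * B)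
        - fls_scal (inverse y) * (fls_scal (y * fls_const q) * B - fls_scal (inverse y * fls_const (inverse q)) * A)
        = sc Q * (fls_scal U * A - B)" for A B
      unfolding right_diff_distrib E unfolding fls_scal.emb_assoc C ab ..
    note H = this
    show "fls_scal y * K $$ (0,0) - fls_scal (inverse y) * K $$ (1,1) = sc Q * (fls_scal U * Wp - Wm)"
      "fls_scal y * K $$ (1,1) - fls_scal (inverse y) * K $$ (0,0) = sc Q * (fls_scal U * Wm - Wp)"
      unfolding K One_nat_def by (rule H)+
  qed
  note relW = W_series_commute[of q "lin a" kp km, folded Wp_def Wm_def]
  note relWW = W_series_commutator[of q "lin a" kp km, folded Wp_def Wm_def Gp_def Gm_def Q_def, folded D]
  have shift: "gen_ser q (\<lambda>k. Wneg (Suc k)) (lin a) = fls_scal U * Wp - W0"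
    "gen_ser q (\<lambda>k. Wpos (Suc k)) (lin a) = fls_scal U * Wm - W1"
    using gen_ser_shift[OF q_nz q_sum_nz nz(3)] by (simp_all add: U_def Wp_def Wm_def)
  note relG = WG_series_q_commutator[of q "lin a" kp km, folded Wp_def Wm_def Gp_def Gm_def Q_def, unfolded shift]
  note push = right_diff_distrib left_diff_distrib distrib_left distrib_right mult.assoc
    fls_scal.emb_left_commute[of W0] fls_scal.emb_left_commute[of W1]
  have "W0 * K $$ (0,0) - K $$ (0,0) * W0 + fls_scal (inverse y * fls_const (inverse q)) * D =
     fls_scal (y * fls_const q) * (W0 * Wp - Wp * W0) - fls_scal (inverse y * fls_const (inverse q)) * (W0 * Wm - Wm * W0 - D)"
    by (simp only: K One_nat_def push) (simp only: diff_conv_add_uminus minus_add_distrib minus_minus add_ac mult_minus_right distrib_left)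
  then show ?A0 using N.diff_closed[OF N.mult_left_closed[OF relW(1)] N.mult_left_closed[OF relWW(1)]] by (simp only:)
  have "W0 * K $$ (1,1) - K $$ (1,1) * W0 - fls_scal (y * fls_const q) * D =
     fls_scal (y * fls_const q) * (W0 * Wm - Wm * W0 - D) - fls_scal (inverse y * fls_const (inverse q)) * (W0 * Wp - Wp * W0)"
    by (simp only: K One_nat_def push) (simp only: diff_conv_add_uminus minus_add_distrib minus_minus add_ac mult_minus_right distrib_left)
  then show ?B0 using N.diff_closed[OF N.mult_left_closed[OF relWW(1)] N.mult_left_closed[OF relW(1)]] by (simp only:)
  have "W1 * K $$ (0,0) - K $$ (0,0) * W1 + fls_scal (y * fls_const q) * D =
     fls_scal (y * fls_const q) * (- (Wp * W1 - W1 * Wp - D)) - fls_scal (inverse y * fls_const (inverse q)) * (W1 * Wm - Wm * W1)"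
    by (simp only: K One_nat_def push) (simp only: diff_conv_add_uminus minus_add_distrib minus_minus add_ac mult_minus_right distrib_left)
  then show ?A1 using N.diff_closed[OF N.mult_left_closed[OF N.uminus_closed[OF relWW(2)]] N.mult_left_closed[OF relW(2)]] by (simp only:)
  have "W1 * K $$ (1,1) - K $$ (1,1) * W1 - fls_scal (inverse y * fls_const (inverse q)) * D =
     fls_scal (y * fls_const q) * (W1 * Wm - Wm * W1) - fls_scal (inverse y * fls_const (inverse q)) * (- (Wp * W1 - W1 * Wp - D))"
    by (simp only: K One_nat_def push) (simp only: diff_conv_add_uminus minus_add_distrib minus_minus add_ac mult_minus_right distrib_left)
  then show ?B1 using N.diff_closed[OF N.mult_left_closed[OF relW(2)] N.mult_left_closed[OF N.uminus_closed[OF relWW(2)]]] by (simp only:)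
  have s: "fls_const (1 / (km * Q)) * fls_const (kp * km * Q^2) = fls_const kp * fls_const Q"
    "fls_const (1 / (kp * Q)) * fls_const (kp * km * Q^2) = fls_const km * fls_const Q"
    using nz Q by (simp_all add: power2_eq_square)
  have t: "fls_const q * fls_const (kk * Q / (q - inverse q))
     = fls_const (inverse q) * fls_const (kk * Q / (q - inverse q)) + fls_const kk * fls_const Q" for kk
  proof -
    have "(q - inverse q) * (kk * Q / (q - inverse q)) = kk * Q" using q_diff_nz by simp
    then have "q * (kk * Q / (q - inverse q)) = inverse q * (kk * Q / (q - inverse q)) + kk * Q"
      by (simp only: left_diff_distrib diff_eq_eq add.commute)
    then show ?thesis
      unfolding fls_const_mult_const fls_plus_const by (rule arg_cong)
  qed
  note aff = fls_scal.affine_q_commutator[OF s(1) t[of kp]] fls_scal.affine_q_commutator[OF s(2) t[of km]]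
  show ?C0 unfolding diag unfolding K One_nat_def aff(1) by (rule N.mult_left_closed[OF relG(1)])
  show ?D0 unfolding diag unfolding K One_nat_def aff(4) by (rule N.mult_left_closed[OF relG(2)])
  show ?C1 unfolding diag unfolding K One_nat_def aff(2) by (rule N.mult_left_closed[OF relG(3)])
  show ?D1 unfolding diag unfolding K One_nat_def aff(3) by (rule N.mult_left_closed[OF relG(4)])
qed

end

section \<open>The fusion defect vanishes\<close>

text \<open>
  Modulo the ideal, a factor of order at most \<open>u\<close> contributes through its coefficient of \<open>u\<close> alone if all lower
  coefficients of the other factor are already in the ideal.
\<close>

lemma coefficient_of_scalar_multiple:
  assumes "two_sided_ideal I" and F: "\<And>m. m < n \<Longrightarrow> fls_nth F m \<in> I" and s: "\<And>i. i < - 1 \<Longrightarrow> fls_nth s i = 0"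
  shows "fls_nth (fls_scal s * F) (n - 1) - scal (fls_nth s (- 1)) * fls_nth F n \<in> I"
proof -
  interpret two_sided_ideal I by fact
  define b where "b = fls_subdegree F"
  have eq: "fls_nth (fls_scal s * F) (n - 1) = (\<Sum>i=- 1..n - 1 - b. scal (fls_nth s i) * fls_nth F (n - 1 - i))"
    using s by (subst fls_times_nth_interval[of "- 1" _ b]) (simp_all add: b_def)
  show ?thesis
  proof (cases "b \<le> n")
    case True
    then have "{- 1..n - 1 - b} = insert (- 1) {0..n - 1 - b}" by auto
    then have "fls_nth (fls_scal s * F) (n - 1) - scal (fls_nth s (- 1)) * fls_nth F n
       = (\<Sum>i=0..n - 1 - b. scal (fls_nth s i) * fls_nth F (n - 1 - i))"
      unfolding eq by simp
    then show ?thesis using F by (auto intro!: sum_closed mult_left_closed)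
  next
    case False
    then show ?thesis unfolding eq b_def by (simp add: zero_closed)
  qed
qed

lemma scal_cancel:
  assumes "two_sided_ideal I" "c \<noteq> 0" "scal c * x \<in> I" shows "x \<in> I"
proof -
  interpret two_sided_ideal I by fact
  have "scal (inverse c) * (scal c * x) = x"
    using assms(2) by (simp add: mult.assoc[symmetric] flip: scal_mult)
  then show ?thesis using mult_left_closed[OF assms(3)] by metis
qed

text \<open>
  Suppose all coefficients below \<open>n\<close> are in the ideal. At order \<open>n - 1\<close> the first relation then reduces to
  \<open>A l * z k (l - 1) = D k * z (k - 1) l\<close> in leading coefficients, and the second one to
  \<open>B' l * z k (l + 1) = C' k * z (k + 1) l\<close>. Along an antidiagonal \<open>k + l\<close>, the first relation descends to \<open>k = 0\<close>,
  where \<open>z\<close> vanishes; this stays within the index range if \<open>k + l \<le> J + 1\<close>. The second one ascends to \<open>k = J\<close>,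
  where \<open>C'\<close> vanishes, and stays in range if \<open>k + l \<ge> J + 1\<close>.
\<close>

lemma bigraded_defect_vanishes:
  fixes z :: "nat \<Rightarrow> nat \<Rightarrow> free_alg fls" and J :: nat
  assumes R: "\<And>k l. 1 \<le> k \<Longrightarrow> k \<le> J \<Longrightarrow> l \<le> Suc J \<Longrightarrow>
      fls_scal (c k l) * (z k l * w) + (if l = 0 then 0 else fls_scal (A l) * z k (l - 1)) + fls_scal (B l) * z k (Suc l)
      - (fls_scal (d k l) * (w * z k l) + fls_scal (C k) * z (Suc k) l + fls_scal (D k) * z (k - 1) l) \<in> aq_null q kp km"
    and R': "\<And>k l. 1 \<le> k \<Longrightarrow> k \<le> J \<Longrightarrow> l \<le> Suc J \<Longrightarrow>
      fls_scal (c' k l) * (z k l * w') + (if l = 0 then 0 else fls_scal (A' l) * z k (l - 1)) + fls_scal (B' l) * z k (Suc l)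
      - (fls_scal (d' k l) * (w' * z k l) + fls_scal (C' k) * z (Suc k) l + fls_scal (D' k) * z (k - 1) l) \<in> aq_null q kp km"
    and w: "\<exists>g. w = fls_const g" "\<exists>g. w' = fls_const g"
    and val: "\<And>k l i. i \<le> - 1 \<Longrightarrow> fls_nth (c k l) i = 0" "\<And>k l i. i \<le> - 1 \<Longrightarrow> fls_nth (d k l) i = 0"
      "\<And>k l i. i \<le> - 1 \<Longrightarrow> fls_nth (c' k l) i = 0" "\<And>k l i. i \<le> - 1 \<Longrightarrow> fls_nth (d' k l) i = 0"
      "\<And>l i. i < - 1 \<Longrightarrow> fls_nth (A l) i = 0" "\<And>l i. i \<le> - 1 \<Longrightarrow> fls_nth (B l) i = 0"
      "\<And>l i. i \<le> - 1 \<Longrightarrow> fls_nth (C l) i = 0" "\<And>l i. i < - 1 \<Longrightarrow> fls_nth (D l) i = 0"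
      "\<And>l i. i \<le> - 1 \<Longrightarrow> fls_nth (A' l) i = 0" "\<And>l i. i < - 1 \<Longrightarrow> fls_nth (B' l) i = 0"
      "\<And>l i. i < - 1 \<Longrightarrow> fls_nth (C' l) i = 0" "\<And>l i. i \<le> - 1 \<Longrightarrow> fls_nth (D' l) i = 0"
    and lead: "\<And>l. 1 \<le> l \<Longrightarrow> l \<le> Suc J \<Longrightarrow> fls_nth (A l) (- 1) \<noteq> 0"
      "\<And>l. l \<le> J \<Longrightarrow> fls_nth (B' l) (- 1) \<noteq> 0"
    and top: "B (Suc J) = 0" "B' (Suc J) = 0" "C J = 0" "C' J = 0"
    and z0: "\<And>l. z 0 l = 0"
    and k: "k \<le> J" and l: "l \<le> Suc J"
  shows "z k l \<in> aq_null q kp km"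
proof -
  let ?I = "aq_ideal q kp km"
  interpret two_sided_ideal ?I by (rule two_sided_ideal_aq_ideal)
  note I = two_sided_ideal_aq_ideal[of q kp km]
  define low where "low n \<longleftrightarrow> (\<forall>k\<le>J. \<forall>l\<le>Suc J. \<forall>m<n. fls_nth (z k l) m \<in> ?I)" for n
  have step: "low (n + 1)" if low: "low n" for n
  proof -
    have lz: "fls_nth (z k l) m \<in> ?I" if "k \<le> J" "l \<le> Suc J" "m < n" for k l m
      using low that by (auto simp: low_def)
    have lzw: "fls_nth (z k l * v) m \<in> ?I" "fls_nth (v * z k l) m \<in> ?I"
      if "k \<le> J" "l \<le> Suc J" "m < n" "\<exists>g. v = fls_const g" for k l m v
      using lz[OF that(1-3)] that(4) by (auto intro: mult_left_closed mult_right_closed)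
    have zero: "fls_nth (fls_scal s * F) (n - 1) \<in> ?I"
      if "\<And>m. m < n \<Longrightarrow> fls_nth F m \<in> ?I" "\<And>i. i \<le> - 1 \<Longrightarrow> fls_nth s i = 0" for s F
      using coefficient_of_scalar_multiple[OF I, of n F s] that by simp
    have rel: "fls_nth ((if l = 0 then 0 else fls_scal (a l) * z k (l - 1)) + fls_scal (b l) * z k (Suc l)
        - (fls_scal (e k) * z (Suc k) l + fls_scal (f k) * z (k - 1) l)) (n - 1) \<in> ?I"
      if rel: "fls_scal s * (z k l * v) + (if l = 0 then 0 else fls_scal (a l) * z k (l - 1)) + fls_scal (b l) * z k (Suc l)
      - (fls_scal t * (v * z k l) + fls_scal (e k) * z (Suc k) l + fls_scal (f k) * z (k - 1) l) \<in> aq_null q kp km"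
        and v: "\<exists>g. v = fls_const g" and s: "\<And>i. i \<le> - 1 \<Longrightarrow> fls_nth s i = 0" and t: "\<And>i. i \<le> - 1 \<Longrightarrow> fls_nth t i = 0"
        and kl: "k \<le> J" "l \<le> Suc J"
      for s t v a b e f k l
    proof -
      have "fls_nth (fls_scal s * (z k l * v)) (n - 1) \<in> ?I" "fls_nth (fls_scal t * (v * z k l)) (n - 1) \<in> ?I"
        by (rule zero[OF lzw(1)[OF kl _ v] s] zero[OF lzw(2)[OF kl _ v] t]; assumption)+
      then show ?thesis
        using diff_closed[OF rel[unfolded aq_null_def mem_Collect_eq, rule_format, of "n - 1"]
            diff_closed[of "fls_nth (fls_scal s * (z k l * v)) (n - 1)" "fls_nth (fls_scal t * (v * z k l)) (n - 1)"]]
        by (simp add: algebra_simps)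
    qed
    have relR: "fls_nth ((if l = 0 then 0 else fls_scal (A l) * z k (l - 1)) + fls_scal (B l) * z k (Suc l)
        - (fls_scal (C k) * z (Suc k) l + fls_scal (D k) * z (k - 1) l)) (n - 1) \<in> ?I"
      and relR': "fls_nth ((if l = 0 then 0 else fls_scal (A' l) * z k (l - 1)) + fls_scal (B' l) * z k (Suc l)
        - (fls_scal (C' k) * z (Suc k) l + fls_scal (D' k) * z (k - 1) l)) (n - 1) \<in> ?I"
      if "1 \<le> k" "k \<le> J" "l \<le> Suc J" for k l
      by (rule rel[where a = A and b = B and e = C and f = D, OF R[OF that] w(1) val(1,2) that(2,3)]
          rel[where a = A' and b = B' and e = C' and f = D', OF R'[OF that] w(2) val(3,4) that(2,3)]; assumption)+
    \<comment> \<open>the first relation, at \<open>l + 1\<close>, expresses \<open>z (k + 1) l\<close> by \<open>z k (l + 1)\<close>\<close>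
    have lower: "fls_nth (z k l) n \<in> ?I" if "k + l \<le> Suc J" "k \<le> J" for k l
      using that
    proof (induction k arbitrary: l)
      case 0
      then show ?case by (simp add: z0 zero_closed)
    next
      case (Suc k)
      have kl: "Suc k \<le> J" "Suc l \<le> Suc J" "l \<le> Suc J" "k \<le> J" using Suc.prems by auto
      have r: "fls_nth (fls_scal (A (Suc l)) * z (Suc k) l + fls_scal (B (Suc l)) * z (Suc k) (Suc (Suc l))
        - (fls_scal (C (Suc k)) * z (Suc (Suc k)) (Suc l) + fls_scal (D (Suc k)) * z k (Suc l))) (n - 1) \<in> ?I"
        using relR[of "Suc k" "Suc l"] kl by simp
      have b: "fls_nth (fls_scal (B (Suc l)) * z (Suc k) (Suc (Suc l))) (n - 1) \<in> ?I"
        using kl by (cases "l = J") (auto simp: top zero_closed intro!: zero lz val)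
      have cc: "fls_nth (fls_scal (C (Suc k)) * z (Suc (Suc k)) (Suc l)) (n - 1) \<in> ?I"
        using kl by (cases "Suc k = J") (auto simp: top zero_closed intro!: zero lz val)
      have dd: "fls_nth (fls_scal (D (Suc k)) * z k (Suc l)) (n - 1) \<in> ?I"
      proof -
        have "fls_nth (z k (Suc l)) n \<in> ?I" using Suc.prems by (intro Suc.IH) auto
        moreover have "fls_nth (fls_scal (D (Suc k)) * z k (Suc l)) (n - 1)
            - scal (fls_nth (D (Suc k)) (- 1)) * fls_nth (z k (Suc l)) n \<in> ?I"
          using kl by (intro coefficient_of_scalar_multiple[OF I] lz val)
        ultimately show ?thesis by (metis add_closed diff_add_cancel mult_left_closed)
      qed
      have "fls_nth (fls_scal (A (Suc l)) * z (Suc k) l) (n - 1) \<in> ?I"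
        using add_closed[OF diff_closed[OF r b] add_closed[OF cc dd]] by (simp add: algebra_simps)
      moreover have "fls_nth (fls_scal (A (Suc l)) * z (Suc k) l) (n - 1)
            - scal (fls_nth (A (Suc l)) (- 1)) * fls_nth (z (Suc k) l) n \<in> ?I"
        using kl by (intro coefficient_of_scalar_multiple[OF I] lz val)
      ultimately have "scal (fls_nth (A (Suc l)) (- 1)) * fls_nth (z (Suc k) l) n \<in> ?I"
        using diff_closed by (metis (no_types, lifting) diff_diff_eq2 add_diff_cancel_left')
      then show ?case using scal_cancel[OF I] lead(1)[of "Suc l"] kl by simp
    qed
    \<comment> \<open>the second relation, at \<open>l - 1\<close>, expresses \<open>z k l\<close> by \<open>z (k + 1) (l - 1)\<close>\<close>
    have upper: "fls_nth (z (J - i) l) n \<in> ?I" if "Suc J \<le> (J - i) + l" "l \<le> Suc J" "i < J" for i l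
      using that
    proof (induction i arbitrary: l)
      case 0
      then obtain l' where l': "l = Suc l'" "l' \<le> J" by (cases l) auto
      have r: "fls_nth ((if l' = 0 then 0 else fls_scal (A' l') * z J (l' - 1)) + fls_scal (B' l') * z J (Suc l')
        - (fls_scal (C' J) * z (Suc J) l' + fls_scal (D' J) * z (J - 1) l')) (n - 1) \<in> ?I"
        using relR'[of J l'] 0 l' by simp
      have a: "fls_nth (if l' = 0 then 0 else fls_scal (A' l') * z J (l' - 1)) (n - 1) \<in> ?I"
        using l' by (auto simp: zero_closed intro!: zero lz val)
      have dd: "fls_nth (fls_scal (D' J) * z (J - 1) l') (n - 1) \<in> ?I"
        using l' by (auto intro!: zero lz val)
      have "fls_nth (fls_scal (B' l') * z J (Suc l')) (n - 1) \<in> ?I"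
        using add_closed[OF diff_closed[OF r a] dd] by (simp add: algebra_simps top)
      moreover have "fls_nth (fls_scal (B' l') * z J (Suc l')) (n - 1)
            - scal (fls_nth (B' l') (- 1)) * fls_nth (z J (Suc l')) n \<in> ?I"
        using l' by (intro coefficient_of_scalar_multiple[OF I] lz val) auto
      ultimately have "scal (fls_nth (B' l') (- 1)) * fls_nth (z J (Suc l')) n \<in> ?I"
        using diff_closed by (metis (no_types, lifting) diff_diff_eq2 add_diff_cancel_left')
      then show ?case using scal_cancel[OF I] lead(2)[of "l'"] l' by simp
    next
      case (Suc i)
      define k where "k = J - Suc i"
      have k: "1 \<le> k" "k \<le> J" "Suc k = J - i" "Suc k \<le> J" using Suc.prems by (auto simp: k_def)
      then obtain l' where l': "l = Suc l'" "l' \<le> J" using Suc.prems by (cases l) auto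
      have r: "fls_nth ((if l' = 0 then 0 else fls_scal (A' l') * z k (l' - 1)) + fls_scal (B' l') * z k (Suc l')
        - (fls_scal (C' k) * z (Suc k) l' + fls_scal (D' k) * z (k - 1) l')) (n - 1) \<in> ?I"
        using relR'[of k l'] k l' by simp
      have a: "fls_nth (if l' = 0 then 0 else fls_scal (A' l') * z k (l' - 1)) (n - 1) \<in> ?I"
        using l' k by (auto simp: zero_closed intro!: zero lz val)
      have dd: "fls_nth (fls_scal (D' k) * z (k - 1) l') (n - 1) \<in> ?I"
        using l' k by (auto intro!: zero lz val)
      have cc: "fls_nth (fls_scal (C' k) * z (Suc k) l') (n - 1) \<in> ?I"
      proof -
        have "fls_nth (z (Suc k) l') n \<in> ?I"
          unfolding k(3) using Suc.prems l' k by (intro Suc.IH) (auto simp: k_def)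
        moreover have "fls_nth (fls_scal (C' k) * z (Suc k) l') (n - 1)
            - scal (fls_nth (C' k) (- 1)) * fls_nth (z (Suc k) l') n \<in> ?I"
          using k l' by (intro coefficient_of_scalar_multiple[OF I] lz val) auto
        ultimately show ?thesis by (metis add_closed diff_add_cancel mult_left_closed)
      qed
      have "fls_nth (fls_scal (B' l') * z k (Suc l')) (n - 1) \<in> ?I"
        using add_closed[OF diff_closed[OF r a] add_closed[OF cc dd]] by (simp add: algebra_simps)
      moreover have "fls_nth (fls_scal (B' l') * z k (Suc l')) (n - 1)
            - scal (fls_nth (B' l') (- 1)) * fls_nth (z k (Suc l')) n \<in> ?I"
        using k l' by (intro coefficient_of_scalar_multiple[OF I] lz val) auto
      ultimately have "scal (fls_nth (B' l') (- 1)) * fls_nth (z k (Suc l')) n \<in> ?I"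
        using diff_closed by (metis (no_types, lifting) diff_diff_eq2 add_diff_cancel_left')
      then show ?case using scal_cancel[OF I] lead(2)[of "l'"] l' by (simp add: k_def)
    qed
    show ?thesis
      unfolding low_def
    proof (intro allI impI)
      fix k l m assume kl: "k \<le> J" "l \<le> Suc J" and m: "m < n + 1"
      show "fls_nth (z k l) m \<in> ?I"
      proof (cases "m < n")
        case True
        then show ?thesis using kl by (intro lz)
      next
        case False
        then have m: "m = n" using m by simp
        show ?thesis
        proof (cases "k + l \<le> Suc J \<or> k = 0")
          case True
          then show ?thesis unfolding m using kl lower by auto
        next
          case False
          then show ?thesis unfolding m using upper[of "J - k" l] kl by simp
        qed
      qed
    qed
  qed
  \<comment> \<open>below the smallest subdegree all coefficients vanish, so the induction on the degree can start\<close>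
  define N where "N = Min ((\<lambda>(k, l). fls_subdegree (z k l)) ` ({..J} \<times> {..Suc J}))"
  have "low N" unfolding low_def
  proof (intro allI impI)
    fix k l m assume kl: "k \<le> J" "l \<le> Suc J" and "m < N"
    then have "m < fls_subdegree (z k l)"
      unfolding N_def by (subst (asm) Min_gr_iff) auto
    then show "fls_nth (z k l) m \<in> ?I" by (simp add: zero_closed)
  qed
  then have "low (N + int i)" for i
  proof (induction i)
    case (Suc i)
    have "low (N + int i + 1)" by (rule step[OF Suc.IH[OF Suc.prems]])
    then show ?case by (simp add: algebra_simps)
  qed simp
  then have "fls_nth (z k l) m \<in> ?I" for m
  proof -
    have "m < N + int (nat (m - N + 1))" by linarith
    then show ?thesis using \<open>\<And>i. low (N + int i)\<close> k l unfolding low_def by blast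
  qed
  then show ?thesis by (simp add: aq_null_def)
qed

section \<open>Fused K-operators intertwine the coideal generators\<close>

lemma lin_nz: "a \<noteq> 0 \<Longrightarrow> lin a \<noteq> 0"
  by (simp add: lin_def)

lemma lin_mult_const: "lin a * fls_const c = lin (a * c)"
  by (simp add: lin_def mult_ac flip: fls_const_mult_const)

lemma inverse_lin: "inverse (lin a) = fls_const (inverse a) * fls_X"
  by (simp add: lin_def fls_inverse_const fls_inverse_X_inv)

lemma lin_monomial_nth: "fls_nth (fls_const k * lin a * fls_const b) i = (if i = - 1 then k * a * b else 0)"
  by (simp add: lin_def mult.assoc)

lemma inverse_lin_monomial_nth:
  "fls_nth (fls_const k * inverse (lin a) * fls_const b) i = (if i = 1 then k * inverse a * b else 0)"
  by (simp add: inverse_lin mult.assoc)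

text \<open>
  At spin 0 the factor \<open>Rfac\<close> is the inverse of this entry, which therefore has to be nonzero at all spectral parameters of
  the recursion.
\<close>

lemma Rdiag_spectral_nz:
  assumes "a \<noteq> 0" "r \<noteq> 0" "c \<noteq> 0"
  shows "Rdiag r 0 ((lin a)^2 * fls_const c) 0 0 \<noteq> 0"
proof -
  have l: "(lin a)^2 * fls_const c = fls_const (a^2 * c) * fls_X_inv ^ 2"
    by (simp add: lin_def power_mult_distrib fls_const_power mult_ac flip: fls_const_mult_const)
  have i: "inverse (fls_const (a^2 * c) * fls_X_inv ^ 2) = fls_const (inverse (a^2 * c)) * fls_X ^ 2"
    by (simp add: fls_inverse_const fls_inverse_X_inv flip: power_inverse)
  have "fls_nth (Rdiag r 0 ((lin a)^2 * fls_const c) 0 0) (- 2) = a^2 * c * r"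
    unfolding Rdiag_def Let_def l i by (simp add: mult.commute[of _ "fls_const _"])
  then show ?thesis using assms by auto
qed

context spin_param
begin

lemma cp_2: "cp 2 = (if p = r then fls_const q else fls_const (inverse q))"
  "cp (- 2) = (if p = r then fls_const (inverse q) else fls_const q)"
  using q_p[of 1] q_p[of "- 1"] by (auto simp: cp_def power_int_minus split: if_splits)

lemma param_of_mult: "param_of (x * fls_const (r powi k)) = param_of x * cp k"
proof -
  have "p = inverse r" if "p \<noteq> r" using p_cases that by auto
  then show ?thesis
    unfolding param_of_def cp_def by (auto simp: fls_inverse_const power_int_inverse power_int_minus)
qed

lemma param_of_sq: "param_of (x^2 * fls_const (r powi k)) = param_of x * (param_of x * cp k)"
  unfolding param_of_mult by (simp add: param_of_def power2_eq_square mult.assoc)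

definition Wgen :: "free_alg fls" where
  "Wgen = (if p = r then W0 else W1)"

abbreviation opMq where "opMq \<equiv> fusion.opM q p fls_scal Wgen"

text \<open>
  The fused K-operator at \<open>a u\<close> intertwines the coactions at \<open>v\<close> and at \<open>v\<^sup>-\<^sup>1\<close>. The coaction contains the generator, so
  this is stated for the action on arbitrary vectors with entries in the noncommutative ring.
\<close>

definition intertwining :: "complex \<Rightarrow> complex \<Rightarrow> nat \<Rightarrow> complex \<Rightarrow> bool" where
  "intertwining kp km J a \<longleftrightarrow> (\<forall>\<phi> n. n \<le> J \<longrightarrow>
     (\<Sum>m\<le>J. Kop q r kp km J (lin a) $$ (n, m) *
        opMq J (fls_const kp * param_of (lin a)) (fls_const km * inverse (param_of (lin a))) \<phi> m)
     - opMq J (fls_const kp * inverse (param_of (lin a))) (fls_const km * param_of (lin a))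
        (\<lambda>n. \<Sum>m\<le>J. Kop q r kp km J (lin a) $$ (n, m) * \<phi> m) n \<in> aq_null q kp km)"

lemma fusionI: "v \<noteq> 0 \<Longrightarrow> fusion q r p v (inverse v) fls_scal (aq_null q kp km)"
  by (intro fusion.intro spin_spectral.intro spin_spectral_axioms.intro spin_param_axioms
      two_sided_ideal_aq_null fls_scal.central_scalars_axioms) simp

lemma param_of_nz: "x \<noteq> 0 \<Longrightarrow> param_of x \<noteq> 0"
  by (simp add: param_of_def)

lemma Kop_half_intertwines:
  assumes nz: "kp \<noteq> 0" "km \<noteq> 0" "a \<noteq> 0"
  defines "K \<equiv> Kop_half q kp km (lin a)" and "y \<equiv> param_of (lin a)" and "w \<equiv> Wgen"
  shows "fls_scal (cp 2) * (K $$ (0,0) * w) + fls_scal (fls_const km * inverse y) * K $$ (0,1)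
      - (fls_scal (cp 2) * (w * K $$ (0,0)) + fls_scal (fls_const kp * inverse y) * K $$ (1,0)) \<in> aq_null q kp km" (is ?A)
    and "fls_scal (cp (- 2)) * (K $$ (0,1) * w) + fls_scal (fls_const kp * y) * K $$ (0,0)
      - (fls_scal (cp 2) * (w * K $$ (0,1)) + fls_scal (fls_const kp * inverse y) * K $$ (1,1)) \<in> aq_null q kp km" (is ?B)
    and "fls_scal (cp 2) * (K $$ (1,0) * w) + fls_scal (fls_const km * inverse y) * K $$ (1,1)
      - (fls_scal (cp (- 2)) * (w * K $$ (1,0)) + fls_scal (fls_const km * y) * K $$ (0,0)) \<in> aq_null q kp km" (is ?C)
    and "fls_scal (cp (- 2)) * (K $$ (1,1) * w) + fls_scal (fls_const kp * y) * K $$ (1,0)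
      - (fls_scal (cp (- 2)) * (w * K $$ (1,1)) + fls_scal (fls_const km * y) * K $$ (0,1)) \<in> aq_null q kp km" (is ?D)
proof -
  interpret N: two_sided_ideal "aq_null q kp km" by (rule two_sided_ideal_aq_null)
  note rel = Kop_half_relations[OF nz, folded K_def]
  define D where "D = sc kp * K $$ (1,0) - sc km * K $$ (0,1)"
  have y_nz: "y \<noteq> 0" using nz by (simp add: y_def param_of_nz lin_nz)
  have c22: "cp 2 * cp (- 2) = 1" "cp (- 2) * cp 2 = 1" by (simp_all add: cp_mult)
  have 1: "w * K $$ (0,0) - K $$ (0,0) * w + fls_scal (inverse y * cp (- 2)) * D \<in> aq_null q kp km"
    using rel(1,5) unfolding w_def Wgen_def y_def param_of_def cp_2 D_def by auto
  have 2: "w * K $$ (1,1) - K $$ (1,1) * w - fls_scal (y * cp 2) * D \<in> aq_null q kp km"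
    using rel(2,6) unfolding w_def Wgen_def y_def param_of_def cp_2 D_def by auto
  have 3: "fls_scal (cp 2) * (w * K $$ (0,1)) - fls_scal (cp (- 2)) * (K $$ (0,1) * w)
      - sc kp * (fls_scal y * K $$ (0,0) - fls_scal (inverse y) * K $$ (1,1)) \<in> aq_null q kp km"
  proof (cases "p = r")
    case True
    then show ?thesis using rel(3) unfolding w_def Wgen_def y_def param_of_def cp_2 by simp
  next
    case False
    then show ?thesis using N.uminus_closed[OF rel(7)] unfolding w_def Wgen_def y_def param_of_def cp_2
      by (simp add: algebra_simps)
  qed
  have 4: "fls_scal (cp 2) * (K $$ (1,0) * w) - fls_scal (cp (- 2)) * (w * K $$ (1,0))
      - sc km * (fls_scal y * K $$ (0,0) - fls_scal (inverse y) * K $$ (1,1)) \<in> aq_null q kp km"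
  proof (cases "p = r")
    case True
    then show ?thesis using rel(4) unfolding w_def Wgen_def y_def param_of_def cp_2 by simp
  next
    case False
    then show ?thesis using N.uminus_closed[OF rel(8)] unfolding w_def Wgen_def y_def param_of_def cp_2
      by (simp add: algebra_simps)
  qed
  have "fls_scal (cp 2) * (K $$ (0,0) * w) + fls_scal (fls_const km * inverse y) * K $$ (0,1)
      - (fls_scal (cp 2) * (w * K $$ (0,0)) + fls_scal (fls_const kp * inverse y) * K $$ (1,0))
     = - (fls_scal (cp 2) * (w * K $$ (0,0) - K $$ (0,0) * w + fls_scal (inverse y * cp (- 2)) * D))"
    by (simp add: D_def right_diff_distrib distrib_left fls_scal.emb_assoc mult.assoc mult.left_commute[of "cp 2"] c22
        mult.commute[of _ "fls_const _"])
  then show ?A using N.uminus_closed[OF N.mult_left_closed[OF 1]] by (simp only:)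
  have "fls_scal (cp (- 2)) * (K $$ (1,1) * w) + fls_scal (fls_const kp * y) * K $$ (1,0)
      - (fls_scal (cp (- 2)) * (w * K $$ (1,1)) + fls_scal (fls_const km * y) * K $$ (0,1))
     = - (fls_scal (cp (- 2)) * (w * K $$ (1,1) - K $$ (1,1) * w - fls_scal (y * cp 2) * D))"
    by (simp add: D_def right_diff_distrib distrib_left fls_scal.emb_assoc mult.assoc mult.left_commute[of "cp (- 2)"] c22
        mult.commute[of _ "fls_const _"])
  then show ?D using N.uminus_closed[OF N.mult_left_closed[OF 2]] by (simp only:)
  have "fls_scal (cp (- 2)) * (K $$ (0,1) * w) + fls_scal (fls_const kp * y) * K $$ (0,0)
      - (fls_scal (cp 2) * (w * K $$ (0,1)) + fls_scal (fls_const kp * inverse y) * K $$ (1,1))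
     = - (fls_scal (cp 2) * (w * K $$ (0,1)) - fls_scal (cp (- 2)) * (K $$ (0,1) * w)
      - sc kp * (fls_scal y * K $$ (0,0) - fls_scal (inverse y) * K $$ (1,1)))"
    by (simp add: right_diff_distrib fls_scal.emb_assoc)
  then show ?B using N.uminus_closed[OF 3] by (simp only:)
  have "fls_scal (cp 2) * (K $$ (1,0) * w) + fls_scal (fls_const km * inverse y) * K $$ (1,1)
      - (fls_scal (cp (- 2)) * (w * K $$ (1,0)) + fls_scal (fls_const km * y) * K $$ (0,0))
     = fls_scal (cp 2) * (K $$ (1,0) * w) - fls_scal (cp (- 2)) * (w * K $$ (1,0))
      - sc km * (fls_scal y * K $$ (0,0) - fls_scal (inverse y) * K $$ (1,1))"
    by (simp add: right_diff_distrib fls_scal.emb_assoc)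
  then show ?C using 4 by (simp only:)
qed

lemma intertwining_spin_0: "intertwining kp km 0 a"
proof -
  interpret N: two_sided_ideal "aq_null q kp km" by (rule two_sided_ideal_aq_null)
  interpret F: fusion q r p 0 1 1 "fls_const kp" "fls_const km" fls_scal "aq_null q kp km" Wgen
    using fusionI[of 1] by simp
  have "be 0 (Suc 0) = 0" using be_Suc[of 0] .
  then show ?thesis
    unfolding intertwining_def Kop_def by (simp add: F.opM_def N.zero_closed)
qed

text \<open>
  The spectral parameters of the two K-operators and of the R-matrix in the recursion are those for which the
  coaction parameters of consecutive factors agree.
\<close>

lemma fused_step_intertwines:
  assumes nz: "kp \<noteq> 0" "km \<noteq> 0" "a \<noteq> 0" and IH: "intertwining kp km J (a * r)" and b: "b < 2" "n \<le> J"
  defines "v \<equiv> param_of (lin a)"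
  shows "two_sided_ideal.cong_mod (aq_null q kp km)
    (fusion_step fls_scal q r J (Kop_half q kp km (lin (a * r powi (- int J)))) (Kop q r kp km J (lin (a * r)))
       ((lin a)^2 * fls_const (r powi (1 - int J)))
       (opMq (Suc J) (fls_const kp * v) (fls_const km * inverse v) \<phi>) b n)
    (fusion.opL q p J fls_scal Wgen (fls_const kp * inverse v * cp (int J)) (fls_const km * v * cp (- int J))
       (fls_const kp * inverse v * cp (- 1)) (fls_const km * v * cp 1)
       (fusion_step fls_scal q r J (Kop_half q kp km (lin (a * r powi (- int J)))) (Kop q r kp km J (lin (a * r)))
       ((lin a)^2 * fls_const (r powi (1 - int J))) \<phi>) b n)"
proof -
  have v: "v \<noteq> 0" using nz by (simp add: v_def param_of_nz lin_nz)
  interpret F: fusion q r p J v "inverse v" "fls_const kp" "fls_const km" fls_scal "aq_null q kp km" Wgen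
    by (rule fusionI[OF v])
  have p1: "param_of (lin (a * r powi (- int J))) = v * cp (- int J)"
    unfolding lin_mult_const[symmetric] param_of_mult v_def ..
  have p2: "param_of (lin (a * r)) = v * cp 1"
    using param_of_mult[of "lin a" 1] by (simp add: v_def lin_mult_const)
  have i1: "inverse (v * cp (- int J)) = inverse v * cp (int J)"
    and i2: "inverse (v * cp 1) = inverse v * cp (- 1)"
    by (simp_all add: cp_expand(3))
  have nz1: "a * r powi (- int J) \<noteq> 0" using nz r_nz by simp
  note half = Kop_half_intertwines[OF nz(1,2) nz1, unfolded p1 i1]
  show ?thesis
  proof (rule F.fusion_step_intertwines)
    show "(lin a)^2 * fls_const (r powi (1 - int J)) \<noteq> 0" using nz r_nz by (simp add: lin_nz)
    show "param_of ((lin a)^2 * fls_const (r powi (1 - int J))) = v * (v * cp (1 - int J))"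
      unfolding param_of_sq v_def ..
    show "F.cong_mod (\<Sum>m\<le>J. Kop q r kp km J (lin (a * r)) $$ (n, m) *
        opMq J (fls_const kp * v * cp 1) (fls_const km * inverse v * cp (- 1)) \<phi> m)
      (opMq J (fls_const kp * inverse v * cp (- 1)) (fls_const km * v * cp 1)
        (\<lambda>n. \<Sum>m\<le>J. Kop q r kp km J (lin (a * r)) $$ (n, m) * \<phi> m) n)" if "n \<le> J" for \<phi> n
      using IH that unfolding intertwining_def p2 i2 F.cong_mod_def by (simp add: mult.assoc)
  qed (use half b in \<open>simp_all add: F.cong_mod_def mult.assoc\<close>)
qed

end

lemma lin_nth: "fls_nth (lin a) i = (if i = - 1 then a else 0)"
  using lin_monomial_nth[of 1 a 1 i] by simp

lemma inverse_lin_nth: "fls_nth (inverse (lin a)) i = (if i = 1 then inverse a else 0)"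
  using inverse_lin_monomial_nth[of 1 a 1 i] by simp

context fusion
begin

lemma Fop_step_linear:
  assumes "i \<le> Suc J"
  shows "Fop emb q J (fusion_step emb q r J K Y x \<phi>) i
    = (\<Sum>l\<le>Suc J. Fop emb q J (fusion_step emb q r J K Y x (unitv l)) i * \<phi> l)"
proof -
  have a: "emb (fls_const (Fa q J i)) * fusion_step emb q r J K Y x \<phi> 0 i
    = (\<Sum>l\<le>Suc J. emb (fls_const (Fa q J i)) * fusion_step emb q r J K Y x (unitv l) 0 i * \<phi> l)"
  proof (cases "i = Suc J")
    case False
    then show ?thesis using assms fusion_step_linear[of 0 i K Y x \<phi>]
      by (simp add: sum_distrib_left mult.assoc del: sum.atMost_Suc)
  qed (simp add: Fa_def)
  have b: "emb (fls_const (Fb q J i)) * fusion_step emb q r J K Y x \<phi> 1 (i - 1)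
    = (\<Sum>l\<le>Suc J. emb (fls_const (Fb q J i)) * fusion_step emb q r J K Y x (unitv l) 1 (i - 1) * \<phi> l)"
    using assms fusion_step_linear[of 1 "i - 1" K Y x \<phi>]
    by (simp add: sum_distrib_left mult.assoc del: sum.atMost_Suc)
  show ?thesis
    unfolding Fop_def a b by (simp add: sum.distrib distrib_right del: sum.atMost_Suc)
qed

lemma opM_eqI:
  assumes "\<And>n. n \<le> L \<Longrightarrow> f n = g n" "i \<le> L"
  shows "opM L b c f i = opM L b c g i"
proof -
  have "emb (b * be L (Suc i)) * f (Suc i) = emb (b * be L (Suc i)) * g (Suc i)"
    using assms by (cases "i = L") auto
  then show ?thesis using assms unfolding opM_def by simp
qed

end

context generic_q
begin

abbreviation (input) "Kstep kp km J a \<equiv> fusion_step fls_scal q r J (Kop_half q kp km (lin (a * r powi (- int J))))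
   (Kop q r kp km J (lin (a * r))) ((lin a)^2 * fls_const (r powi (1 - int J)))"

lemma Kop_Suc_index:
  assumes "a \<noteq> 0" "i \<le> Suc J" "k \<le> Suc J"
  shows "Kop q r kp km (Suc J) (lin a) $$ (i, k) = Fop fls_scal q J (Kstep kp km J a (\<lambda>n. if n = k then 1 else 0)) i"
  unfolding Kop_def
  by (subst fused_Suc_index)
    (use assms r_nz in \<open>simp_all add: fls_scal.emb_mult Kop_half_carrier Rdiag_spectral_nz lin_mult_const\<close>)

end

context spin_param
begin

lemma intertwining_SucI:
  assumes a: "a \<noteq> 0"
    and H: "\<And>\<phi> i. i \<le> Suc J \<Longrightarrow> two_sided_ideal.cong_mod (aq_null q kp km)
      (Fop fls_scal q J (Kstep kp km J a (opMq (Suc J) (fls_const kp * param_of (lin a)) (fls_const km * inverse (param_of (lin a))) \<phi>)) i)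
      (opMq (Suc J) (fls_const kp * inverse (param_of (lin a))) (fls_const km * param_of (lin a))
         (Fop fls_scal q J (Kstep kp km J a \<phi>)) i)"
  shows "intertwining kp km (Suc J) a"
proof -
  have v: "param_of (lin a) \<noteq> 0" using a by (simp add: param_of_nz lin_nz)
  interpret F: fusion q r p J "param_of (lin a)" "inverse (param_of (lin a))" "fls_const kp" "fls_const km" fls_scal "aq_null q kp km" Wgen
    by (rule fusionI[OF v])
  have S: "(\<Sum>m\<le>Suc J. Kop q r kp km (Suc J) (lin a) $$ (i, m) * g m) = Fop fls_scal q J (Kstep kp km J a g) i"
    if "i \<le> Suc J" for i g
    unfolding F.Fop_step_linear[OF that, of _ _ _ g]
    using Kop_Suc_index[OF a that] by (intro sum.cong) (simp_all add: F.unitv_def[abs_def])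
  show ?thesis
    unfolding intertwining_def
  proof (intro allI impI)
    fix \<phi> n assume n: "n \<le> Suc J"
    have "opMq (Suc J) b c (\<lambda>n. \<Sum>m\<le>Suc J. Kop q r kp km (Suc J) (lin a) $$ (n, m) * \<phi> m) n
      = opMq (Suc J) b c (Fop fls_scal q J (Kstep kp km J a \<phi>)) n" for b c
      by (rule F.opM_eqI[OF S n])
    then show "(\<Sum>m\<le>Suc J. Kop q r kp km (Suc J) (lin a) $$ (n, m) *
        opMq (Suc J) (fls_const kp * param_of (lin a)) (fls_const km * inverse (param_of (lin a))) \<phi> m)
     - opMq (Suc J) (fls_const kp * inverse (param_of (lin a))) (fls_const km * param_of (lin a))
        (\<lambda>n. \<Sum>m\<le>Suc J. Kop q r kp km (Suc J) (lin a) $$ (n, m) * \<phi> m) n \<in> aq_null q kp km"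
      using H[OF n, of \<phi>] unfolding S[OF n] F.cong_mod_def by (simp only:)
  qed
qed

lemma cp_nth: "fls_nth (cp k) i = (if i = 0 then p powi k else 0)"
  by (simp add: cp_def)

lemma be_const: "be L n = fls_const (bq q L n * p powi (int L + 1 - 2 * int n))"
  by (simp add: be_def cp_def)

end

context fusion
begin

text \<open>
  Only the order in \<open>u\<close> of these coefficients matters for the defect.
\<close>

lemma xi_const: "\<exists>b. xi k = kp * iv * fls_const b"
proof -
  have "xi k = kp * iv * (cp (- 1) * be J (Suc k) * (qn (int k) / qn (int (Suc k))))"
    by (simp add: xi_def mult.assoc)
  then show ?thesis unfolding cp_def be_const qn_def fls_const_divide_const fls_const_mult_const by blast
qed

lemma xi'_const: "\<exists>b. xi' k = km * v * fls_const b"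
proof -
  have "xi' k = km * v * (cp 1 * (bb J k * cp (int J + 3 - 2 * int k)))"
    by (simp add: xi'_def mult.assoc)
  then show ?thesis unfolding cp_def fls_const_mult_const by blast
qed

lemma xi_top: "xi J = 0"
  by (simp add: xi_def)

end

context generic_q
begin

lemma r_neq_inverse: "r \<noteq> inverse r"
proof
  assume "r = inverse r"
  then have "r ^ 2 = 1" using r_nz by (metis power2_eq_square right_inverse)
  then show False using r_sq q_power[of 1] by simp
qed

text \<open>
  The induction treats \<open>W\<^sub>0\<close> and \<open>W\<^sub>1\<close> simultaneously, because the vanishing of the defect uses both relations. The
  raising part of the coaction of \<open>W\<^sub>0\<close> and the lowering part of that of \<open>W\<^sub>1\<close> are the ones of order \<open>u\<close>.
\<close>

theorem Kop_intertwines: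
  assumes nz: "kp \<noteq> 0" "km \<noteq> 0" and a: "a \<noteq> 0"
  shows "spin_param.intertwining q r r kp km J a \<and> spin_param.intertwining q r (inverse r) kp km J a"
  using a
proof (induction J arbitrary: a)
  case 0
  interpret P: spin_param q r r by unfold_locales simp
  interpret M: spin_param q r "inverse r" by unfold_locales simp
  show ?case using P.intertwining_spin_0 M.intertwining_spin_0 by simp
next
  case (Suc J)
  interpret P: spin_param q r r by unfold_locales simp
  interpret M: spin_param q r "inverse r" by unfold_locales simp
  have ar: "a * r \<noteq> 0" using Suc.prems r_nz by simp
  note IH = Suc.IH[OF ar]
  have pv: "P.param_of (lin a) = lin a" "M.param_of (lin a) = inverse (lin a)"
    using r_neq_inverse by (auto simp: P.param_of_def M.param_of_def)
  have l: "lin a \<noteq> 0" "inverse (lin a) \<noteq> 0" using Suc.prems by (simp_all add: lin_nz)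
  have wg: "\<exists>g. P.Wgen = fls_const g" "\<exists>g. M.Wgen = fls_const g"
    by (auto simp: P.Wgen_def M.Wgen_def)
  interpret FP: fusion q r r J "lin a" "inverse (lin a)" "fls_const kp" "fls_const km" fls_scal "aq_null q kp km" P.Wgen
    by (rule P.fusionI[OF l(1)])
  interpret FM: fusion q r "inverse r" J "inverse (lin a)" "lin a" "fls_const kp" "fls_const km" fls_scal "aq_null q kp km" M.Wgen
    using M.fusionI[OF l(2)] by simp
  note XP = P.fused_step_intertwines[OF nz Suc.prems conjunct1[OF IH], unfolded pv]
  note XM = M.fused_step_intertwines[OF nz Suc.prems conjunct2[OF IH], unfolded pv inverse_inverse_eq]
  \<comment> \<open>the defect is the same for both generators, as the forms \<open>defect_form\<close> are independent of \<open>p\<close>\<close>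
  define z where "z = (\<lambda>k l. FP.defect_form (Kstep kp km J a (FP.unitv l)) k)"
  note relP = FP.defect_relation[OF XP _ _ _ z_def, unfolded FP.cong_mod_def]
  note relM = FM.defect_relation[OF XM _ _ _ z_def, unfolded FP.cong_mod_def]
  have nthP: "fls_nth (FP.al * P.be L n) i = (if i = - 1 then kp * a * (bq q L n * r powi (int L + 1 - 2 * int n)) else 0)"
    "fls_nth (FP.ga * P.be L n) i = (if i = 1 then km * inverse a * (bq q L n * r powi (int L + 1 - 2 * int n)) else 0)" for L n i
    unfolding P.be_const lin_monomial_nth inverse_lin_monomial_nth by simp_all
  have nthM: "fls_nth (FM.al * M.be L n) i = (if i = 1 then kp * inverse a * (bq q L n * inverse r powi (int L + 1 - 2 * int n)) else 0)"
    "fls_nth (FM.ga * M.be L n) i = (if i = - 1 then km * a * (bq q L n * inverse r powi (int L + 1 - 2 * int n)) else 0)" for L n i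
    unfolding M.be_const lin_monomial_nth inverse_lin_monomial_nth by simp_all
  have xiP: "i \<le> - 1 \<Longrightarrow> fls_nth (FP.xi k) i = 0" "i < - 1 \<Longrightarrow> fls_nth (FP.xi' k) i = 0" for k i
    using FP.xi_const[of k] FP.xi'_const[of k] by (auto simp: lin_nth inverse_lin_nth)
  have xiM: "i < - 1 \<Longrightarrow> fls_nth (FM.xi k) i = 0" "i \<le> - 1 \<Longrightarrow> fls_nth (FM.xi' k) i = 0" for k i
    using FM.xi_const[of k] FM.xi'_const[of k] by (auto simp: lin_nth inverse_lin_nth)
  have z: "z k l \<in> aq_null q kp km" if kl: "k \<le> J" "l \<le> Suc J" for k l
  proof (rule bigraded_defect_vanishes[OF relP relM wg])
    show "fls_nth (FP.al * P.be (Suc J) l) (- 1) \<noteq> 0" if "1 \<le> l" "l \<le> Suc J" for l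
      unfolding nthP using nz Suc.prems r_nz bq_nz[OF that] by simp
    show "fls_nth (FM.ga * M.be (Suc J) (Suc l)) (- 1) \<noteq> 0" if "l \<le> J" for l
      unfolding nthM using nz Suc.prems r_nz bq_nz[of "Suc l" "Suc J"] that by simp
    show "z 0 l = 0" for l by (simp add: z_def)
  qed (use kl in \<open>simp_all add: P.cp_nth M.cp_nth P.cp_mult M.cp_mult nthP nthM xiP xiM FP.xi_top FM.xi_top\<close>)
  have P: "P.intertwining kp km (Suc J) a"
  proof (rule P.intertwining_SucI[OF Suc.prems], unfold pv)
    fix \<phi> i assume i: "i \<le> Suc J"
    show "two_sided_ideal.cong_mod (aq_null q kp km)
      (Fop fls_scal q J (Kstep kp km J a (P.opMq (Suc J) (fls_const kp * lin a) (fls_const km * inverse (lin a)) \<phi>)) i)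
      (P.opMq (Suc J) (fls_const kp * inverse (lin a)) (fls_const km * lin a) (Fop fls_scal q J (Kstep kp km J a \<phi>)) i)"
      by (rule FP.fused_intertwines[OF XP z[unfolded z_def] i])
  qed
  have M: "M.intertwining kp km (Suc J) a"
  proof (rule M.intertwining_SucI[OF Suc.prems], unfold pv inverse_inverse_eq)
    fix \<phi> i assume i: "i \<le> Suc J"
    show "two_sided_ideal.cong_mod (aq_null q kp km)
      (Fop fls_scal q J (Kstep kp km J a (M.opMq (Suc J) (fls_const kp * inverse (lin a)) (fls_const km * lin a) \<phi>)) i)
      (M.opMq (Suc J) (fls_const kp * lin a) (fls_const km * inverse (lin a)) (Fop fls_scal q J (Kstep kp km J a \<phi>)) i)"
      by (rule FM.fused_intertwines[OF XM z[unfolded z_def] i])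
  qed
  show ?case using P M ..
qed

end

section \<open>Diagonal K-matrices\<close>

context spin_spectral
begin

text \<open>
  The factor \<open>Lr\<close> of the ratio below, in powers of \<open>p\<close> and with the spectral parameter and its inverse as separate
  arguments.
\<close>

definition Lf :: "complex fls \<Rightarrow> complex fls \<Rightarrow> int \<Rightarrow> complex fls \<Rightarrow> complex fls \<Rightarrow> complex fls" where
  "Lf ep em m y iy = em * (cp m * y) + ep * (cp (- m) * iy)"

text \<open>
  These two identities are the fusion of a diagonal K-matrix on the two components of a column of \<open>E\<close>: both give the
  same factor times the original component, so the product maps each column of \<open>E\<close> to a multiple of itself.
\<close>

lemma diagonal_fusion_upper:
  "(v * (v * cp (2 - 2 * int k)) - iv * (iv * cp (2 * int k - 2))) * Lf ep em (2 * int k - 1 - int J) (v * cp 1) (iv * cp (- 1))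
   + (cp (2 * int k) - cp (- 2 * int k)) * Lf ep em (2 * int k - 1 - int J) (iv * cp (- 1)) (v * cp 1)
   = (v * (v * cp 2) - iv * (iv * cp (- 2))) * (em * (v * cp (- int J)) + ep * (iv * cp (int J)))"
  unfolding Lf_def
  by (simp add: monomials, (simp add: algebra_simps power_numeral_reduce)?)

lemma diagonal_fusion_lower:
  "(v * (v * cp (2 * int k - 2 * int J)) - iv * (iv * cp (2 * int J - 2 * int k))) * Lf ep em (2 * int k - 1 - int J) (iv * cp (- 1)) (v * cp 1)
   + (cp (2 * (int J + 1 - int k)) - cp (- 2 * (int J + 1 - int k))) * Lf ep em (2 * int k - 1 - int J) (v * cp 1) (iv * cp (- 1))
   = (v * (v * cp 2) - iv * (iv * cp (- 2))) * (ep * (v * cp (- int J)) + em * (iv * cp (int J)))"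
  unfolding Lf_def
  by (simp add: monomials, (simp add: algebra_simps power_numeral_reduce)?)

lemma Roff_EB: "k \<le> Suc J \<Longrightarrow> Roff q J k * EB k = sg * ((cp (2 * int k) - cp (- 2 * int k)) * EA k)"
  unfolding qn_eq[symmetric] Roff_eq using bb_EB[of k] by (simp add: mult.assoc del: fls_const_mult_const)

lemma Roff_EA: "1 \<le> k \<Longrightarrow> k \<le> Suc J \<Longrightarrow> Roff q J k * EA k = sg * ((cp (2 * (int J + 1 - int k)) - cp (- 2 * (int J + 1 - int k))) * EB k)"
proof -
  assume k: "1 \<le> k" "k \<le> Suc J"
  have nz: "qn (int k) \<noteq> 0" using qnum_nz[of k] k by (simp add: qn_def)
  have "qn (int k) * (bb J k * EA k) = bb J k * bb J k * EB k"
    using bb_EB[OF k(2)] by (simp add: ac_simps del: fls_const_mult_const)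
  then have "qn (int k) * (bb J k * EA k) = qn (int k) * (qn (int J + 1 - int k) * EB k)"
    unfolding bq_square by (simp add: mult.assoc)
  then have "bb J k * EA k = qn (int J + 1 - int k) * EB k" using nz by simp
  then show ?thesis unfolding qn_eq[symmetric] Roff_eq by (simp add: mult.assoc del: fls_const_mult_const)
qed

end

lemma Rdiag_inverse_spectral_nz:
  assumes "a \<noteq> 0" "r \<noteq> 0" "c \<noteq> 0"
  shows "Rdiag r 0 ((inverse (lin a))^2 * fls_const c) 0 0 \<noteq> 0"
proof -
  have "Rdiag r 0 ((inverse (lin a))^2 * fls_const c) 0 0 = - Rdiag (inverse r) 0 ((lin a)^2 * fls_const (inverse c)) 0 0"
    using assms by (simp add: Rdiag_def Let_def power_inverse fls_inverse_const power_int_minus flip: fls_inverse_const)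
  then show ?thesis using Rdiag_spectral_nz[of a "inverse r" "inverse c"] assms by simp
qed

lemma Ksc_half_index:
  "Ksc_half q ep em kp km x $$ (0, 0) = x * fls_const ep + inverse x * fls_const em"
  "Ksc_half q ep em kp km x $$ (0, Suc 0) = fls_const (kp / (q - inverse q)) * cfun (x^2)"
  "Ksc_half q ep em kp km x $$ (Suc 0, 0) = fls_const (km / (q - inverse q)) * cfun (x^2)"
  "Ksc_half q ep em kp km x $$ (Suc 0, Suc 0) = x * fls_const em + inverse x * fls_const ep"
  by (simp_all add: Ksc_half_def mat_of_rows_list_def)

lemma Ksc_half_carrier: "Ksc_half q ep em kp km x \<in> carrier_mat 2 2"
  by (rule carrier_matI) (simp_all add: Ksc_half_def mat_of_rows_list_def)

lemma inverse_lin_mult_const: "c \<noteq> 0 \<Longrightarrow> inverse (lin a) * fls_const c = inverse (lin (a * inverse c))"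
  by (simp add: inverse_lin mult_ac flip: fls_const_mult_const)

context generic_q
begin

lemma Ksc_Suc_index:
  assumes "a \<noteq> 0" "i \<le> Suc J" "k \<le> Suc J"
  shows "Ksc q r ep em kp km (Suc J) (inverse (lin a)) $$ (i, k) = Fop (\<lambda>f. f) q J
    (fusion_step (\<lambda>f. f) q r J (Ksc_half q ep em kp km (inverse (lin a) * fls_const (r powi (- int J))))
      (Ksc q r ep em kp km J (inverse (lin (a * inverse r)))) ((inverse (lin a))^2 * fls_const (r powi (1 - int J)))
      (\<lambda>n. if n = k then 1 else 0)) i"
  unfolding Ksc_def
  by (subst fused_Suc_index)
    (use assms r_nz in \<open>simp_all add: Ksc_half_carrier Rdiag_inverse_spectral_nz inverse_lin_mult_const\<close>)

text \<open>
  The factor \<open>em q\<^bsup>m/2\<^esup> x + ep q\<^bsup>-m/2\<^esup> x\<^sup>-\<^sup>1\<close>. Its values at \<open>x\<close> and \<open>x\<^sup>-\<^sup>1\<close> give the ratio of neighbouring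
  diagonal entries.
\<close>

definition Lr :: "complex \<Rightarrow> complex \<Rightarrow> int \<Rightarrow> complex fls \<Rightarrow> complex fls" where
  "Lr ep em m x = fls_const em * (fls_const (r powi m) * x) + fls_const ep * (fls_const (r powi (- m)) * inverse x)"

lemma Lr_inverse_lin_nz:
  assumes "ep \<noteq> 0 \<or> em \<noteq> 0" "a \<noteq> 0"
  shows "Lr ep em m (inverse (lin a)) \<noteq> 0"
proof -
  have "fls_nth (Lr ep em m (inverse (lin a))) 1 = em * r powi m * inverse a"
    "fls_nth (Lr ep em m (inverse (lin a))) (- 1) = ep * r powi (- m) * a"
    by (simp_all add: Lr_def lin_nth inverse_lin_nth)
  then show ?thesis using assms r_nz by auto
qed

lemma Lr_lin_nz:
  assumes "ep \<noteq> 0 \<or> em \<noteq> 0" "a \<noteq> 0"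
  shows "Lr ep em m (lin a) \<noteq> 0"
proof -
  have "fls_nth (Lr ep em m (lin a)) 1 = ep * r powi (- m) * inverse a"
    "fls_nth (Lr ep em m (lin a)) (- 1) = em * r powi m * a"
    by (simp_all add: Lr_def lin_nth inverse_lin_nth)
  then show ?thesis using assms r_nz by auto
qed

text \<open>
  By induction. If the entries at spin \<open>J/2\<close> satisfy the ratios, each entry can be written in two ways as a multiple of
  a factor \<open>Lr\<close>, with multiples \<open>c k\<close> and \<open>c (k + 1)\<close>; the new diagonal entries turn out to be proportional to the
  \<open>c k\<close>, and this yields the new ratios.
\<close>

theorem Ksc_diagonal:
  assumes e: "ep \<noteq> 0 \<or> em \<noteq> 0" and a: "a \<noteq> 0"
  shows "(\<forall>i\<le>J. \<forall>k\<le>J. i \<noteq> k \<longrightarrow> Ksc q r ep em 0 0 J (inverse (lin a)) $$ (i, k) = 0) \<and>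
    (\<forall>i<J. Ksc q r ep em 0 0 J (inverse (lin a)) $$ (i, i) * Lr ep em (2 * int i + 1 - int J) (inverse (lin a))
      = Ksc q r ep em 0 0 J (inverse (lin a)) $$ (Suc i, Suc i) * Lr ep em (2 * int i + 1 - int J) (lin a))"
  using a
proof (induction J arbitrary: a)
  case 0
  then show ?case by simp
next
  case (Suc J)
  define x where "x = inverse (lin a)"
  define x2 where "x2 = inverse (lin (a * inverse r))"
  have a2: "a * inverse r \<noteq> 0" using Suc.prems r_nz by simp
  have x: "x \<noteq> 0" "inverse x = lin a" using Suc.prems by (simp_all add: x_def lin_nz)
  define Y where "Y = Ksc q r ep em 0 0 J x2"
  interpret P: spin_param q r r by unfold_locales simp
  interpret S: spin_spectral q r r J x "inverse x" 0 0 by unfold_locales (rule right_inverse[OF x(1)])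
  have x2: "x2 = x * P.cp 1" "inverse x2 = inverse x * P.cp (- 1)"
  proof -
    show 1: "x2 = x * P.cp 1"
      using r_nz Suc.prems by (simp add: x2_def x_def P.cp_def inverse_lin_mult_const)
    show "inverse x2 = inverse x * P.cp (- 1)" unfolding 1 by (simp add: P.cp_expand(3))
  qed
  have Y0: "Y $$ (i, k) = 0" if "i \<le> J" "k \<le> J" "i \<noteq> k" for i k
    using Suc.IH[OF a2] that by (simp add: Y_def x2_def)
  have Yr: "Y $$ (i, i) * Lr ep em (2 * int i + 1 - int J) x2 = Y $$ (Suc i, Suc i) * Lr ep em (2 * int i + 1 - int J) (inverse x2)"
    if "i < J" for i
    using Suc.IH[OF a2] that by (simp add: Y_def x2_def)
  have Lnz: "Lr ep em m x2 \<noteq> 0" "Lr ep em m (inverse x2) \<noteq> 0" for m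
    unfolding x2_def using Lr_inverse_lin_nz[OF e a2] Lr_lin_nz[OF e a2] by simp_all
  \<comment> \<open>the ratio at spin \<open>J/2\<close> makes the two expressions \<open>c1\<close> and \<open>c2\<close> agree; the value at \<open>k = J + 1\<close> is the one that \<open>c2\<close> requires\<close>
  define c where "c k = (if k \<le> J then Y $$ (k, k) / Lr ep em (2 * int k - 1 - int J) x2
     else Y $$ (J, J) / Lr ep em (int J + 1) (inverse x2))" for k
  have c1: "Y $$ (k, k) = c k * Lr ep em (2 * int k - 1 - int J) x2" if "k \<le> J" for k
    using that Lnz by (simp add: c_def)
  have c2: "Y $$ (k, k) = c (Suc k) * Lr ep em (2 * int k + 1 - int J) (inverse x2)" if "k \<le> J" for k
  proof (cases "k = J")
    case True
    then show ?thesis using Lnz by (simp add: c_def)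
  next
    case False
    then show ?thesis using Yr[of k] that Lnz by (simp add: c_def field_simps)
  qed
  have c2': "Y $$ (k, k) = c (Suc k) * Lr ep em (2 * int (Suc k) - 1 - int J) (inverse x2)" if "k \<le> J" for k
    using c2[OF that] by (simp add: algebra_simps)
  define K where "K = Ksc_half q ep em 0 0 (x * fls_const (r powi (- int J)))"
  have K: "K $$ (0, Suc 0) = 0" "K $$ (Suc 0, 0) = 0"
    "K $$ (0, 0) = fls_const ep * (x * P.cp (- int J)) + fls_const em * (inverse x * P.cp (int J))"
    "K $$ (Suc 0, Suc 0) = fls_const em * (x * P.cp (- int J)) + fls_const ep * (inverse x * P.cp (int J))"
    unfolding K_def Ksc_half_index P.cp_def[symmetric]
    by (simp_all add: P.cp_expand(3) mult.commute)
  define z where "z = x^2 * fls_const (r powi (1 - int J))"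
  have z: "z \<noteq> 0" "P.param_of z = x * (x * P.cp (1 - int J))"
    using x r_nz by (simp_all add: z_def P.param_of_def P.cp_def power2_eq_square mult.assoc)
  have iz: "inverse (P.param_of z) = inverse x * (inverse x * P.cp (int J - 1))"
    unfolding z(2) by (simp add: P.inverse_cp mult_ac)
  have R0: "Rdiag r J z 0 n = x * (x * P.cp (2 - 2 * int n)) - inverse x * (inverse x * P.cp (2 * int n - 2))"
    and R1: "Rdiag r J z (Suc 0) n = x * (x * P.cp (2 * int (Suc n) - 2 * int J)) - inverse x * (inverse x * P.cp (2 * int J - 2 * int (Suc n)))" for n
    unfolding P.Rdiag_eq[OF z(1)] iz unfolding z(2) P.sg_def by (simp_all add: P.cp_mult mult.assoc algebra_simps)
  define C where "C = x * (x * P.cp 2) - inverse x * (inverse x * P.cp (- 2))"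
  define \<kappa> where "\<kappa> = Rfac r J z * (C * (K $$ (0, 0) * K $$ (Suc 0, Suc 0)))"
  have LrS: "Lr ep em m x2 = S.Lf (fls_const ep) (fls_const em) m (x * P.cp 1) (inverse x * P.cp (- 1))"
    "Lr ep em m (inverse x2) = S.Lf (fls_const ep) (fls_const em) m (inverse x * P.cp (- 1)) (x * P.cp 1)" for m
    unfolding Lr_def S.Lf_def inverse_inverse_eq x2 P.cp_def[symmetric]
    using x2 by simp_all
  define \<psi> where "\<psi> k = fusion_step (\<lambda>f. f) q r J K Y z (\<lambda>n. if n = k then 1 else 0)" for k
  have ro: "right_op J Y (Eop (\<lambda>f. f) q J (\<lambda>n. if n = k then 1 else 0)) b n =
     Y $$ (n, n) * Eop (\<lambda>f. f) q J (\<lambda>n. if n = k then 1 else 0) b n" if "n \<le> J" for b n k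
  proof -
    have "right_op J Y (Eop (\<lambda>f. f) q J (\<lambda>n. if n = k then 1 else 0)) b n =
      (\<Sum>m\<le>J. if m = n then Y $$ (n, n) * Eop (\<lambda>f. f) q J (\<lambda>n. if n = k then 1 else 0) b n else 0)"
      unfolding right_op_def by (rule sum.cong) (use that Y0 in auto)
    then show ?thesis using that by simp
  qed
  have lop: "left_op K f 0 n = K $$ (0, 0) * f 0 n" "left_op K f 1 n = K $$ (Suc 0, Suc 0) * f 1 n" for f n
    by (simp_all add: left_op_def K(1,2))
  have rop: "Rop (\<lambda>f. f) q r J z f 0 n = Rfac r J z * (Rdiag r J z 0 n * f 0 n + Roff q J n * f 1 (n - 1))"
    "Rop (\<lambda>f. f) q r J z f 1 n = Rfac r J z * (Roff q J (Suc n) * f 0 (Suc n) + Rdiag r J z (Suc 0) n * f 1 n)" for f n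
    by (simp_all add: Rop_def)
  have psi0: "\<psi> k 0 n = (if n = k then S.EA k * (\<kappa> * c k) else 0)" if n: "n \<le> J" for k n
  proof -
    have n': "n - 1 \<le> J" using n by simp
    have "\<psi> k 0 n = K $$ (0, 0) * (Rfac r J z * (Rdiag r J z 0 n * (Y $$ (n, n) * (if n = k then S.EA n else 0))
       + Roff q J n * (Y $$ (n - 1, n - 1) * (if Suc (n - 1) = k then S.EB (Suc (n - 1)) else 0))))"
      unfolding \<psi>_def fusion_step_def lop rop ro[OF n] ro[OF n'] by (simp add: Eop_def)
    also have "\<dots> = (if n = k then K $$ (0, 0) * (Rfac r J z * (Rdiag r J z 0 n * (Y $$ (n, n) * S.EA n) + Roff q J n * (Y $$ (n - 1, n - 1) * S.EB n))) else 0)"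
      by (cases n) auto
    also have "\<dots> = (if n = k then S.EA k * (\<kappa> * c k) else 0)"
    proof (cases "n = k")
      case True
      have y': "Roff q J n * (Y $$ (n - 1, n - 1) * S.EB n) = Roff q J n * S.EB n * (c n * Lr ep em (2 * int n - 1 - int J) (inverse x2))"
        using c2'[of "n - 1"] n by (cases n) (simp_all add: mult_ac del: fls_const_mult_const)
      have id: "Rdiag r J z 0 n * Lr ep em (2 * int n - 1 - int J) x2
          + (P.cp (2 * int n) - P.cp (- 2 * int n)) * Lr ep em (2 * int n - 1 - int J) (inverse x2) = C * K $$ (Suc 0, Suc 0)"
        unfolding R0 LrS C_def K(4) by (rule S.diagonal_fusion_upper)
      have "Rdiag r J z 0 n * (Y $$ (n, n) * S.EA n) + Roff q J n * (Y $$ (n - 1, n - 1) * S.EB n)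
        = S.EA n * c n * (Rdiag r J z 0 n * Lr ep em (2 * int n - 1 - int J) x2
          + (P.cp (2 * int n) - P.cp (- 2 * int n)) * Lr ep em (2 * int n - 1 - int J) (inverse x2))"
        unfolding y' S.Roff_EB[of n, OF le_SucI[OF n]] c1[OF n] P.sg_def
        by (simp add: algebra_simps del: fls_const_mult_const)
      also note id
      finally have "Rdiag r J z 0 n * (Y $$ (n, n) * S.EA n) + Roff q J n * (Y $$ (n - 1, n - 1) * S.EB n)
        = S.EA n * c n * (C * K $$ (Suc 0, Suc 0))" .
      then show ?thesis using True by (simp add: \<kappa>_def mult_ac)
    qed simp
    finally show ?thesis .
  qed
  have psi1: "\<psi> k 1 n = (if Suc n = k then S.EB k * (\<kappa> * c k) else 0)" if n: "n \<le> J" for k n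
  proof -
    have off: "Roff q J (Suc n) * right_op J Y (Eop (\<lambda>f. f) q J (\<lambda>n. if n = k then 1 else 0)) 0 (Suc n)
       = Roff q J (Suc n) * (Y $$ (Suc n, Suc n) * (if Suc n = k then S.EA (Suc n) else 0))"
      using n by (cases "n = J") (simp_all add: ro Eop_def)
    have "\<psi> k 1 n = K $$ (Suc 0, Suc 0) * (Rfac r J z * (Roff q J (Suc n) * (Y $$ (Suc n, Suc n) * (if Suc n = k then S.EA (Suc n) else 0))
       + Rdiag r J z (Suc 0) n * (Y $$ (n, n) * (if Suc n = k then S.EB (Suc n) else 0))))"
      unfolding \<psi>_def fusion_step_def lop rop off ro[OF n] by (simp add: Eop_def)
    also have "\<dots> = (if Suc n = k then S.EB k * (\<kappa> * c k) else 0)"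
    proof (cases "Suc n = k")
      case True
      have y': "Roff q J (Suc n) * (Y $$ (Suc n, Suc n) * S.EA (Suc n)) = Roff q J (Suc n) * S.EA (Suc n) * (c (Suc n) * Lr ep em (2 * int (Suc n) - 1 - int J) x2)"
        using c1[of "Suc n"] n by (cases "n = J") (simp_all add: mult_ac del: fls_const_mult_const)
      have id: "Rdiag r J z (Suc 0) n * Lr ep em (2 * int (Suc n) - 1 - int J) (inverse x2)
          + (P.cp (2 * (int J + 1 - int (Suc n))) - P.cp (- 2 * (int J + 1 - int (Suc n)))) * Lr ep em (2 * int (Suc n) - 1 - int J) x2 = C * K $$ (0, 0)"
        unfolding R1 LrS C_def K(3) by (rule S.diagonal_fusion_lower)
      have "Suc n \<le> Suc J" "1 \<le> Suc n" using n by simp_all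
      note ea = S.Roff_EA[OF this(2,1)]
      have "Roff q J (Suc n) * (Y $$ (Suc n, Suc n) * S.EA (Suc n)) + Rdiag r J z (Suc 0) n * (Y $$ (n, n) * S.EB (Suc n))
        = S.EB (Suc n) * c (Suc n) * (Rdiag r J z (Suc 0) n * Lr ep em (2 * int (Suc n) - 1 - int J) (inverse x2)
          + (P.cp (2 * (int J + 1 - int (Suc n))) - P.cp (- 2 * (int J + 1 - int (Suc n)))) * Lr ep em (2 * int (Suc n) - 1 - int J) x2)"
        unfolding y' ea c2'[OF n] P.sg_def
        by (simp add: algebra_simps del: fls_const_mult_const of_nat_Suc)
      also note id
      finally have "Roff q J (Suc n) * (Y $$ (Suc n, Suc n) * S.EA (Suc n)) + Rdiag r J z (Suc 0) n * (Y $$ (n, n) * S.EB (Suc n))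
        = S.EB (Suc n) * c (Suc n) * (C * K $$ (0, 0))" .
      then show ?thesis using True by (simp add: \<kappa>_def mult_ac)
    qed simp
    finally show ?thesis .
  qed
  have new: "Ksc q r ep em 0 0 (Suc J) x $$ (i, k) = (if i = k then \<kappa> * c k else 0)" if ik: "i \<le> Suc J" "k \<le> Suc J" for i k
  proof -
    have "Ksc q r ep em 0 0 (Suc J) x $$ (i, k) = Fop (\<lambda>f. f) q J (\<psi> k) i"
      unfolding x_def Ksc_Suc_index[OF Suc.prems ik] \<psi>_def K_def Y_def z_def x2_def ..
    also have "\<dots> = fls_const (Fa q J i) * (if i = k then S.EA k * (\<kappa> * c k) else 0) + fls_const (Fb q J i) * (if i = k then S.EB k * (\<kappa> * c k) else 0)"
    proof -
      have "fls_const (Fa q J i) * \<psi> k 0 i = fls_const (Fa q J i) * (if i = k then S.EA k * (\<kappa> * c k) else 0)"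
        using ik by (cases "i = Suc J") (simp_all add: psi0 Fa_def)
      moreover have "fls_const (Fb q J i) * \<psi> k 1 (i - 1) = fls_const (Fb q J i) * (if i = k then S.EB k * (\<kappa> * c k) else 0)"
        using ik by (cases i) (simp_all add: psi1 Fb_def del: One_nat_def)
      ultimately show ?thesis unfolding Fop_def by (rule arg_cong2[where f = "(+)"])
    qed
    also have "\<dots> = (if i = k then (fls_const (Fa q J k) * S.EA k + fls_const (Fb q J k) * S.EB k) * (\<kappa> * c k) else 0)"
      by (simp add: distrib_right mult.assoc del: fls_const_mult_const)
    also have "fls_const (Fa q J k) * S.EA k + fls_const (Fb q J k) * S.EB k = 1"
      using Fa_Fb[OF ik(2)] by (simp add: fls_plus_const)
    finally show ?thesis by simp
  qed
  have cm: "P.cp m * (y * P.cp k) = P.cp (m + k) * y" for m k y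
    by (metis P.cp_mult mult.commute mult.left_commute)
  have shift: "Lr ep em (2 * int k - 1 - int J) x2 = Lr ep em (2 * int k - int J) x"
    "Lr ep em (2 * int k + 1 - int J) (inverse x2) = Lr ep em (2 * int k - int J) (inverse x)" for k
    unfolding Lr_def inverse_inverse_eq x2 unfolding P.cp_def[symmetric] cm
    by (simp_all add: P.inverse_cp P.cp_mult P.cp_mult_left algebra_simps)
  have "\<kappa> * c i * Lr ep em (2 * int i + 1 - int (Suc J)) x = \<kappa> * c (Suc i) * Lr ep em (2 * int i + 1 - int (Suc J)) (inverse x)"
    if "i < Suc J" for i
    using c1[of i] c2[of i] that unfolding shift by simp
  then show ?case
    unfolding x_def[symmetric] x(2)[symmetric] using new by simp
qed

end

section \<open>Commutation for vanishing off-diagonal parameters\<close>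

context spin_param
begin

lemma sum_neighbours:
  fixes f g f' g' :: "nat \<Rightarrow> 'b::ab_group_add"
  assumes "f J = 0" "g' J = 0"
  shows "(\<Sum>i\<le>J. f i + (if i = 0 then 0 else g i) - (if i = 0 then 0 else f' i) - g' i)
    = (\<Sum>i<J. (f i - f' (Suc i)) - (g' i - g (Suc i)))"
proof -
  have "(\<Sum>i\<le>J. f i) = (\<Sum>i<J. f i)" "(\<Sum>i\<le>J. g' i) = (\<Sum>i<J. g' i)"
    using assms by (simp_all add: lessThan_Suc_atMost[symmetric])
  moreover have "(\<Sum>i\<le>J. if i = 0 then 0 else h i) = (\<Sum>i<J. h (Suc i))" for h :: "nat \<Rightarrow> 'b"
    unfolding sum.atMost_shift by simp
  ultimately show ?thesis
    by (simp add: sum.distrib sum_subtractf algebra_simps)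
qed

text \<open>
  A diagonal entry of the intertwining relation: the terms with the generator form the commutator, the tridiagonal
  part contributes the four neighbouring entries. Division by the weight of the diagonal term gives the factor \<open>h\<close>.
\<close>

lemma diagonal_commutator:
  assumes "intertwining kp km J a" "a \<noteq> 0" "i \<le> J"
  defines "K \<equiv> Kop q r kp km J (lin a)" and "v \<equiv> param_of (lin a)"
  defines "h \<equiv> cp (- 2 * (int J - 2 * int i))"
  shows "(K $$ (i, i) * Wgen - Wgen * K $$ (i, i)) -
     (fls_scal (h * (fls_const kp * inverse v * be J (Suc i))) * K $$ (Suc i, i)
     + (if i = 0 then 0 else fls_scal (h * (fls_const km * v * be J i)) * K $$ (i - 1, i))
     - (if i = 0 then 0 else fls_scal (h * (fls_const kp * v * be J i)) * K $$ (i, i - 1))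
     - fls_scal (h * (fls_const km * inverse v * be J (Suc i))) * K $$ (i, Suc i)) \<in> aq_null q kp km"
proof -
  have v: "v \<noteq> 0" using assms(2) by (simp add: v_def param_of_nz lin_nz)
  interpret F: fusion q r p J v "inverse v" "fls_const kp" "fls_const km" fls_scal "aq_null q kp km" Wgen
    by (rule fusionI[OF v])
  have r: "(\<Sum>m\<le>J. K $$ (n, m) * F.unitv i m) = K $$ (n, i)" for n
    using assms(3) by (simp add: F.unitv_def if_distrib[of "\<lambda>x. _ * x"] cong: if_cong)
  define H where "H = cp (2 * (int J - 2 * int i))"
  have hH: "h * H = 1" by (simp add: h_def H_def cp_mult)
  have "fls_scal H * (K $$ (i, i) * Wgen)
     + (if i = 0 then 0 else fls_scal (fls_const kp * v * be J i) * K $$ (i, i - 1))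
     + fls_scal (fls_const km * inverse v * be J (Suc i)) * K $$ (i, Suc i)
     - (fls_scal H * (Wgen * K $$ (i, i)) + fls_scal (fls_const kp * inverse v * be J (Suc i)) * K $$ (Suc i, i)
       + fls_scal (fls_const km * v * be J i) * K $$ (i - 1, i)) \<in> aq_null q kp km"
    using assms(1)[unfolded intertwining_def, rule_format, OF assms(3), of "F.unitv i", folded K_def v_def]
    unfolding F.sum_opM_unitv[OF assms(3)] r unfolding F.opM_def H_def .
  note X = F.mult_left_closed[OF this, of "fls_scal h"]
  have z: "i = 0 \<Longrightarrow> be J i = 0" by simp
  have "(K $$ (i, i) * Wgen - Wgen * K $$ (i, i)) -
     (fls_scal (h * (fls_const kp * inverse v * be J (Suc i))) * K $$ (Suc i, i)
     + (if i = 0 then 0 else fls_scal (h * (fls_const km * v * be J i)) * K $$ (i - 1, i))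
     - (if i = 0 then 0 else fls_scal (h * (fls_const kp * v * be J i)) * K $$ (i, i - 1))
     - fls_scal (h * (fls_const km * inverse v * be J (Suc i))) * K $$ (i, Suc i))
   = fls_scal h * (fls_scal H * (K $$ (i, i) * Wgen)
     + (if i = 0 then 0 else fls_scal (fls_const kp * v * be J i) * K $$ (i, i - 1))
     + fls_scal (fls_const km * inverse v * be J (Suc i)) * K $$ (i, Suc i)
     - (fls_scal H * (Wgen * K $$ (i, i)) + fls_scal (fls_const kp * inverse v * be J (Suc i)) * K $$ (Suc i, i)
       + fls_scal (fls_const km * v * be J i) * K $$ (i - 1, i)))"
    by (cases "i = 0") (simp_all add: right_diff_distrib distrib_left fls_scal.emb_assoc hH)
  then show ?thesis using X by (simp only:)
qed

text \<open>
  The off-diagonal pair between \<open>i\<close> and \<open>i + 1\<close> receives contributions from both diagonal positions. They combine to one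
  weight for the difference of the two entries, scaled by \<open>kp\<close> and \<open>km\<close>.
\<close>

lemma diagonal_trace_commutator:
  fixes d :: "nat \<Rightarrow> complex fls"
  assumes "intertwining kp km J a" "a \<noteq> 0"
  defines "K \<equiv> Kop q r kp km J (lin a)" and "v \<equiv> param_of (lin a)"
  defines "\<gamma> \<equiv> \<lambda>i. (d i * (cp (- 2 * (int J - 2 * int i)) * inverse v) - d (Suc i) * (cp (- 2 * (int J - 2 * int (Suc i))) * v)) * be J (Suc i)"
  shows "(\<Sum>i\<le>J. fls_scal (d i) * (K $$ (i, i) * Wgen - Wgen * K $$ (i, i)))
    - (\<Sum>i<J. fls_scal (\<gamma> i) * (sc kp * K $$ (Suc i, i) - sc km * K $$ (i, Suc i))) \<in> aq_null q kp km"
proof -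
  interpret N: two_sided_ideal "aq_null q kp km" by (rule two_sided_ideal_aq_null)
  define h where "h = (\<lambda>i::nat. cp (- 2 * (int J - 2 * int i)))"
  define A where "A i = fls_scal (d i * (h i * (fls_const kp * inverse v * be J (Suc i)))) * K $$ (Suc i, i)" for i
  define B where "B i = fls_scal (d i * (h i * (fls_const km * v * be J i))) * K $$ (i - 1, i)" for i
  define A' where "A' i = fls_scal (d i * (h i * (fls_const kp * v * be J i))) * K $$ (i, i - 1)" for i
  define B' where "B' i = fls_scal (d i * (h i * (fls_const km * inverse v * be J (Suc i)))) * K $$ (i, Suc i)" for i
  have "fls_scal (d i) * (K $$ (i, i) * Wgen - Wgen * K $$ (i, i)) -
     (A i + (if i = 0 then 0 else B i) - (if i = 0 then 0 else A' i) - B' i) \<in> aq_null q kp km" if "i \<le> J" for i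
  proof -
    have "fls_scal (d i) * ((K $$ (i, i) * Wgen - Wgen * K $$ (i, i)) -
     (fls_scal (h i * (fls_const kp * inverse v * be J (Suc i))) * K $$ (Suc i, i)
     + (if i = 0 then 0 else fls_scal (h i * (fls_const km * v * be J i)) * K $$ (i - 1, i))
     - (if i = 0 then 0 else fls_scal (h i * (fls_const kp * v * be J i)) * K $$ (i, i - 1))
     - fls_scal (h i * (fls_const km * inverse v * be J (Suc i))) * K $$ (i, Suc i)))
     = fls_scal (d i) * (K $$ (i, i) * Wgen - Wgen * K $$ (i, i)) -
     (A i + (if i = 0 then 0 else B i) - (if i = 0 then 0 else A' i) - B' i)"
      unfolding A_def B_def A'_def B'_def
      by (cases "i = 0") (simp_all only: simp_thms if_True if_False right_diff_distrib distrib_left fls_scal.emb_assoc mult_zero_right)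
    then show ?thesis
      using N.mult_left_closed[OF diagonal_commutator[OF assms(1,2) that, folded K_def v_def h_def], of "fls_scal (d i)"]
      unfolding h_def by (simp only:)
  qed
  then have "(\<Sum>i\<le>J. fls_scal (d i) * (K $$ (i, i) * Wgen - Wgen * K $$ (i, i)) -
     (A i + (if i = 0 then 0 else B i) - (if i = 0 then 0 else A' i) - B' i)) \<in> aq_null q kp km"
    by (intro N.sum_closed) simp
  then have "(\<Sum>i\<le>J. fls_scal (d i) * (K $$ (i, i) * Wgen - Wgen * K $$ (i, i))) -
     (\<Sum>i\<le>J. A i + (if i = 0 then 0 else B i) - (if i = 0 then 0 else A' i) - B' i) \<in> aq_null q kp km"
    by (simp only: sum_subtractf)
  also have "(\<Sum>i\<le>J. A i + (if i = 0 then 0 else B i) - (if i = 0 then 0 else A' i) - B' i)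
    = (\<Sum>i<J. (A i - A' (Suc i)) - (B' i - B (Suc i)))"
    by (rule sum_neighbours) (simp_all add: A_def B'_def)
  also have "\<dots> = (\<Sum>i<J. fls_scal (\<gamma> i) * (sc kp * K $$ (Suc i, i) - sc km * K $$ (i, Suc i)))"
  proof (rule sum.cong)
    fix i
    have s: "d i * (h i * (fls_const c * inverse v * be J (Suc i))) - d (Suc i) * (h (Suc i) * (fls_const c * v * be J (Suc i))) = \<gamma> i * fls_const c" for c
      unfolding \<gamma>_def h_def by (simp add: algebra_simps)
    have "A i - A' (Suc i) = fls_scal (\<gamma> i) * (sc kp * K $$ (Suc i, i))"
      unfolding A_def A'_def fls_scal.emb_assoc s[symmetric] fls_scal_diff by (simp add: left_diff_distrib)
    moreover have "B' i - B (Suc i) = fls_scal (\<gamma> i) * (sc km * K $$ (i, Suc i))"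
      unfolding B'_def B_def fls_scal.emb_assoc s[symmetric] fls_scal_diff by (simp add: left_diff_distrib)
    ultimately show "(A i - A' (Suc i)) - (B' i - B (Suc i)) = fls_scal (\<gamma> i) * (sc kp * K $$ (Suc i, i) - sc km * K $$ (i, Suc i))"
      by (simp add: right_diff_distrib)
  qed simp
  finally show ?thesis .
qed

end

lemma mat_trace_mult:
  assumes "A \<in> carrier_mat (Suc J) (Suc J)" "B \<in> carrier_mat (Suc J) (Suc J)"
  shows "mat_trace (A * B) = (\<Sum>i\<le>J. \<Sum>k\<le>J. A $$ (i, k) * B $$ (k, i))"
proof -
  have d: "dim_row A = Suc J" "dim_col A = Suc J" "dim_row B = Suc J" "dim_col B = Suc J" using assms by auto
  have "(A * B) $$ (i, i) = (\<Sum>k\<le>J. A $$ (i, k) * B $$ (k, i))" if "i < Suc J" for i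
    using index_mult_mat_apply[of i A i B] that by (simp add: d mat_apply_def lessThan_Suc_atMost)
  then show ?thesis by (simp add: mat_trace_def d lessThan_Suc_atMost[symmetric] del: sum.lessThan_Suc)
qed

lemma Kop_carrier: "Kop q r kp km J x \<in> carrier_mat (Suc J) (Suc J)"
  unfolding Kop_def by (rule fused_carrier)

lemma Ksc_carrier: "Ksc q r ep em kp km J x \<in> carrier_mat (Suc J) (Suc J)"
  unfolding Ksc_def by (rule fused_carrier)

lemma transfer_trace:
  "mat_trace (map_mat fls_scal (Kdual q r ebp ebm kbp kbm J fls_X_inv) * Kop q r kp km J fls_X_inv)
   = (\<Sum>i\<le>J. \<Sum>k\<le>J. fls_scal (inverse (ffun q J fls_X_inv) *
        Ksc q r ebm ebp (- kbm) (- kbp) J (inverse (lin q)) $$ (k, i)) * Kop q r kp km J (lin 1) $$ (k, i))"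
proof -
  have l: "fls_X_inv = lin 1" "inverse (lin 1) * fls_const (inverse q) = inverse (lin q)"
    by (simp_all add: lin_def[of 1] inverse_lin[of q] fls_inverse_X_inv mult.commute)
  have "Kdual q r ebp ebm kbp kbm J fls_X_inv \<in> carrier_mat (Suc J) (Suc J)"
    unfolding Kdual_def using Ksc_carrier by auto
  then have "mat_trace (map_mat fls_scal (Kdual q r ebp ebm kbp kbm J fls_X_inv) * Kop q r kp km J fls_X_inv)
    = (\<Sum>i\<le>J. \<Sum>k\<le>J. map_mat fls_scal (Kdual q r ebp ebm kbp kbm J fls_X_inv) $$ (i, k) * Kop q r kp km J fls_X_inv $$ (k, i))"
    by (intro mat_trace_mult Kop_carrier) auto
  also have "\<dots> = (\<Sum>i\<le>J. \<Sum>k\<le>J. fls_scal (inverse (ffun q J fls_X_inv) *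
        Ksc q r ebm ebp (- kbm) (- kbp) J (inverse (lin q)) $$ (k, i)) * Kop q r kp km J (lin 1) $$ (k, i))"
    using Ksc_carrier[of q r ebm ebp "- kbm" "- kbp" J "inverse (lin q)"] unfolding Kdual_def l
    by (intro sum.cong) (auto simp: divide_inverse)
  finally show ?thesis .
qed

context generic_q
begin

text \<open>
  The weights of an off-diagonal pair coming from \<open>W\<^sub>0\<close> and from \<open>W\<^sub>1\<close> add up to a multiple of the difference of the two
  sides of the ratio in \<open>Ksc_diagonal\<close>.
\<close>

lemma transfer_commutes:
  fixes J :: nat and kp km ebp ebm :: complex
  assumes nz: "kp \<noteq> 0" "km \<noteq> 0" and e: "ebp \<noteq> 0 \<or> ebm \<noteq> 0"
  defines "T \<equiv> mat_trace (map_mat fls_scal (Kdual q r ebp ebm 0 0 J fls_X_inv) * Kop q r kp km J fls_X_inv)"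
    and "w \<equiv> fls_const (scal ebp * gen (Wneg 0) + scal ebm * gen (Wpos 0))"
  shows "T * w - w * T \<in> aq_null q kp km"
proof -
  interpret N: two_sided_ideal "aq_null q kp km" by (rule two_sided_ideal_aq_null)
  interpret P: spin_param q r r by unfold_locales simp
  interpret M: spin_param q r "inverse r" by unfold_locales simp
  have e': "ebm \<noteq> 0 \<or> ebp \<noteq> 0" using e by auto
  define K where "K = Kop q r kp km J (lin 1)"
  define D where "D = Ksc q r ebm ebp 0 0 J (inverse (lin q))"
  define d where "d i = inverse (ffun q J fls_X_inv) * D $$ (i, i)" for i
  define u where "u = lin 1"
  have u: "u \<noteq> 0" by (simp add: u_def lin_nz)
  have diag: "D $$ (i, k) = 0" if "i \<le> J" "k \<le> J" "i \<noteq> k" for i k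
    using Ksc_diagonal[OF e' q_nz] that by (simp add: D_def)
  have ratio: "d i * Lr ebm ebp (2 * int i + 1 - int J) (inverse (lin q)) = d (Suc i) * Lr ebm ebp (2 * int i + 1 - int J) (lin q)"
    if "i < J" for i
    using Ksc_diagonal[OF e' q_nz] that by (simp add: D_def d_def mult.assoc)
  have T: "T = (\<Sum>i\<le>J. fls_scal (d i) * K $$ (i, i))"
  proof -
    have "T = (\<Sum>i\<le>J. \<Sum>k\<le>J. fls_scal (inverse (ffun q J fls_X_inv) * D $$ (k, i)) * K $$ (k, i))"
      unfolding T_def transfer_trace D_def K_def by simp
    also have "\<dots> = (\<Sum>i\<le>J. \<Sum>k\<le>J. if k = i then fls_scal (d i) * K $$ (i, i) else 0)"
      by (intro sum.cong) (auto simp: diag d_def)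
    finally show ?thesis by simp
  qed
  have w: "w = sc ebp * W0 + sc ebm * W1"
    by (simp add: w_def fls_scal_const flip: fls_plus_const fls_const_mult_const)
  have PW: "P.Wgen = W0" "M.Wgen = W1" using r_neq_inverse by (auto simp: P.Wgen_def M.Wgen_def)
  have pv: "P.param_of (lin 1) = u" "M.param_of (lin 1) = inverse u"
    using r_neq_inverse by (auto simp: P.param_of_def M.param_of_def u_def)
  have comm: "T * w - w * T = sc ebp * (\<Sum>i\<le>J. fls_scal (d i) * (K $$ (i, i) * W0 - W0 * K $$ (i, i)))
     + sc ebm * (\<Sum>i\<le>J. fls_scal (d i) * (K $$ (i, i) * W1 - W1 * K $$ (i, i)))"
  proof -
    have t: "T * x - x * T = (\<Sum>i\<le>J. fls_scal (d i) * (K $$ (i, i) * x - x * K $$ (i, i)))" for x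
      unfolding T by (simp add: sum_distrib_left sum_distrib_right right_diff_distrib mult.assoc
          fls_scal.emb_left_commute[of x] sum_subtractf)
    have "T * w - w * T = sc ebp * (T * W0 - W0 * T) + sc ebm * (T * W1 - W1 * T)"
      unfolding w by (simp add: distrib_left distrib_right right_diff_distrib mult.assoc fls_scal.emb_left_commute[of T])
    then show ?thesis unfolding t .
  qed
  define gP where "gP i = (d i * (P.cp (- 2 * (int J - 2 * int i)) * inverse u) - d (Suc i) * (P.cp (- 2 * (int J - 2 * int (Suc i))) * u)) * P.be J (Suc i)" for i
  define gM where "gM i = (d i * (M.cp (- 2 * (int J - 2 * int i)) * u) - d (Suc i) * (M.cp (- 2 * (int J - 2 * int (Suc i))) * inverse u)) * M.be J (Suc i)" for i
  define V where "V i = sc kp * K $$ (Suc i, i) - sc km * K $$ (i, Suc i)" for i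
  have cP: "(\<Sum>i\<le>J. fls_scal (d i) * (K $$ (i, i) * W0 - W0 * K $$ (i, i))) - (\<Sum>i<J. fls_scal (gP i) * V i) \<in> aq_null q kp km"
    using P.diagonal_trace_commutator[OF conjunct1[OF Kop_intertwines[OF nz one_neq_zero]] one_neq_zero, where d = d and J = J]
    unfolding pv PW K_def[symmetric] gP_def V_def .
  have cM: "(\<Sum>i\<le>J. fls_scal (d i) * (K $$ (i, i) * W1 - W1 * K $$ (i, i))) - (\<Sum>i<J. fls_scal (gM i) * V i) \<in> aq_null q kp km"
    using M.diagonal_trace_commutator[OF conjunct2[OF Kop_intertwines[OF nz one_neq_zero]] one_neq_zero, where d = d and J = J]
    unfolding pv PW inverse_inverse_eq K_def[symmetric] gM_def V_def .
  have g0: "fls_const ebp * gP i + fls_const ebm * gM i = 0" if "i < J" for i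
  proof -
    have Mcp: "M.cp k = P.cp (- k)" for k
      by (simp add: M.cp_def P.cp_def power_int_minus power_int_inverse)
    interpret S: spin_spectral q r r J u "inverse u" 0 0 by unfold_locales (rule right_inverse[OF u])
    have lq: "lin q = u * P.cp 2"
      using r_sq by (simp add: u_def P.cp_def lin_mult_const)
    have "fls_const ebp * gP i + fls_const ebm * gM i = fls_const (bq q J (Suc i)) *
      (d i * Lr ebm ebp (2 * int i + 1 - int J) (inverse (lin q)) - d (Suc i) * Lr ebm ebp (2 * int i + 1 - int J) (lin q))"
      unfolding gP_def gM_def Lr_def inverse_inverse_eq lq P.be_def M.be_def Mcp
      unfolding P.cp_def[symmetric] using u
      by (simp add: P.cp_expand S.cp_expand_right field_simps del: fls_const_mult_const, (simp add: algebra_simps power_numeral_reduce del: fls_const_mult_const)?)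
    then show ?thesis using ratio[OF that] by simp
  qed
  have "sc ebp * (\<Sum>i<J. fls_scal (gP i) * V i) + sc ebm * (\<Sum>i<J. fls_scal (gM i) * V i)
    = (\<Sum>i<J. fls_scal (fls_const ebp * gP i + fls_const ebm * gM i) * V i)"
    by (simp add: sum_distrib_left fls_scal.emb_assoc fls_scal_add distrib_right sum.distrib)
  also have "\<dots> = 0" by (simp add: g0)
  finally have z: "sc ebp * (\<Sum>i<J. fls_scal (gP i) * V i) + sc ebm * (\<Sum>i<J. fls_scal (gM i) * V i) = 0" .
  have "T * w - w * T - (sc ebp * (\<Sum>i<J. fls_scal (gP i) * V i) + sc ebm * (\<Sum>i<J. fls_scal (gM i) * V i)) \<in> aq_null q kp km"
    unfolding comm using N.add_closed[OF N.mult_left_closed[OF cP, of "sc ebp"] N.mult_left_closed[OF cM, of "sc ebm"]]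
    by (simp add: right_diff_distrib algebra_simps)
  then show ?thesis unfolding z by simp
qed

end

section \<open>A representation on the quantum torus\<close>

type_synonym state = "int \<Rightarrow> int \<Rightarrow> complex"

text \<open>
  The quantum torus acting on functions of two integers: \<open>tor w m n\<close> is the Weyl-ordered monomial \<open>X\<^sup>m Y\<^sup>n\<close>, a translation
  by \<open>(m, n)\<close> followed by a twist. The twist is chosen symmetrically, so that inverses are the monomials with negated
  exponents.
\<close>

definition tor :: "complex \<Rightarrow> int \<Rightarrow> int \<Rightarrow> state \<Rightarrow> state" where
  "tor w m n f a b = w powi (n * a - m * b) * f (a - m) (b - n)"

text \<open>
  \<open>W\<^sub>0\<close> and \<open>W\<^sub>1\<close> act as \<open>mu (Y + Y\<^sup>-\<^sup>1)\<close> and \<open>mu (X + X\<^sup>-\<^sup>1)\<close>, and \<open>G\<^sub>1\<close>, \<open>G~\<^sub>1\<close> as the two \<open>q\<close>-commutators of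
  these. With a suitable \<open>mu\<close> the next relations hold with all higher generators acting as zero.
\<close>

fun opgen :: "complex \<Rightarrow> complex \<Rightarrow> complex \<Rightarrow> aq_gen \<Rightarrow> state \<Rightarrow> state" where
  "opgen q w mu (Wneg k) f a b = (if k = 0 then mu * (tor w 0 1 f a b + tor w 0 (- 1) f a b) else 0)"
| "opgen q w mu (Wpos k) f a b = (if k = 0 then mu * (tor w 1 0 f a b + tor w (- 1) 0 f a b) else 0)"
| "opgen q w mu (Gen_G k) f a b = (if k = 0 then mu^2 *
     ((q / w - w / q) * (tor w 1 1 f a b + tor w (- 1) (- 1) f a b)
      + (q * w - inverse (q * w)) * (tor w 1 (- 1) f a b + tor w (- 1) 1 f a b)) else 0)"
| "opgen q w mu (Gen_Gt k) f a b = (if k = 0 then mu^2 *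
     ((q * w - inverse (q * w)) * (tor w 1 1 f a b + tor w (- 1) (- 1) f a b)
      + (q / w - w / q) * (tor w 1 (- 1) f a b + tor w (- 1) 1 f a b)) else 0)"

lemma tor_linear:
  "tor w m n (\<lambda>a b. f a b + g a b) a b = tor w m n f a b + tor w m n g a b"
  "tor w m n (\<lambda>a b. c * f a b) a b = c * tor w m n f a b"
  by (simp_all add: tor_def algebra_simps)

lemma opgen_add: "opgen q w mu g (\<lambda>a b. f a b + f' a b) = (\<lambda>a b. opgen q w mu g f a b + opgen q w mu g f' a b)"
  by (intro ext, cases g) (simp_all add: tor_linear algebra_simps)

lemma opgen_mult: "opgen q w mu g (\<lambda>a b. c * f a b) = (\<lambda>a b. c * opgen q w mu g f a b)"
  by (intro ext, cases g) (simp_all add: tor_linear algebra_simps)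

lemma foldr_opgen_add: "foldr (opgen q w mu) xs (\<lambda>a b. f a b + f' a b) =
    (\<lambda>a b. foldr (opgen q w mu) xs f a b + foldr (opgen q w mu) xs f' a b)"
  by (induction xs) (simp_all add: opgen_add)

lemma foldr_opgen_mult: "foldr (opgen q w mu) xs (\<lambda>a b. c * f a b) = (\<lambda>a b. c * foldr (opgen q w mu) xs f a b)"
  by (induction xs) (simp_all add: opgen_mult)

lemma tor_tor:
  assumes "w \<noteq> 0"
  shows "tor w m n (tor w m' n' f) a b = w powi (n * m' - m * n') * tor w (m + m') (n + n') f a b"
proof -
  have "w powi (n * a - m * b) * w powi (n' * (a - m) - m' * (b - n))
      = w powi ((n * m' - m * n') + ((n + n') * a - (m + m') * b))"
    by (subst power_int_add[symmetric]) (simp_all add: assms algebra_simps)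
  also have "\<dots> = w powi (n * m' - m * n') * w powi ((n + n') * a - (m + m') * b)"
    by (rule power_int_add) (simp add: assms)
  finally show ?thesis by (simp add: tor_def diff_diff_eq flip: mult.assoc)
qed

lemma opgen_0:
  "opgen q w mu (Wneg 0) f = (\<lambda>a b. mu * (tor w 0 1 f a b + tor w 0 (- 1) f a b))"
  "opgen q w mu (Wpos 0) f = (\<lambda>a b. mu * (tor w 1 0 f a b + tor w (- 1) 0 f a b))"
  "opgen q w mu (Gen_G 0) f = (\<lambda>a b. mu^2 *
     ((q / w - w / q) * (tor w 1 1 f a b + tor w (- 1) (- 1) f a b)
      + (q * w - inverse (q * w)) * (tor w 1 (- 1) f a b + tor w (- 1) 1 f a b)))"
  "opgen q w mu (Gen_Gt 0) f = (\<lambda>a b. mu^2 *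
     ((q * w - inverse (q * w)) * (tor w 1 1 f a b + tor w (- 1) (- 1) f a b)
      + (q / w - w / q) * (tor w 1 (- 1) f a b + tor w (- 1) 1 f a b)))"
  by (intro ext, simp)+

lemma opgen_Suc: "opgen q w mu (Wneg (Suc k)) f = (\<lambda>a b. 0)" "opgen q w mu (Wpos (Suc k)) f = (\<lambda>a b. 0)"
  "opgen q w mu (Gen_G (Suc k)) f = (\<lambda>a b. 0)" "opgen q w mu (Gen_Gt (Suc k)) f = (\<lambda>a b. 0)"
  by (intro ext, simp)+

locale torus_rep =
  fixes q w mu :: complex
begin

fun opword :: "aq_word \<Rightarrow> state \<Rightarrow> state" where
  "opword (Aq_Word xs) f = foldr (opgen q w mu) xs f"

lemma opword_add: "opword u (\<lambda>a b. f a b + f' a b) = (\<lambda>a b. opword u f a b + opword u f' a b)"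
proof (cases u)
  case (Aq_Word xs)
  then show ?thesis
    by (simp add: foldr_opgen_add)
qed

lemma opword_mult: "opword u (\<lambda>a b. c * f a b) = (\<lambda>a b. c * opword u f a b)"
proof (cases u)
  case (Aq_Word xs)
  then show ?thesis
    by (simp add: foldr_opgen_mult)
qed

lemma opword_0: "opword u (\<lambda>a b. 0) = (\<lambda>a b. 0)"
  using opword_mult[of u 0 "\<lambda>a b. 0"] by simp

lemma opword_sum: "opword u (\<lambda>a b. \<Sum>i\<in>A. f i a b) = (\<lambda>a b. \<Sum>i\<in>A. opword u (f i) a b)"
  by (induction A rule: infinite_finite_induct) (simp_all add: opword_0 opword_add)

lemma opword_plus: "opword (u + v) f = opword u (opword v f)"
  by (cases u; cases v) simp

definition act :: "free_alg \<Rightarrow> state \<Rightarrow> state" where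
  "act x f a b = (\<Sum>u\<in>Poly_Mapping.keys x. Poly_Mapping.lookup x u * opword u f a b)"

lemma act_superset:
  "finite A \<Longrightarrow> Poly_Mapping.keys x \<subseteq> A \<Longrightarrow> act x f a b = (\<Sum>u\<in>A. Poly_Mapping.lookup x u * opword u f a b)"
  unfolding act_def by (rule sum.mono_neutral_left) (auto simp: in_keys_iff)

lemma act_add: "act (x + y) f a b = act x f a b + act y f a b"
proof -
  let ?A = "Poly_Mapping.keys x \<union> Poly_Mapping.keys y"
  have "Poly_Mapping.keys (x + y) \<subseteq> ?A" by (rule Poly_Mapping.keys_add)
  then show ?thesis
    by (simp add: act_superset[of ?A] lookup_add distrib_right sum.distrib)
qed

lemma act_single: "act (Poly_Mapping.single u c) f a b = c * opword u f a b"
  by (simp add: act_def)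

lemma act_0 [simp]: "act 0 f a b = 0" by (simp add: act_def)

lemma act_sum: "act (sum g A) f a b = (\<Sum>i\<in>A. act (g i) f a b)"
  by (induction A rule: infinite_finite_induct) (simp_all add: act_add)

lemma act_mult: "act (x * y) f = act x (act y f)"
proof (intro ext)
  fix a b
  have "x * y = (\<Sum>u\<in>Poly_Mapping.keys x. \<Sum>v\<in>Poly_Mapping.keys y.
      Poly_Mapping.single (u + v) (Poly_Mapping.lookup x u * Poly_Mapping.lookup y v))"
    by (subst poly_mapping_eq_sum_single[of x], subst poly_mapping_eq_sum_single[of y])
      (simp add: sum_distrib_left sum_distrib_right mult_single sum.swap[of _ "Poly_Mapping.keys y"])
  then have "act (x * y) f a b = (\<Sum>u\<in>Poly_Mapping.keys x. \<Sum>v\<in>Poly_Mapping.keys y.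
      (Poly_Mapping.lookup x u * Poly_Mapping.lookup y v) * opword (u + v) f a b)"
    by (simp add: act_sum act_single)
  also have "\<dots> = (\<Sum>u\<in>Poly_Mapping.keys x. Poly_Mapping.lookup x u * opword u (act y f) a b)"
    unfolding act_def[of y, abs_def] opword_plus
    by (simp add: opword_sum opword_mult sum_distrib_left mult.assoc)
  finally show "act (x * y) f a b = act x (act y f) a b" by (simp add: act_def)
qed

lemma act_gen: "act (gen g) f = opgen q w mu g f"
  by (intro ext) (simp add: gen_def act_single)

lemma act_scal: "act (scal c) f a b = c * f a b"
  by (simp add: scal_def act_single zero_aq_word_def)

lemma act_uminus: "act (- x) f a b = - act x f a b"
  using act_add[of x "- x" f a b] by (simp add: eq_neg_iff_add_eq_0 add.commute)

lemma act_diff: "act (x - y) f a b = act x f a b - act y f a b"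
  using act_add[of x "- y" f a b] by (simp add: act_uminus)

lemma act_zero_state: "act x (\<lambda>a b. 0) a b = 0"
  by (simp add: act_def opword_0)

lemma two_sided_ideal_kernel: "two_sided_ideal {x. \<forall>f a b. act x f a b = 0}"
proof
  fix x y :: free_alg
  assume x: "x \<in> {x. \<forall>f a b. act x f a b = 0}"
  then have "act x f = (\<lambda>a b. 0)" for f by (auto simp: fun_eq_iff)
  then show "y * x \<in> {x. \<forall>f a b. act x f a b = 0}" by (simp add: act_mult act_zero_state)
  show "x * y \<in> {x. \<forall>f a b. act x f a b = 0}" using x by (simp add: act_mult)
qed (simp_all add: act_diff)

lemma opgen_0_state: "opgen q w mu g (\<lambda>a b. 0) = (\<lambda>a b. 0)"
  using opgen_mult[of q w mu g 0 "\<lambda>a b. 0"] by (intro ext) simp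

lemma act_comm: "act (comm (gen g) (gen h)) f a b = opgen q w mu g (opgen q w mu h f) a b - opgen q w mu h (opgen q w mu g f) a b"
  by (simp add: comm_def act_diff act_mult act_gen)

lemma act_qcomm: "act (qcomm c (gen g) (gen h)) f a b
  = c * opgen q w mu g (opgen q w mu h f) a b - inverse c * opgen q w mu h (opgen q w mu g f) a b"
  by (simp add: qcomm_def act_diff act_mult act_gen act_scal)

lemma act_scal_diff: "act (scal c * (gen g - gen h)) f a b = c * (opgen q w mu g f a b - opgen q w mu h f a b)"
  by (simp add: act_mult act_diff act_gen act_scal)

text \<open>
  For \<open>w = q\<^sup>\<plusminus>\<^sup>1\<close> one of the two coefficients of \<open>G\<^sub>1\<close> and of \<open>G~\<^sub>1\<close> vanishes, and the square of the other one is
  \<open>(q\<^sup>2 - q\<^sup>-\<^sup>2)\<^sup>2\<close>. The \<open>q\<close>-commutators of \<open>G\<^sub>1\<close> and \<open>G~\<^sub>1\<close> with \<open>W\<^sub>0\<close> and \<open>W\<^sub>1\<close> then are multiples of \<open>W\<^sub>1\<close> and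
  \<open>W\<^sub>0\<close>, and the value of \<open>mu\<^sup>2\<close> makes them the right ones.
\<close>

lemma aq_ideal_act:
  assumes nz: "q \<noteq> 0" "q + inverse q \<noteq> 0" "q - inverse q \<noteq> 0" and w: "w = q \<or> w = inverse q"
    and mu: "mu^2 = - (kp * km) / (q - inverse q)^2"
    and x: "x \<in> aq_ideal q kp km"
  shows "act x f a b = 0"
proof -
  have w0: "w \<noteq> 0" using nz w by auto
  note tt = tor_tor[OF w0]
  define i where "i = inverse q"
  define v where "v = inverse w"
  define al where "al = q / w - w / q"
  define be where "be = q * w - inverse (q * w)"
  \<comment> \<open>the rewrite rules move the powers of \<open>w\<close> that come from composing monomials into \<open>al\<close> and \<open>be\<close>; the variable \<open>X\<close> lets them apply inside products\<close>
  have qwX: "q * (w * X) = be * X + i * (v * X)" "q * (v * X) = al * X + i * (w * X)" for X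
    using w0 nz by (simp_all add: al_def be_def i_def v_def divide_inverse algebra_simps)
  have albe: "al * (be * X) = 0" for X using w nz by (auto simp: al_def be_def)
  define s where "s = 1 / (q + i)"
  have diff: "w * X = v * X + s * (be * X) - s * (al * X)" for X
  proof -
    have "be * X - al * X = (q + i) * (w * X - v * X)"
      by (simp add: al_def be_def i_def v_def divide_inverse algebra_simps)
    then have "s * (be * X - al * X) = w * X - v * X" using nz by (simp add: i_def s_def)
    then show ?thesis by (simp add: algebra_simps)
  qed
  have sq: "kp * km * (q + i)^2 * X = - (mu^2 * (al * (al * X) + be * (be * X)))" for X
  proof -
    have "al = 0 \<and> be = q^2 - i^2 \<or> be = 0 \<and> al = q^2 - i^2"
      using w nz by (auto simp: al_def be_def i_def power2_eq_square divide_inverse)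
    moreover have "(q^2 - i^2)^2 = (q + i)^2 * (q - i)^2"
      by (simp add: power2_eq_square algebra_simps)
    ultimately have "al^2 + be^2 = (q + i)^2 * (q - i)^2" by auto
    moreover have "kp * km = - (mu^2 * (q - i)^2)" using mu nz by (simp add: i_def field_simps)
    ultimately have RR: "kp * km * (q + i)^2 = - (mu^2 * (al^2 + be^2))" by (simp add: mult_ac)
    show ?thesis unfolding RR by (simp add: algebra_simps power2_eq_square)
  qed
  note ev0 = act_comm act_qcomm act_scal_diff act_add opgen_Suc opgen_0_state
  note ev = act_comm act_qcomm act_scal_diff act_add opgen_0[of q w mu, folded al_def be_def] power_int_1_right opgen_Suc tor_linear tt power_int_minus opgen_0_state i_def[symmetric] v_def[symmetric]
  have "act l f a b = act r f a b" if "aq_rel q kp km l r" for l r f a b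
    using that
  proof cases
    case (1 k)
    show ?thesis
    proof (cases k)
      case 0
      show ?thesis unfolding 1 0
        by (simp only: ev s_def[symmetric]) (simp add: algebra_simps diff power2_eq_square v_def[symmetric])
    qed (simp add: 1 ev0 del: opgen.simps)
  next
    case (2 k)
    show ?thesis
    proof (cases k)
      case 0
      show ?thesis unfolding 2 0
        by (simp only: ev s_def[symmetric]) (simp add: algebra_simps diff power2_eq_square v_def[symmetric])
    qed (simp add: 2 ev0 del: opgen.simps)
  next
    case (3 k)
    show ?thesis
    proof (cases k)
      case 0
      show ?thesis unfolding 3 0
        by (simp only: ev sq) (simp add: algebra_simps qwX albe power2_eq_square v_def[symmetric])
    qed (simp add: 3 ev0 del: opgen.simps)
  next
    case (4 k)
    show ?thesis
    proof (cases k)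
      case 0
      show ?thesis unfolding 4 0
        by (simp only: ev sq) (simp add: algebra_simps qwX albe power2_eq_square v_def[symmetric])
    qed (simp add: 4 ev0 del: opgen.simps)
  next
    case (5 k)
    show ?thesis
    proof (cases k)
      case 0
      show ?thesis unfolding 5 0
        by (simp only: ev sq) (simp add: algebra_simps qwX albe power2_eq_square v_def[symmetric])
    qed (simp add: 5 ev0 del: opgen.simps)
  next
    case (6 k)
    show ?thesis
    proof (cases k)
      case 0
      show ?thesis unfolding 6 0
        by (simp only: ev sq) (simp add: algebra_simps qwX albe power2_eq_square v_def[symmetric])
    qed (simp add: 6 ev0 del: opgen.simps)
  next
    case (7 k l)
    then show ?thesis by (cases k; cases l) (simp_all add: ev0 del: opgen.simps)
  next
    case (8 k l)
    then show ?thesis by (cases k; cases l) (simp_all add: ev0 del: opgen.simps)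
  next
    case (9 k l)
    then show ?thesis by (cases k; cases l) (simp_all add: ev0 del: opgen.simps)
  next
    case (10 k l)
    then show ?thesis by (cases k; cases l) (simp_all add: ev0 del: opgen.simps)
  next
    case (11 k l)
    then show ?thesis by (cases k; cases l) (simp_all add: ev0 del: opgen.simps)
  next
    case (12 k l)
    then show ?thesis by (cases k; cases l) (simp_all add: ev0 del: opgen.simps)
  next
    case (13 k l)
    then show ?thesis by (cases k; cases l) (simp_all add: ev0 del: opgen.simps)
  next
    case (14 k l)
    then show ?thesis by (cases k; cases l) (simp_all add: ev0 del: opgen.simps)
  next
    case (15 k l)
    then show ?thesis by (cases k; cases l) (simp_all add: ev0 del: opgen.simps)
  next
    case (16 k l)
    then show ?thesis by (cases k; cases l) (simp_all add: ev0 del: opgen.simps)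
  qed
  then have "l - r \<in> {x. \<forall>f a b. act x f a b = 0}" if "aq_rel q kp km l r" for l r
    using that by (simp add: act_diff)
  then show ?thesis
    using aq_ideal_minimal[OF two_sided_ideal_kernel] x by blast
qed

end

section \<open>Leading symbols\<close>

context torus_rep
begin

definition degree_le :: "int \<Rightarrow> state \<Rightarrow> bool" where
  "degree_le e f \<longleftrightarrow> (\<forall>a b. e < a + b \<longrightarrow> f a b = 0)"

text \<open>
  An element of degree at most \<open>N\<close> raises the total degree \<open>a + b\<close> by at most \<open>2 N\<close>, and in that top degree it acts as \<open>c\<close>
  times the translation by \<open>(N, N)\<close>. For \<open>W\<^sub>0\<close> and \<open>W\<^sub>1\<close>, which raise the total degree by one, this holds with \<open>N = 1\<close>
  and \<open>c = 0\<close>. The element does not determine \<open>N\<close>.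
\<close>

definition top_symbol :: "nat \<Rightarrow> complex \<Rightarrow> free_alg \<Rightarrow> bool" where
  "top_symbol N c x \<longleftrightarrow> (\<forall>f e. degree_le e f \<longrightarrow>
     (\<forall>a b. e + 2 * int N \<le> a + b \<longrightarrow> act x f a b = c * tor w (int N) (int N) f a b))"

lemma top_symbolD:
  "top_symbol N c x \<Longrightarrow> degree_le e f \<Longrightarrow> e + 2 * int N \<le> a + b \<Longrightarrow> act x f a b = c * tor w (int N) (int N) f a b"
  unfolding top_symbol_def by blast

lemma degree_le_act: "top_symbol N c x \<Longrightarrow> degree_le e f \<Longrightarrow> degree_le (e + 2 * int N) (act x f)"
  by (auto simp: degree_le_def[of "e + _"] top_symbolD) (simp add: degree_le_def tor_def)

lemma top_symbol_0: "top_symbol N 0 0" by (simp add: top_symbol_def)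

lemma top_symbol_add: "top_symbol N c x \<Longrightarrow> top_symbol N d y \<Longrightarrow> top_symbol N (c + d) (x + y)"
  by (simp add: top_symbol_def act_add distrib_right)

lemma top_symbol_diff: "top_symbol N c x \<Longrightarrow> top_symbol N d y \<Longrightarrow> top_symbol N (c - d) (x - y)"
  by (simp add: top_symbol_def act_diff left_diff_distrib)

lemma top_symbol_sum: "(\<And>i. i \<in> A \<Longrightarrow> top_symbol N (c i) (x i)) \<Longrightarrow> top_symbol N (sum c A) (sum x A)"
  by (induction A rule: infinite_finite_induct) (simp_all add: top_symbol_0 top_symbol_add)

lemma top_symbol_mult:
  assumes w: "w \<noteq> 0" and x: "top_symbol N c x" and y: "top_symbol M d y"
  shows "top_symbol (N + M) (c * d) (x * y)"
  unfolding top_symbol_def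
proof (intro allI impI)
  fix f e a b
  assume f: "degree_le e f" and ab: "e + 2 * int (N + M) \<le> a + b"
  have "act (x * y) f a b = c * tor w (int N) (int N) (act y f) a b"
    unfolding act_mult by (rule top_symbolD[OF x degree_le_act[OF y f]]) (use ab in simp)
  also have "\<dots> = c * (d * tor w (int N) (int N) (tor w (int M) (int M) f) a b)"
    using top_symbolD[OF y f, of "a - int N" "b - int N"] ab by (simp add: tor_def)
  also have "\<dots> = c * d * tor w (int (N + M)) (int (N + M)) f a b"
    by (simp add: tor_tor[OF w])
  finally show "act (x * y) f a b = c * d * tor w (int (N + M)) (int (N + M)) f a b" .
qed

text \<open>
  Allows adding terms of lower degree, such as the scalar terms in the off-diagonal entries of the fundamental
  K-operator.
\<close>

lemma top_symbol_Suc: "top_symbol N c x \<Longrightarrow> top_symbol (Suc N) 0 x"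
  unfolding top_symbol_def by (simp add: degree_le_def tor_def)

lemma top_symbol_scal: "top_symbol 0 c (scal c)"
  by (simp add: top_symbol_def act_scal tor_def)

text \<open>
  The coefficient of \<open>X Y\<close>, the single monomial of total degree 2 that occurs in the action of a generator.
\<close>

fun gen_symbol :: "aq_gen \<Rightarrow> complex" where
  "gen_symbol (Gen_G 0) = mu^2 * (q / w - w / q)"
| "gen_symbol (Gen_Gt 0) = mu^2 * (q * w - inverse (q * w))"
| "gen_symbol _ = 0"

lemma top_symbol_gen: "top_symbol 1 (gen_symbol g) (gen g)"
  unfolding top_symbol_def act_gen
  by (cases g rule: gen_symbol.cases) (auto simp: degree_le_def tor_def algebra_simps)

text \<open>
  Symbols of series, coefficient by coefficient, with one degree for all coefficients.
\<close>

definition symbol_series :: "nat \<Rightarrow> free_alg fls \<Rightarrow> complex fls \<Rightarrow> bool" where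
  "symbol_series N F S \<longleftrightarrow> (\<forall>n. top_symbol N (fls_nth S n) (fls_nth F n))"

lemma symbol_series_0: "symbol_series N 0 0" by (simp add: symbol_series_def top_symbol_0)

lemma symbol_series_add: "symbol_series N F S \<Longrightarrow> symbol_series N F' S' \<Longrightarrow> symbol_series N (F + F') (S + S')"
  by (simp add: symbol_series_def top_symbol_add)

lemma symbol_series_diff: "symbol_series N F S \<Longrightarrow> symbol_series N F' S' \<Longrightarrow> symbol_series N (F - F') (S - S')"
  by (simp add: symbol_series_def top_symbol_diff)

lemma symbol_series_sum:
  "(\<And>i. i \<in> A \<Longrightarrow> symbol_series N (F i) (S i)) \<Longrightarrow> symbol_series N (sum F A) (sum S A)"
  by (induction A rule: infinite_finite_induct) (simp_all add: symbol_series_0 symbol_series_add)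

lemma symbol_series_scal: "symbol_series 0 (fls_scal f) f"
  by (simp add: symbol_series_def top_symbol_scal)

lemma symbol_series_Suc: "symbol_series N F S \<Longrightarrow> symbol_series (Suc N) F 0"
  unfolding symbol_series_def using top_symbol_Suc by fastforce

lemma symbol_series_mult:
  assumes "w \<noteq> 0" "symbol_series N F S" "symbol_series M F' S'"
  shows "symbol_series (N + M) (F * F') (S * S')"
  unfolding symbol_series_def
proof
  fix n
  let ?a = "min (fls_subdegree F) (fls_subdegree S)" and ?b = "min (fls_subdegree F') (fls_subdegree S')"
  have "fls_nth (F * F') n = (\<Sum>i=?a..n - ?b. fls_nth F i * fls_nth F' (n - i))"
    "fls_nth (S * S') n = (\<Sum>i=?a..n - ?b. fls_nth S i * fls_nth S' (n - i))"
    by (rule fls_times_nth_interval; simp)+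
  then show "top_symbol (N + M) (fls_nth (S * S') n) (fls_nth (F * F') n)"
    using assms by (auto simp: symbol_series_def intro!: top_symbol_sum top_symbol_mult)
qed

lemma symbol_series_scal_mult:
  "w \<noteq> 0 \<Longrightarrow> symbol_series N F S \<Longrightarrow> symbol_series N (fls_scal f * F) (f * S)"
  using symbol_series_mult[OF _ symbol_series_scal] by fastforce

lemma symbol_series_gen_ser:
  assumes w: "w \<noteq> 0" and q: "q \<noteq> 0" "q + inverse q \<noteq> 0" "a \<noteq> 0" and g: "\<And>k. gen_symbol (g (Suc k)) = 0"
  shows "symbol_series 1 (gen_ser q g (lin a)) (fls_const (gen_symbol (g 0)) * inverse (Ufun q (lin a)))"
  unfolding symbol_series_def
proof
  fix n
  let ?V = "inv_U_fps q (lin a)"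
  have V: "fls_nth (inverse (Ufun q (lin a))) n = (if n \<le> 0 then 0 else fps_nth ?V (nat n))"
    using inverse_Ufun_nth_eq_0[OF q, of n] by (simp add: inv_U_fps_def lin_def)
  show "top_symbol 1 (fls_nth (fls_const (gen_symbol (g 0)) * inverse (Ufun q (lin a))) n) (fls_nth (gen_ser q g (lin a)) n)"
  proof (cases "n \<le> 0")
    case True
    then have "fls_nth (gen_ser q g (lin a)) n = 0" by (simp add: gen_ser_nth)
    then show ?thesis using True by (simp add: V top_symbol_0)
  next
    case False
    then obtain m where m: "nat n = Suc m" by (cases "nat n") auto
    have "top_symbol 1 (\<Sum>k<nat n. gen_symbol (g k) * fps_nth (?V ^ Suc k) (nat n))
       (\<Sum>k<nat n. gen (g k) * scal (fps_nth (?V ^ Suc k) (nat n)))"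
      by (rule top_symbol_sum, use top_symbol_mult[OF w top_symbol_gen top_symbol_scal] in simp)
    also have "(\<Sum>k<nat n. gen_symbol (g k) * fps_nth (?V ^ Suc k) (nat n)) = gen_symbol (g 0) * fps_nth ?V (nat n)"
      unfolding m by (subst sum.lessThan_Suc_shift) (simp add: g)
    finally show ?thesis using False by (simp add: V gen_ser_nth)
  qed
qed

lemma symbol_series_Eop:
  assumes "w \<noteq> 0" "\<And>n. symbol_series N (\<phi> n) (\<phi>' n)"
  shows "symbol_series N (Eop fls_scal q J \<phi> a n) (Eop (\<lambda>f. f) q J \<phi>' a n)"
  using assms by (simp add: Eop_def symbol_series_scal_mult)

lemma symbol_series_right_op:
  assumes "w \<noteq> 0" "\<And>n m. n \<le> J \<Longrightarrow> m \<le> J \<Longrightarrow> symbol_series N (Y $$ (n, m)) (Y' $$ (n, m))"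
    "\<And>n. symbol_series M (\<psi> a n) (\<psi>' a n)" "n \<le> J"
  shows "symbol_series (N + M) (right_op J Y \<psi> a n) (right_op J Y' \<psi>' a n)"
  unfolding right_op_def using assms by (intro symbol_series_sum symbol_series_mult) auto

lemma symbol_series_Rop:
  assumes "w \<noteq> 0" "\<And>a n. n \<le> J \<Longrightarrow> symbol_series N (\<psi> a n) (\<psi>' a n)" "n \<le> J"
  shows "symbol_series N (Rop fls_scal q r J z \<psi> a n) (Rop (\<lambda>f. f) q r J z \<psi>' a n)"
proof -
  have "symbol_series N (fls_scal (Roff q J (Suc n)) * \<psi> 0 (Suc n)) (Roff q J (Suc n) * \<psi>' 0 (Suc n))"
    using assms by (cases "n = J") (simp_all add: symbol_series_0 symbol_series_scal_mult)
  then show ?thesis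
    using assms by (simp add: Rop_def symbol_series_scal_mult symbol_series_add)
qed

lemma symbol_series_left_op:
  assumes "w \<noteq> 0" "\<And>a b. a < 2 \<Longrightarrow> b < 2 \<Longrightarrow> symbol_series N (A $$ (a, b)) (A' $$ (a, b))"
    "\<And>b. symbol_series M (\<psi> b n) (\<psi>' b n)" "a < 2"
  shows "symbol_series (N + M) (left_op A \<psi> a n) (left_op A' \<psi>' a n)"
  unfolding left_op_def using assms by (intro symbol_series_add symbol_series_mult) auto

lemma symbol_series_Fop:
  assumes "w \<noteq> 0" "\<And>a n. a < 2 \<Longrightarrow> n \<le> J \<Longrightarrow> symbol_series N (\<psi> a n) (\<psi>' a n)" "i \<le> Suc J"
  shows "symbol_series N (Fop fls_scal q J \<psi> i) (Fop (\<lambda>f. f) q J \<psi>' i)"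
proof -
  have "symbol_series N (fls_scal (fls_const (Fa q J i)) * \<psi> 0 i) (fls_const (Fa q J i) * \<psi>' 0 i)"
    using assms by (cases "i = Suc J") (simp_all add: Fa_def symbol_series_0 symbol_series_scal_mult)
  then show ?thesis
    unfolding Fop_def using assms by (intro symbol_series_add symbol_series_scal_mult[of N "\<psi> 1 _"]) auto
qed

text \<open>
  Symbols are compatible with sums, products and scalars, so fusion commutes with taking symbols; each of the \<open>J\<close>
  K-operators in the fusion product adds one to the degree.
\<close>

lemma symbol_series_fused:
  assumes w: "w \<noteq> 0" and r: "r \<noteq> 0" and a: "a \<noteq> 0"
    and K: "\<And>x. K x \<in> carrier_mat 2 2" "\<And>x. K' x \<in> carrier_mat 2 2"
    and KK': "\<And>a i k. a \<noteq> 0 \<Longrightarrow> i < 2 \<Longrightarrow> k < 2 \<Longrightarrow> symbol_series 1 (K (lin a) $$ (i, k)) (K' (lin a) $$ (i, k))"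
    and ik: "i \<le> J" "k \<le> J"
  shows "symbol_series J (fused q r fls_scal K J (lin a) $$ (i, k)) (fused q r (\<lambda>f. f) K' J (lin a) $$ (i, k))"
  using a ik
proof (induction J arbitrary: a i k)
  case 0
  then show ?case using symbol_series_scal[of 1] by simp
next
  case (Suc J)
  let ?Y = "fused q r fls_scal K J (lin (a * r))" and ?Y' = "fused q r (\<lambda>f. f) K' J (lin (a * r))"
  let ?\<delta> = "\<lambda>n. if n = k then 1 else 0"
  have a': "a * r \<noteq> 0" "a * r powi (- int J) \<noteq> 0" using Suc.prems r by simp_all
  have \<delta>: "symbol_series 0 (?\<delta> n) (?\<delta> n)" for n
    using symbol_series_scal[of 1] symbol_series_0[of 0] by simp
  have E: "symbol_series 0 (Eop fls_scal q J ?\<delta> b n) (Eop (\<lambda>f. f) q J ?\<delta> b n)" for b n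
    by (rule symbol_series_Eop[OF w \<delta>])
  have Y: "symbol_series (J + 0) (right_op J ?Y (Eop fls_scal q J ?\<delta>) b n) (right_op J ?Y' (Eop (\<lambda>f. f) q J ?\<delta>) b n)"
    if "n \<le> J" for b n
    by (rule symbol_series_right_op[OF w _ _ that]) (rule Suc.IH[OF a'(1)], assumption+, rule E)
  have R: "symbol_series (J + 0) (Rop fls_scal q r J z (right_op J ?Y (Eop fls_scal q J ?\<delta>)) b n)
      (Rop (\<lambda>f. f) q r J z (right_op J ?Y' (Eop (\<lambda>f. f) q J ?\<delta>)) b n)" if "n \<le> J" for z b n
    by (rule symbol_series_Rop[OF w _ that]) (rule Y)
  have "symbol_series (1 + (J + 0)) (fusion_step fls_scal q r J (K (lin (a * r powi (- int J)))) ?Y z ?\<delta> b n)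
      (fusion_step (\<lambda>f. f) q r J (K' (lin (a * r powi (- int J)))) ?Y' z ?\<delta> b n)" if "b < 2" "n \<le> J" for z b n
    unfolding fusion_step_def by (rule symbol_series_left_op[OF w _ _ that(1)]) (rule KK'[OF a'(2)], assumption+, rule R[OF that(2)])
  then have "symbol_series (Suc J) (Fop fls_scal q J (fusion_step fls_scal q r J (K (lin (a * r powi (- int J)))) ?Y z ?\<delta>) i)
      (Fop (\<lambda>f. f) q J (fusion_step (\<lambda>f. f) q r J (K' (lin (a * r powi (- int J)))) ?Y' z ?\<delta>) i)" for z
    using Suc.prems by (intro symbol_series_Fop[OF w]) simp_all
  then show ?case
    using Suc.prems r
    by (subst (1 2) fused_Suc_index) (simp_all add: fls_scal.emb_mult K Rdiag_spectral_nz lin_mult_const)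
qed

end

section \<open>Corner entries of fused matrices\<close>

text \<open>
  All scalar factors in the corner entries have the form \<open>cfun y\<close>.
\<close>

lemma Rdiag_eq_cfun:
  shows "Rdiag r J z a n = cfun (z * fls_const (r powi (if a = 0 then 1 + (int J - 2 * int n) else 1 - (int J - 2 * int n))))"
proof -
  have "inverse (z * fls_const (r powi d)) = inverse z * fls_const (r powi (- d))" for d
    unfolding inverse_mult_distrib fls_inverse_const power_int_minus ..
  then show ?thesis unfolding Rdiag_def cfun_def Let_def by (simp only:)
qed

text \<open>
  A set of spectral parameters that is stable under the shifts in the recursion and on which no R-matrix entry vanishes.
  It covers the parameters \<open>a u\<close> of the K-operators and \<open>a u\<^sup>-\<^sup>1\<close> of the dual K-matrices.
\<close>

definition spectral_class :: "complex fls set \<Rightarrow> bool" where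
  "spectral_class X \<longleftrightarrow> (\<forall>x\<in>X. \<forall>c. c \<noteq> 0 \<longrightarrow> x * fls_const c \<in> X \<and> cfun (x^2 * fls_const c) \<noteq> 0)"

lemma spectral_classD:
  "spectral_class X \<Longrightarrow> x \<in> X \<Longrightarrow> c \<noteq> 0 \<Longrightarrow> x * fls_const c \<in> X"
  "spectral_class X \<Longrightarrow> x \<in> X \<Longrightarrow> c \<noteq> 0 \<Longrightarrow> cfun (x^2 * fls_const c) \<noteq> 0"
  unfolding spectral_class_def by blast+

lemma spectral_class_lin: "spectral_class (lin ` (- {0}))"
  unfolding spectral_class_def
proof (intro ballI allI impI conjI)
  fix x and c :: complex
  assume "x \<in> lin ` (- {0})" and c: "c \<noteq> 0"
  then obtain a where a: "x = lin a" "a \<noteq> 0" by auto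
  have "a * c \<in> - {0}" using a c by simp
  then show "x * fls_const c \<in> lin ` (- {0})" unfolding a(1) lin_mult_const by (rule imageI)
  show "cfun (x^2 * fls_const c) \<noteq> 0"
    using Rdiag_spectral_nz[OF a(2) one_neq_zero c] unfolding a(1) Rdiag_eq_cfun by simp
qed

lemma spectral_class_inverse_lin: "spectral_class ((\<lambda>a. inverse (lin a)) ` (- {0}))"
  unfolding spectral_class_def
proof (intro ballI allI impI conjI)
  fix x and c :: complex
  assume "x \<in> (\<lambda>a. inverse (lin a)) ` (- {0})" and c: "c \<noteq> 0"
  then obtain a where a: "x = inverse (lin a)" "a \<noteq> 0" by auto
  have "a * inverse c \<in> - {0}" using a c by simp
  then show "x * fls_const c \<in> (\<lambda>a. inverse (lin a)) ` (- {0})"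
    unfolding a(1) inverse_lin_mult_const[OF c] by (rule imageI)
  show "cfun (x^2 * fls_const c) \<noteq> 0"
    using Rdiag_inverse_spectral_nz[OF a(2) one_neq_zero c] unfolding a(1) Rdiag_eq_cfun by simp
qed

lemma ffun_nz:
  assumes "q \<noteq> 0"
  shows "ffun q J fls_X_inv \<noteq> 0"
proof -
  have c: "q powi m \<noteq> 0" for m using assms by simp
  have l: "fls_X_inv = lin 1" by (simp add: lin_def)
  have "lin 1 \<in> lin ` (- {0})" "inverse (lin 1) \<in> (\<lambda>a. inverse (lin a)) ` (- {0})" by (rule imageI, simp)+
  then have "cfun ((lin 1)^2 * fls_const (q powi m)) \<noteq> 0" "cfun ((inverse (lin 1))^2 * fls_const (q powi m)) \<noteq> 0" for m
    using spectral_classD(2)[OF spectral_class_lin _ c] spectral_classD(2)[OF spectral_class_inverse_lin _ c] by blast+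
  then show ?thesis unfolding ffun_def l prod_zero_iff[OF finite_atLeastAtMost] by (simp only: power_inverse[symmetric] mult_eq_0_iff bex_simps HOL.simp_thms not_False_eq_True prod_zero_iff[OF finite_atLeastAtMost]) simp
qed

context generic_q
begin

lemma Fb_top_nz: "Fb q J (Suc J) \<noteq> 0"
  using Fa_Fb[of "Suc J" J] by (auto simp: Fa_def)

lemma Fa_0_nz: "Fa q J 0 \<noteq> 0"
  using Fa_Fb[of 0 J] by auto

lemma Rdiag_nz: "spectral_class X \<Longrightarrow> x \<in> X \<Longrightarrow> Rdiag r J (x^2 * fls_const (r powi m)) a n \<noteq> 0"
  unfolding Rdiag_eq_cfun mult.assoc fls_const_mult_const
  by (rule spectral_classD(2)) (use r_nz in simp_all)

lemma Rfac_nz: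
  assumes "spectral_class X" "x \<in> X"
  shows "Rfac r J (x^2 * fls_const (r powi m)) \<noteq> 0"
proof -
  have "cfun (x^2 * fls_const (r powi m) * fls_const (r powi k)) \<noteq> 0" for k
    unfolding mult.assoc fls_const_mult_const
    by (rule spectral_classD(2)[OF assms]) (use r_nz in simp)
  then show ?thesis using Rdiag_nz[OF assms, of 0 m 0 0]
    by (simp only: Rfac_def prod_zero_iff[OF finite_lessThan] inverse_nonzero_iff_nonzero split: if_split) simp
qed

text \<open>
  A corner entry at spin \<open>(J + 1)/2\<close> arises in a single way, from the off-diagonal entry of the first K-matrix and the
  corner entry at spin \<open>J/2\<close>, through a diagonal entry of the R-matrix.
\<close>

lemma fused_corner_nz:
  assumes X: "spectral_class X" and K: "\<And>x. K x \<in> carrier_mat 2 2" and x: "x \<in> X"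
  shows "(\<And>x. x \<in> X \<Longrightarrow> K x $$ (1, 0) \<noteq> 0) \<Longrightarrow> fused q r (\<lambda>f. f) K J x $$ (J, 0) \<noteq> 0"
    and "(\<And>x. x \<in> X \<Longrightarrow> K x $$ (0, 1) \<noteq> 0) \<Longrightarrow> fused q r (\<lambda>f. f) K J x $$ (0, J) \<noteq> 0"
proof -
  have cl: "x * fls_const c \<in> X" if "x \<in> X" "c \<noteq> 0" for x c
    using X that by (simp add: spectral_class_def)
  show "fused q r (\<lambda>f. f) K J x $$ (J, 0) \<noteq> 0" if K10: "\<And>x. x \<in> X \<Longrightarrow> K x $$ (1, 0) \<noteq> 0"
    using x
  proof (induction J arbitrary: x)
    case (Suc J)
    let ?z = "x^2 * fls_const (r powi (1 - int J))" and ?K = "K (x * fls_const (r powi (- int J)))"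
      and ?Y = "fused q r (\<lambda>f. f) K J (x * fls_const r)"
    have ro: "right_op J ?Y (Eop (\<lambda>f. f) q J (\<lambda>n. if n = 0 then 1 else 0)) 0 n = ?Y $$ (n, 0)"
      "right_op J ?Y (Eop (\<lambda>f. f) q J (\<lambda>n. if n = 0 then 1 else 0)) 1 n = 0" for n
      unfolding right_op_def Eop_def by (subst sum.mono_neutral_right[of _ "{0}"]; simp)+
    have "fused q r (\<lambda>f. f) K (Suc J) x $$ (Suc J, 0) =
        fls_const (Fb q J (Suc J)) * (?K $$ (1, 0) * (Rfac r J ?z * (Rdiag r J ?z 0 J * ?Y $$ (J, 0))))"
      using Rdiag_nz[OF X Suc.prems]
      by (subst fused_Suc_index) (simp_all add: K Fop_def Fa_def fusion_step_def left_op_def Rop_def ro del: One_nat_def)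
    moreover have "?K $$ (1, 0) \<noteq> 0" by (rule K10[OF cl[OF Suc.prems]]) (use r_nz in simp)
    moreover have "?Y $$ (J, 0) \<noteq> 0" by (rule Suc.IH[OF cl[OF Suc.prems r_nz]])
    ultimately show ?case
      using Fb_top_nz[of J] Rfac_nz[OF X Suc.prems] Rdiag_nz[OF X Suc.prems]
      by (simp only: mult_eq_0_iff fls_const_0 fls_const_nonzero HOL.simp_thms not_False_eq_True)
  qed simp
  show "fused q r (\<lambda>f. f) K J x $$ (0, J) \<noteq> 0" if K01: "\<And>x. x \<in> X \<Longrightarrow> K x $$ (0, 1) \<noteq> 0"
    using x
  proof (induction J arbitrary: x)
    case (Suc J)
    let ?z = "x^2 * fls_const (r powi (1 - int J))" and ?K = "K (x * fls_const (r powi (- int J)))"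
      and ?Y = "fused q r (\<lambda>f. f) K J (x * fls_const r)"
    have ro: "right_op J ?Y (Eop (\<lambda>f. f) q J (\<lambda>n. if n = Suc J then 1 else 0)) 0 n = 0"
      "right_op J ?Y (Eop (\<lambda>f. f) q J (\<lambda>n. if n = Suc J then 1 else 0)) 1 n = ?Y $$ (n, J) * fls_const (Eb q J (Suc J))" for n
      unfolding right_op_def Eop_def by (subst sum.mono_neutral_right[of _ "{J}"]; simp)+
    have "fused q r (\<lambda>f. f) K (Suc J) x $$ (0, Suc J) =
        fls_const (Fa q J 0) * (?K $$ (0, 1) * (Rfac r J ?z * (Rdiag r J ?z 1 0 * (?Y $$ (0, J) * fls_const (Eb q J (Suc J))))))"
      using Rdiag_nz[OF X Suc.prems]
      by (subst fused_Suc_index) (simp_all add: K Fop_def Fb_def fusion_step_def left_op_def Rop_def ro del: One_nat_def)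
    moreover have "?K $$ (0, 1) \<noteq> 0" by (rule K01[OF cl[OF Suc.prems]]) (use r_nz in simp)
    moreover have "?Y $$ (0, J) \<noteq> 0" by (rule Suc.IH[OF cl[OF Suc.prems r_nz]])
    moreover have "Eb q J (Suc J) \<noteq> 0" by (rule Eb_nz) simp_all
    ultimately show ?case
      using Fa_0_nz[of J] Rfac_nz[OF X Suc.prems] Rdiag_nz[OF X Suc.prems]
      by (simp only: mult_eq_0_iff fls_const_0 fls_const_nonzero HOL.simp_thms not_False_eq_True)
  qed simp
qed

text \<open>
  If each spin 1/2 factor strictly lowers (or raises) the weight, the fused matrix changes the weight by the maximal
  amount.
\<close>

lemma fused_only_corner:
  assumes X: "spectral_class X" and K: "\<And>x. K x \<in> carrier_mat 2 2" and x: "x \<in> X" and ik: "i \<le> J" "k \<le> J"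
    and K0: "\<And>x. x \<in> X \<Longrightarrow> K x $$ (0, 0) = 0 \<and> K x $$ (1, 1) = 0"
  shows "(\<And>x. x \<in> X \<Longrightarrow> K x $$ (0, 1) = 0) \<Longrightarrow> (i, k) \<noteq> (J, 0) \<Longrightarrow> fused q r (\<lambda>f. f) K J x $$ (i, k) = 0"
    and "(\<And>x. x \<in> X \<Longrightarrow> K x $$ (1, 0) = 0) \<Longrightarrow> (i, k) \<noteq> (0, J) \<Longrightarrow> fused q r (\<lambda>f. f) K J x $$ (i, k) = 0"
proof -
  have cl: "x * fls_const c \<in> X" if "x \<in> X" "c \<noteq> 0" for x c
    using X that by (simp add: spectral_class_def)
  show "fused q r (\<lambda>f. f) K J x $$ (i, k) = 0" if K01: "\<And>x. x \<in> X \<Longrightarrow> K x $$ (0, 1) = 0" and "(i, k) \<noteq> (J, 0)"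
    using x ik that(2)
  proof (induction J arbitrary: x i k)
    case (Suc J)
    let ?z = "x^2 * fls_const (r powi (1 - int J))" and ?K = "K (x * fls_const (r powi (- int J)))"
      and ?Y = "fused q r (\<lambda>f. f) K J (x * fls_const r)"
    let ?ro = "right_op J ?Y (Eop (\<lambda>f. f) q J (\<lambda>n. if n = k then 1 else 0))"
    have xr: "x * fls_const r \<in> X" "x * fls_const (r powi (- int J)) \<in> X" using cl[OF Suc.prems(1)] r_nz by simp_all
    have Y: "?Y $$ (n, m) = 0" if "n \<le> J" "m \<le> J" "(n, m) \<noteq> (J, 0)" for n m
      by (rule Suc.IH[OF xr(1) that])
    have ro: "?ro a n = 0" if "n < J" for a n
      using that Y by (auto simp: right_op_def intro!: sum.neutral)
    have ro0: "?ro 0 J = 0" if "k \<noteq> 0"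
      unfolding right_op_def by (rule sum.neutral) (use that Y in \<open>auto simp: Eop_def\<close>)
    have *: "Roff q J n * ?ro 1 (n - 1) = 0" if "n \<le> J" for n
      using ro[of "n - 1" 1] that by (cases n) simp_all
    have Z: "Rop (\<lambda>f. f) q r J ?z ?ro 0 n = 0" if "n \<le> J" "n \<noteq> J \<or> k \<noteq> 0" for n
      using that ro[of n 0] ro0 *[OF that(1)] by (cases "n = J") (simp_all add: Rop_def del: One_nat_def)
    have "Fb q J i = 0 \<or> i - 1 \<le> J \<and> (i - 1 \<noteq> J \<or> k \<noteq> 0)"
      using Suc.prems by (cases i) (auto simp: Fb_def)
    then have "fls_const (Fb q J i) * (?K $$ (1, 0) * Rop (\<lambda>f. f) q r J ?z ?ro 0 (i - 1)) = 0"
      using Z by auto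
    then show ?case
      using Rdiag_nz[OF X Suc.prems(1)] Suc.prems K0[OF xr(2)] K01[OF xr(2)]
      by (subst fused_Suc_index) (simp_all add: K Fop_def fusion_step_def left_op_def del: One_nat_def)
  qed simp
  show "fused q r (\<lambda>f. f) K J x $$ (i, k) = 0" if K10: "\<And>x. x \<in> X \<Longrightarrow> K x $$ (1, 0) = 0" and "(i, k) \<noteq> (0, J)"
    using x ik that(2)
  proof (induction J arbitrary: x i k)
    case (Suc J)
    let ?z = "x^2 * fls_const (r powi (1 - int J))" and ?K = "K (x * fls_const (r powi (- int J)))"
      and ?Y = "fused q r (\<lambda>f. f) K J (x * fls_const r)"
    let ?ro = "right_op J ?Y (Eop (\<lambda>f. f) q J (\<lambda>n. if n = k then 1 else 0))"
    have xr: "x * fls_const r \<in> X" "x * fls_const (r powi (- int J)) \<in> X" using cl[OF Suc.prems(1)] r_nz by simp_all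
    have Y: "?Y $$ (n, m) = 0" if "n \<le> J" "m \<le> J" "(n, m) \<noteq> (0, J)" for n m
      by (rule Suc.IH[OF xr(1) that])
    have ro: "?ro a n = 0" if "0 < n" "n \<le> J" for a n
      using that Y by (auto simp: right_op_def intro!: sum.neutral)
    have ro1: "?ro 1 0 = 0" if "k \<noteq> Suc J"
      unfolding right_op_def by (rule sum.neutral) (use that Y in \<open>auto simp: Eop_def\<close>)
    have *: "Roff q J (Suc n) * ?ro 0 (Suc n) = 0" if "n \<le> J" for n
      using ro[of "Suc n" 0] that by (cases "n = J") simp_all
    have Z: "Rop (\<lambda>f. f) q r J ?z ?ro 1 n = 0" if "n \<le> J" "n \<noteq> 0 \<or> k \<noteq> Suc J" for n
      using that ro[of n 1] ro1 *[OF that(1)] by (cases "n = 0") (simp_all add: Rop_def del: One_nat_def)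
    have "Fa q J i = 0 \<or> i \<le> J \<and> (i \<noteq> 0 \<or> k \<noteq> Suc J)"
      using Suc.prems by (auto simp: Fa_def)
    then have "fls_const (Fa q J i) * (?K $$ (0, 1) * Rop (\<lambda>f. f) q r J ?z ?ro 1 i) = 0"
      using Z by auto
    then show ?case
      using Rdiag_nz[OF X Suc.prems(1)] Suc.prems K0[OF xr(2)] K10[OF xr(2)]
      by (subst fused_Suc_index) (simp_all add: K Fop_def fusion_step_def left_op_def del: One_nat_def)
  qed simp
qed

end

section \<open>The symbol of the transfer matrix\<close>

context torus_rep
begin

text \<open>
  Both products are applied to the indicator function of the origin and evaluated at \<open>(N, N + 1)\<close>, where the terms with
  \<open>Y\<close> contribute, and at \<open>(N + 1, N)\<close>, where those with \<open>X\<close> do. The translation by \<open>(N, N)\<close> commutes with \<open>X\<close> and \<open>Y\<close>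
  up to a power of \<open>w\<close>.
\<close>

lemma symbol_commutator_coefficients:
  assumes w: "w \<noteq> 0" and x: "top_symbol N c x" and v: "v = scal ep * gen (Wneg 0) + scal em * gen (Wpos 0)"
    and comm: "\<And>f a b. act (x * v - v * x) f a b = 0"
  shows "c * ep * mu * (w powi (- int N) - w powi int N) = 0"
    and "c * em * mu * (w powi int N - w powi (- int N)) = 0"
proof -
  define \<delta> :: state where "\<delta> = (\<lambda>a b. if a = 0 \<and> b = 0 then 1 else 0)"
  have d0: "degree_le 0 \<delta>" by (auto simp: degree_le_def \<delta>_def)
  have v': "act v f a b = mu * (ep * (w powi a * f a (b - 1) + w powi (- a) * f a (b + 1))
      + em * (w powi (- b) * f (a - 1) b + w powi b * f (a + 1) b))" for f a b
    unfolding v by (simp add: act_add act_mult act_scal act_gen tor_def algebra_simps)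
  have d1: "degree_le 1 (act v \<delta>)" by (auto simp: degree_le_def v' \<delta>_def)
  have xd: "act x \<delta> a b = (if a = int N \<and> b = int N then c else 0)" if "2 * int N \<le> a + b" for a b
    using top_symbolD[OF x d0, of a b] that by (auto simp: tor_def \<delta>_def)
  have xv: "act x (act v \<delta>) a b = act v (act x \<delta>) a b" for a b
    using comm[of \<delta> a b] by (simp add: act_diff act_mult)
  have top: "act x (act v \<delta>) a b = c * (w powi (int N * (a - b)) * act v \<delta> (a - int N) (b - int N))"
    if "1 + 2 * int N \<le> a + b" for a b
    using top_symbolD[OF x d1, of a b] that by (simp add: tor_def algebra_simps)
  have "c * (w powi (- int N) * (mu * ep)) = mu * (ep * (w powi int N * c))"
    using top[of "int N" "int N + 1"] xv[of "int N" "int N + 1"]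
    by (simp add: v' xd) (auto simp: \<delta>_def)
  then show "c * ep * mu * (w powi (- int N) - w powi int N) = 0" by (simp add: algebra_simps)
  have "c * (w powi (int N) * (mu * em)) = mu * (em * (w powi (- int N) * c))"
    using top[of "int N + 1" "int N"] xv[of "int N + 1" "int N"]
    by (simp add: v' xd) (auto simp: \<delta>_def)
  then show "c * em * mu * (w powi int N - w powi (- int N)) = 0" by (simp add: algebra_simps)
qed

text \<open>
  The symbol of degree 1 of the fundamental K-operator. The diagonal entries involve the generators \<open>W\<close>
  alone, and the scalar terms have smaller degree.
\<close>

definition Khalf_symbol :: "complex \<Rightarrow> complex \<Rightarrow> complex fls \<Rightarrow> complex fls mat" where
  "Khalf_symbol kp km x = mat_of_rows_list 2
     [[0, fls_const (1 / (km * (q + inverse q))) * (fls_const (gen_symbol (Gen_G 0)) * inverse (Ufun q x))],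
      [fls_const (1 / (kp * (q + inverse q))) * (fls_const (gen_symbol (Gen_Gt 0)) * inverse (Ufun q x)), 0]]"

lemma Khalf_symbol_index:
  "Khalf_symbol kp km x $$ (0, 0) = 0"
  "Khalf_symbol kp km x $$ (0, 1) = fls_const (1 / (km * (q + inverse q))) * (fls_const (gen_symbol (Gen_G 0)) * inverse (Ufun q x))"
  "Khalf_symbol kp km x $$ (1, 0) = fls_const (1 / (kp * (q + inverse q))) * (fls_const (gen_symbol (Gen_Gt 0)) * inverse (Ufun q x))"
  "Khalf_symbol kp km x $$ (1, 1) = 0"
  by (simp_all add: Khalf_symbol_def mat_of_rows_list_def del: fls_const_mult_const gen_symbol.simps)

lemma Khalf_symbol_carrier: "Khalf_symbol kp km x \<in> carrier_mat 2 2"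
  by (rule carrier_matI) (simp_all add: Khalf_symbol_def mat_of_rows_list_def)

lemma symbol_series_Kop_half:
  assumes g: "generic_q q r" and w: "w \<noteq> 0" and a: "a \<noteq> 0" and ik: "i < 2" "k < 2"
  shows "symbol_series 1 (Kop_half q kp km (lin a) $$ (i, k)) (Khalf_symbol kp km (lin a) $$ (i, k))"
proof -
  interpret generic_q q r by fact
  note gs = symbol_series_gen_ser[OF w q_nz q_sum_nz a]
  have G: "symbol_series 1 (gen_ser q Gen_G (lin a)) (fls_const (gen_symbol (Gen_G 0)) * inverse (Ufun q (lin a)))"
    "symbol_series 1 (gen_ser q Gen_Gt (lin a)) (fls_const (gen_symbol (Gen_Gt 0)) * inverse (Ufun q (lin a)))"
    by (rule gs, simp)+
  have W: "symbol_series 1 (gen_ser q Wneg (lin a)) 0" "symbol_series 1 (gen_ser q Wpos (lin a)) 0"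
    using gs[of Wneg] gs[of Wpos] by simp_all
  have c: "symbol_series 1 (sc t) 0" for t
    using symbol_series_Suc[OF symbol_series_scal] by simp
  have D: "symbol_series 1 (fls_scal f * gen_ser q Wneg (lin a) - fls_scal h * gen_ser q Wpos (lin a)) 0"
    "symbol_series 1 (fls_scal f * gen_ser q Wpos (lin a) - fls_scal h * gen_ser q Wneg (lin a)) 0" for f h
    using symbol_series_diff[OF symbol_series_scal_mult[OF w W(1)] symbol_series_scal_mult[OF w W(2)]]
      symbol_series_diff[OF symbol_series_scal_mult[OF w W(2)] symbol_series_scal_mult[OF w W(1)]] by simp_all
  have O: "symbol_series 1 (sc s * gen_ser q Gen_G (lin a) + sc t) (fls_const s * (fls_const (gen_symbol (Gen_G 0)) * inverse (Ufun q (lin a))))"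
    "symbol_series 1 (sc s * gen_ser q Gen_Gt (lin a) + sc t) (fls_const s * (fls_const (gen_symbol (Gen_Gt 0)) * inverse (Ufun q (lin a))))" for s t
    using symbol_series_add[OF symbol_series_scal_mult[OF w G(1)] c] symbol_series_add[OF symbol_series_scal_mult[OF w G(2)] c]
    by (simp_all del: fls_const_mult_const gen_symbol.simps)
  consider "i = 0" "k = 0" | "i = 0" "k = 1" | "i = 1" "k = 0" | "i = 1" "k = 1" using ik by linarith
  then show ?thesis
  proof cases
    case 1
    then show ?thesis unfolding 1 Khalf_symbol_index Kop_half_index by (intro D)
  next
    case 2
    then show ?thesis unfolding 2 Khalf_symbol_index unfolding One_nat_def Kop_half_index unfolding One_nat_def[symmetric] by (intro O)
  next
    case 3
    then show ?thesis unfolding 3 Khalf_symbol_index unfolding One_nat_def Kop_half_index unfolding One_nat_def[symmetric] by (intro O)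
  next
    case 4
    then show ?thesis unfolding 4 Khalf_symbol_index unfolding One_nat_def Kop_half_index unfolding One_nat_def[symmetric] by (intro D)
  qed
qed

end

context generic_q
begin

lemma q_powi_nz: "1 \<le> N \<Longrightarrow> q powi int N - q powi (- int N) \<noteq> 0"
  using qnum_nz[of N] by (auto simp: qnum_def)

lemma symbol_commutator:
  assumes w: "w = q \<or> w = inverse q" and mu: "mu^2 = - (kp * km) / (q - inverse q)^2" and k: "kp \<noteq> 0" "km \<noteq> 0"
    and e: "ep \<noteq> 0 \<or> em \<noteq> 0" and N: "1 \<le> N" and x: "torus_rep.top_symbol q w mu N c x"
    and comm: "x * (scal ep * gen (Wneg 0) + scal em * gen (Wpos 0)) - (scal ep * gen (Wneg 0) + scal em * gen (Wpos 0)) * x \<in> aq_ideal q kp km"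
  shows "c = 0"
proof -
  have mu0: "mu \<noteq> 0" using mu k q_diff_nz by auto
  have w0: "w \<noteq> 0" using w q_nz by auto
  have "w powi int N - w powi (- int N) \<noteq> 0"
    using w q_powi_nz[OF N] by (auto simp: power_int_minus power_inverse)
  moreover have "c * ep * mu * (w powi (- int N) - w powi int N) = 0" "c * em * mu * (w powi int N - w powi (- int N)) = 0"
    by (rule torus_rep.symbol_commutator_coefficients[OF w0 x refl torus_rep.aq_ideal_act[OF q_nz q_sum_nz q_diff_nz w mu comm]])+
  ultimately show ?thesis using mu0 e by auto
qed

lemma Ksc_half_off_nz:
  assumes "spectral_class X" "x \<in> X"
  shows "km \<noteq> 0 \<Longrightarrow> Ksc_half q ep em kp km x $$ (1, 0) \<noteq> 0" "kp \<noteq> 0 \<Longrightarrow> Ksc_half q ep em kp km x $$ (0, 1) \<noteq> 0"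
  using spectral_classD(2)[OF assms, of 1] q_diff_nz by (simp_all add: Ksc_half_index)

text \<open>
  Only one term of the trace has a nonzero symbol, the product of a corner entry of the dual K-matrix with a corner entry of
  the symbol of the K-operator.
\<close>

lemma transfer_not_central:
  assumes k: "kp \<noteq> 0" "km \<noteq> 0" and e: "ebp \<noteq> 0 \<or> ebm \<noteq> 0" and J: "1 \<le> J" and kb: "kbp \<noteq> 0 \<or> kbm \<noteq> 0"
  defines "T \<equiv> mat_trace (map_mat fls_scal (Kdual q r ebp ebm kbp kbm J fls_X_inv) * Kop q r kp km J fls_X_inv)"
  defines "v \<equiv> scal ebp * gen (Wneg 0) + scal ebm * gen (Wpos 0)"
  shows "\<exists>n. fls_nth T n * v - v * fls_nth T n \<notin> aq_ideal q kp km"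
proof -
  define mu where "mu = csqrt (- (kp * km) / (q - inverse q)^2)"
  have mu: "mu^2 = - (kp * km) / (q - inverse q)^2" by (simp add: mu_def)
  have mu0: "mu \<noteq> 0" using mu k q_diff_nz by auto
  \<comment> \<open>the lower left corner of \<open>D\<close> is a nonzero multiple of \<open>kbp ^ J\<close>, and for \<open>w = q\<close> the symbol is nonzero there; the upper right corner goes with \<open>kbm\<close> and \<open>w = inverse q\<close>\<close>
  define w where "w = (if kbp \<noteq> 0 then q else inverse q)"
  have w: "w = q \<or> w = inverse q" "w \<noteq> 0" using q_nz by (auto simp: w_def)
  interpret R: torus_rep q w mu .
  define \<kappa> where "\<kappa> = fused q r (\<lambda>f. f) (R.Khalf_symbol kp km) J (lin 1)"
  define D where "D = Ksc q r ebm ebp (- kbm) (- kbp) J (inverse (lin q))"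
  define S where "S = (\<Sum>i\<le>J. \<Sum>k\<le>J. inverse (ffun q J fls_X_inv) * D $$ (k, i) * \<kappa> $$ (k, i))"
  have TS: "R.symbol_series J T S"
    unfolding T_def S_def transfer_trace D_def[symmetric]
  proof (intro R.symbol_series_sum R.symbol_series_scal_mult w(2))
    fix i k assume "i \<in> {..J}" "k \<in> {..J}"
    then show "R.symbol_series J (Kop q r kp km J (lin 1) $$ (k, i)) (\<kappa> $$ (k, i))"
      unfolding Kop_def \<kappa>_def
      by (intro R.symbol_series_fused w(2) r_nz one_neq_zero Kop_half_carrier R.Khalf_symbol_carrier
          R.symbol_series_Kop_half[OF generic_q_axioms]) auto
  qed
  have X1: "lin 1 \<in> lin ` (- {0})" by (rule imageI) simp
  have Xq: "inverse (lin q) \<in> (\<lambda>a. inverse (lin a)) ` (- {0})" by (rule imageI) (use q_nz in simp)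
  have U: "inverse (Ufun q x) \<noteq> 0" if "x \<in> lin ` (- {0})" for x
    using that Ufun_nz[OF q_nz q_sum_nz] by auto
  have q4: "q * q - inverse (q * q) \<noteq> 0" using q_powi_nz[of 2] by (simp add: power_int_minus power2_eq_square)
  note corner = fused_corner_nz[OF spectral_class_lin R.Khalf_symbol_carrier X1] fused_only_corner[OF spectral_class_lin R.Khalf_symbol_carrier X1]
  note cornerD = fused_corner_nz[OF spectral_class_inverse_lin Ksc_half_carrier Xq]
  have "\<exists>k0\<le>J. \<exists>i0\<le>J. (\<forall>k\<le>J. \<forall>i\<le>J. (k, i) \<noteq> (k0, i0) \<longrightarrow> \<kappa> $$ (k, i) = 0) \<and> \<kappa> $$ (k0, i0) \<noteq> 0 \<and> D $$ (k0, i0) \<noteq> 0"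
  proof (cases "kbp = 0")
    case False
    then have wq: "w = q" by (simp add: w_def)
    have G: "R.gen_symbol (Gen_G 0) = 0" "R.gen_symbol (Gen_Gt 0) \<noteq> 0"
      unfolding R.gen_symbol.simps unfolding wq using mu0 q4 q_nz by simp_all
    have "\<kappa> $$ (J, 0) \<noteq> 0"
      unfolding \<kappa>_def by (rule corner(1)) (use G U k q_sum_nz in \<open>simp_all add: R.Khalf_symbol_index del: R.gen_symbol.simps One_nat_def\<close>)
    moreover have "\<kappa> $$ (k, i) = 0" if "k \<le> J" "i \<le> J" "(k, i) \<noteq> (J, 0)" for k i
      unfolding \<kappa>_def by (rule corner(3)) (use that G in \<open>simp_all add: R.Khalf_symbol_index del: R.gen_symbol.simps One_nat_def\<close>)
    moreover have "D $$ (J, 0) \<noteq> 0"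
      unfolding D_def Ksc_def by (rule cornerD(1), rule Ksc_half_off_nz(1)[OF spectral_class_inverse_lin]) (use False in simp_all)
    ultimately show ?thesis by blast
  next
    case True
    then have wq: "w = inverse q" and kbm: "kbm \<noteq> 0" using kb by (simp_all add: w_def)
    have G: "R.gen_symbol (Gen_Gt 0) = 0" "R.gen_symbol (Gen_G 0) \<noteq> 0"
      unfolding R.gen_symbol.simps unfolding wq using mu0 q4 q_nz by (simp_all add: divide_inverse)
    have "\<kappa> $$ (0, J) \<noteq> 0"
      unfolding \<kappa>_def by (rule corner(2)) (use G U k q_sum_nz in \<open>simp_all add: R.Khalf_symbol_index del: R.gen_symbol.simps One_nat_def\<close>)
    moreover have "\<kappa> $$ (k, i) = 0" if "k \<le> J" "i \<le> J" "(k, i) \<noteq> (0, J)" for k i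
      unfolding \<kappa>_def by (rule corner(4)) (use that G in \<open>simp_all add: R.Khalf_symbol_index del: R.gen_symbol.simps One_nat_def\<close>)
    moreover have "D $$ (0, J) \<noteq> 0"
      unfolding D_def Ksc_def by (rule cornerD(2), rule Ksc_half_off_nz(2)[OF spectral_class_inverse_lin]) (use kbm in simp_all)
    ultimately show ?thesis by blast
  qed
  then obtain k0 i0 where k0: "k0 \<le> J" "i0 \<le> J" and zero: "\<And>k i. k \<le> J \<Longrightarrow> i \<le> J \<Longrightarrow> (k, i) \<noteq> (k0, i0) \<Longrightarrow> \<kappa> $$ (k, i) = 0"
    and nz: "\<kappa> $$ (k0, i0) \<noteq> 0" "D $$ (k0, i0) \<noteq> 0" by blast
  have "S = (\<Sum>i\<le>J. if i = i0 then inverse (ffun q J fls_X_inv) * D $$ (k0, i0) * \<kappa> $$ (k0, i0) else 0)"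
    unfolding S_def
  proof (rule sum.cong)
    fix i assume i: "i \<in> {..J}"
    have "(\<Sum>k\<le>J. inverse (ffun q J fls_X_inv) * D $$ (k, i) * \<kappa> $$ (k, i)) =
      (\<Sum>k\<le>J. if k = k0 then (if i = i0 then inverse (ffun q J fls_X_inv) * D $$ (k0, i0) * \<kappa> $$ (k0, i0) else 0) else 0)"
      by (rule sum.cong) (use i zero in auto)
    then show "(\<Sum>k\<le>J. inverse (ffun q J fls_X_inv) * D $$ (k, i) * \<kappa> $$ (k, i)) =
      (if i = i0 then inverse (ffun q J fls_X_inv) * D $$ (k0, i0) * \<kappa> $$ (k0, i0) else 0)"
      using k0 by simp
  qed simp
  then have "S = inverse (ffun q J fls_X_inv) * D $$ (k0, i0) * \<kappa> $$ (k0, i0)" using k0 by simp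
  then have "S \<noteq> 0" using nz ffun_nz[OF q_nz] by simp
  then obtain n where n: "fls_nth S n \<noteq> 0" by (metis fls_eqI fls_zero_nth)
  have "R.top_symbol J (fls_nth S n) (fls_nth T n)" using TS by (simp add: R.symbol_series_def)
  then have "fls_nth T n * v - v * fls_nth T n \<notin> aq_ideal q kp km"
    using symbol_commutator[OF w(1) mu k e J] n unfolding v_def by blast
  then show ?thesis by blast
qed

end

theorem proposition6p5:
  fixes q r kp km ebp ebm kbp kbm :: complex and J :: nat
  assumes "q \<noteq> 0" and "\<And>n::nat. n \<ge> 1 \<Longrightarrow> q ^ n \<noteq> 1"
    and "r ^ 2 = q"
    and "kp \<noteq> 0" and "km \<noteq> 0"
    and "J \<ge> 1"
    and "ebp \<noteq> 0 \<or> ebm \<noteq> 0"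
  shows "ser_comm (Aq q kp km) (transfer q r kp km ebp ebm kbp kbm J)
             (aq_proj q kp km (scal ebp * gen (Wneg 0) + scal ebm * gen (Wpos 0)))
           = (\<lambda>_. \<zero>\<^bsub>Aq q kp km\<^esub>)
         \<longleftrightarrow> kbp = 0 \<and> kbm = 0"
proof -
  interpret generic_q q r using assms by unfold_locales auto
  let ?v = "scal ebp * gen (Wneg 0) + scal ebm * gen (Wpos 0)"
  define T where "T = mat_trace (map_mat fls_scal (Kdual q r ebp ebm kbp kbm J fls_X_inv) * Kop q r kp km J fls_X_inv)"
  have "ser_comm (Aq q kp km) (transfer q r kp km ebp ebm kbp kbm J) (aq_proj q kp km ?v) = (\<lambda>_. \<zero>\<^bsub>Aq q kp km\<^esub>)
    \<longleftrightarrow> (\<forall>n. fls_nth T n * ?v - ?v * fls_nth T n \<in> aq_ideal q kp km)"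
    unfolding ser_comm_def transfer_def aq_ser_def T_def[symmetric] aq_proj_commutator fun_eq_iff aq_proj_eq_zero_iff ..
  also have "\<dots> \<longleftrightarrow> kbp = 0 \<and> kbm = 0"
  proof
    assume "\<forall>n. fls_nth T n * ?v - ?v * fls_nth T n \<in> aq_ideal q kp km"
    then show "kbp = 0 \<and> kbm = 0"
      using transfer_not_central[OF assms(4,5,7,6), of kbp kbm] unfolding T_def[symmetric] by blast
  next
    assume "kbp = 0 \<and> kbm = 0"
    then have "T * fls_const ?v - fls_const ?v * T \<in> aq_null q kp km"
      using transfer_commutes[OF assms(4,5,7), of J] by (simp add: T_def)
    then show "\<forall>n. fls_nth T n * ?v - ?v * fls_nth T n \<in> aq_ideal q kp km"
      by (simp add: aq_null_def)
  qed
  finally show ?thesis .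
qed

end
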